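(* Let $\theta$ be an inner automorphism of $\mathfrak{gl}(\mathbb V)$ of order $m$ with multiplicities vector $\hat r=(1,r_1,\ldots,r_{m-2},r_{m-1})$ (so $r_0=1$). Suppose that $\hat r$ has no substring of three consecutive entries $r_i,r_{i+1},r_{i+2}$ all of which are larger than $1$. Then $\theta$ has GIB.
   Context: $\mathbb F$ is an algebraically closed field of characteristic zero. For a Lie algebra $\mathfrak q$ and a finite-dimensional $\mathfrak q$-module $V$, the index is $\mathrm{ind}(\mathfrak q,V)=\dim V-\max_{\xi\in V^*}\dim(\mathfrak q\cdot\xi)$. Let $Q$ be an algebraic group with $\mathfrak q=\mathrm{Lie}\,Q$ and $V$ a finite-dimensional $Q$-module; $\mathfrak q_v=\{x\in\mathfrak q\mid x\cdot v=0\}$. The pair $(Q,V)$ has GIB (good index behaviour) if $\mathrm{ind}(\mathfrak q,V^* )=\mathrm{ind}(\mathfrak q_v,(V/\mathfrak q\cdot v)^* )$ for every $v\in V$. Inner automorphisms of $\mathfrak g=\mathfrak{gl}(\mathbb V)$, where $\mathbb V$ is a finite-dimensional vector space over $\mathbb F$: fix a primitive $m$-th root of unity $\zeta$. A vector $\hat r=(r_0,\dots,r_{m-1})$ of non-negative integers with $\sum r_t=\dim\mathbb V$ (the multiplicities vector) defines the inner automorphism $\theta$ of $\mathfrak g$ given by conjugation by the diagonalisable element of $\mathrm{GL}(\mathbb V)$ that acts as $\zeta^t$ on $\mathbb V_t$, where $\mathbb V=\bigoplus_t\mathbb V_t$ and $\dim\mathbb V_t=r_t$. Let $\mathfrak g=\bigoplus_{i\in\mathbb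 Z/m\mathbb Z}\mathfrak g_i$ be the corresponding grading, $\mathfrak g_i$ being the $\zeta^i$-eigenspace of $\theta$; then $\mathfrak g_1=\bigoplus_{i}\mathrm{Hom}(\mathbb V_i,\mathbb V_{i+1})$ (indices modulo $m$), and $G_0=\mathrm{GL}(\mathbb V_0)\times\dots\times\mathrm{GL}(\mathbb V_{m-1})$ acts on $\mathfrak g_1$ by restriction of the adjoint action. One says $\theta$ has GIB if the pair $(G_0,\mathfrak g_1)$ has GIB. *)

theory Defs
  imports
    "HOL-Computational_Algebra.Computational_Algebra"
    "HOL-Library.Function_Algebras"
    "HOL-Library.Set_Algebras"
begin

definition pscale :: "('a \<Rightarrow> 'b \<Rightarrow> 'b) \<Rightarrow> 'a \<Rightarrow> ('w \<Rightarrow> 'b) \<Rightarrow> 'w \<Rightarrow> 'b" where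
  "pscale sc c f = (\<lambda>w. sc c (f w))"


section \<open>Dual and quotient modules\<close>

text \<open>
  A module over a set \<open>q\<close> of operators is given by a carrier, an addition, a scalar
  multiplication and an action. Addition and scalar multiplication are explicit arguments of
  \<open>dual_space\<close> so that it applies both to a subspace of a vector space (with \<open>(+)\<close> and the ambient
  scalar multiplication) and to a quotient, whose elements are cosets. Functionals on a carrier
  are extended by \<open>0\<close> outside it, so that a dual space is always a subspace of a function space
  and the library notion of dimension applies to it.
\<close>

definition dual_space ::
    "('a::field \<Rightarrow> 'w \<Rightarrow> 'w) \<Rightarrow> ('w \<Rightarrow> 'w \<Rightarrow> 'w) \<Rightarrow> 'w set \<Rightarrow> ('w \<Rightarrow> 'a) set" where
  "dual_space sm add C =
     {f. (\<forall>u\<in>C. \<forall>w\<in>C. f (add u w) = f u + f w) \<and>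
         (\<forall>c. \<forall>w\<in>C. f (sm c w) = c * f w) \<and>
         (\<forall>w. w \<notin> C \<longrightarrow> f w = 0)}"

definition dual_act ::
    "('l \<Rightarrow> 'w \<Rightarrow> 'w) \<Rightarrow> 'w set \<Rightarrow> 'l \<Rightarrow> ('w \<Rightarrow> 'a::field) \<Rightarrow> 'w \<Rightarrow> 'a" where
  "dual_act act C x f = (\<lambda>w. if w \<in> C then - f (act x w) else 0)"

definition quot_space :: "'w::ab_group_add set \<Rightarrow> 'w set \<Rightarrow> 'w set set" where
  "quot_space M N = (\<lambda>w. {w} + N) ` M"

text \<open>
  In both definitions below the summand \<open>N\<close> turns the image of a coset, which may be smaller than
  a coset (\<open>{0}\<close> for \<open>c = 0\<close>), into a full coset. The sum of two cosets is their sum as sets.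
\<close>

definition quot_smult ::
    "('a \<Rightarrow> 'w \<Rightarrow> 'w) \<Rightarrow> 'w::ab_group_add set \<Rightarrow> 'a \<Rightarrow> 'w set \<Rightarrow> 'w set" where
  "quot_smult sc N c A = sc c ` A + N"

definition quot_act ::
    "('l \<Rightarrow> 'w \<Rightarrow> 'w) \<Rightarrow> 'w::ab_group_add set \<Rightarrow> 'l \<Rightarrow> 'w set \<Rightarrow> 'w set" where
  "quot_act act N x A = act x ` A + N"


section \<open>Index and good index behaviour\<close>

definition orbit_space :: "('l \<Rightarrow> 'w \<Rightarrow> 'w) \<Rightarrow> 'l set \<Rightarrow> 'w \<Rightarrow> 'w set" where
  "orbit_space act q w = (\<lambda>x. act x w) ` q"

definition annihilator :: "('l \<Rightarrow> 'w::zero \<Rightarrow> 'w) \<Rightarrow> 'l set \<Rightarrow> 'w \<Rightarrow> 'l set" where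
  "annihilator act q w = {x \<in> q. act x w = 0}"

text \<open>\<open>ind sc act q M\<close> is the index of \<open>q\<close> in the module \<open>M\<close>, a finite-dimensional subspace of the
  vector space with scalar multiplication \<open>sc\<close>.\<close>

definition ind ::
    "('a::field \<Rightarrow> 'w::ab_group_add \<Rightarrow> 'w) \<Rightarrow> ('l \<Rightarrow> 'w \<Rightarrow> 'w) \<Rightarrow> 'l set \<Rightarrow> 'w set \<Rightarrow> int" where
  "ind sc act q M =
     int (vector_space.dim sc M) -
     int (Max ((\<lambda>\<xi>. vector_space.dim (pscale ((*) :: 'a \<Rightarrow> 'a \<Rightarrow> 'a))
                       (orbit_space (dual_act act M) q \<xi>))
               ` dual_space sc (+) M))"

definition lie_GIB ::
    "('a::field \<Rightarrow> 'w::ab_group_add \<Rightarrow> 'w) \<Rightarrow> ('l \<Rightarrow> 'w \<Rightarrow> 'w) \<Rightarrow> 'l set \<Rightarrow> 'w set \<Rightarrow> bool" where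
  "lie_GIB sc act q M \<longleftrightarrow>
     (\<forall>w\<in>M.
        let N = orbit_space act q w; MN = quot_space M N in
        ind (pscale ((*) :: 'a \<Rightarrow> 'a \<Rightarrow> 'a)) (dual_act act M) q (dual_space sc (+) M) =
        ind (pscale ((*) :: 'a \<Rightarrow> 'a \<Rightarrow> 'a)) (dual_act (quot_act act N) MN) (annihilator act q w)
          (dual_space (quot_smult sc N) (+) MN))"


section \<open>Linear groups and their Lie algebras\<close>

definition gl :: "('a::field \<Rightarrow> 'v::ab_group_add \<Rightarrow> 'v) \<Rightarrow> ('v \<Rightarrow> 'v) set" where
  "gl scale = {x. Vector_Spaces.linear scale scale x}"

definition GL :: "('a::field \<Rightarrow> 'v::ab_group_add \<Rightarrow> 'v) \<Rightarrow> ('v \<Rightarrow> 'v) set" where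
  "GL scale = {g \<in> gl scale. bij g}"

definition commutator :: "('v \<Rightarrow> 'v) \<Rightarrow> ('v \<Rightarrow> 'v) \<Rightarrow> 'v \<Rightarrow> 'v::ab_group_add" where
  "commutator x y = (\<lambda>v. x (y v) - y (x v))"

text \<open>The polynomial functions on the space of endomorphisms: the algebra generated by the
  matrix coefficients.\<close>

inductive poly_fun ::
    "('a::field \<Rightarrow> 'v::ab_group_add \<Rightarrow> 'v) \<Rightarrow> (('v \<Rightarrow> 'v) \<Rightarrow> 'a) \<Rightarrow> bool"
  for scale where
  const: "poly_fun scale (\<lambda>x. c)"
| matrix_coeff: "Vector_Spaces.linear scale (*) \<phi> \<Longrightarrow> poly_fun scale (\<lambda>x. \<phi> (x v))"
| add: "poly_fun scale f \<Longrightarrow> poly_fun scale h \<Longrightarrow> poly_fun scale (\<lambda>x. f x + h x)"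
| mult: "poly_fun scale f \<Longrightarrow> poly_fun scale h \<Longrightarrow> poly_fun scale (\<lambda>x. f x * h x)"

text \<open>
  The Lie algebra of a linear algebraic group \<open>G\<close>, as its tangent space at the identity: the
  endomorphisms \<open>x\<close> such that every polynomial function \<open>f\<close> vanishing on \<open>G\<close> has zero derivative
  at \<open>id\<close> in direction \<open>x\<close>. That derivative is the linear coefficient of the polynomial
  \<open>t \<mapsto> f (id + t x)\<close>.
\<close>

definition lie_algebra_of ::
    "('a::field \<Rightarrow> 'v::ab_group_add \<Rightarrow> 'v) \<Rightarrow> ('v \<Rightarrow> 'v) set \<Rightarrow> ('v \<Rightarrow> 'v) set" where
  "lie_algebra_of scale G =
     {x \<in> gl scale. \<forall>f p. poly_fun scale f \<longrightarrow> (\<forall>g\<in>G. f g = 0) \<longrightarrow>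
        (\<forall>t. poly p t = f (\<lambda>v. v + scale t (x v))) \<longrightarrow> coeff p 1 = 0}"

text \<open>
  GIB of \<open>(G, M)\<close>, for a linear algebraic group \<open>G\<close> acting by conjugation on a stable subspace \<open>M\<close>
  of endomorphisms. GIB involves only the action of the Lie algebra, and the differential of
  \<open>g \<mapsto> (y \<mapsto> g y g\<inverse>)\<close> at the identity is \<open>x \<mapsto> (y \<mapsto> [x, y])\<close>.
\<close>

definition adjoint_pair_GIB ::
    "('a::field \<Rightarrow> 'v::ab_group_add \<Rightarrow> 'v) \<Rightarrow> ('v \<Rightarrow> 'v) set \<Rightarrow> ('v \<Rightarrow> 'v) set \<Rightarrow> bool" where
  "adjoint_pair_GIB scale G M \<longleftrightarrow> lie_GIB (pscale scale) commutator (lie_algebra_of scale G) M"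


section \<open>Inner automorphisms of finite order\<close>

definition primitive_root_unity :: "nat \<Rightarrow> 'a::field \<Rightarrow> bool" where
  "primitive_root_unity m \<zeta> \<longleftrightarrow> m > 0 \<and> \<zeta> ^ m = 1 \<and> (\<forall>k. 0 < k \<and> k < m \<longrightarrow> \<zeta> ^ k \<noteq> 1)"

definition direct_decomposition ::
    "('a::field \<Rightarrow> 'v::ab_group_add \<Rightarrow> 'v) \<Rightarrow> nat \<Rightarrow> (nat \<Rightarrow> 'v set) \<Rightarrow> bool" where
  "direct_decomposition scale m V \<longleftrightarrow>
     (\<forall>t<m. module.subspace scale (V t)) \<and>
     (\<forall>v. \<exists>!u. (\<forall>t<m. u t \<in> V t) \<and> (\<forall>t\<ge>m. u t = 0) \<and> v = (\<Sum>t<m. u t))"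

definition inner_aut :: "('v \<Rightarrow> 'v) \<Rightarrow> ('v \<Rightarrow> 'v) \<Rightarrow> 'v \<Rightarrow> 'v" where
  "inner_aut s x = s \<circ> x \<circ> inv s"

definition has_order :: "('a::field \<Rightarrow> 'v::ab_group_add \<Rightarrow> 'v) \<Rightarrow> (('v \<Rightarrow> 'v) \<Rightarrow> 'v \<Rightarrow> 'v) \<Rightarrow> nat \<Rightarrow> bool" where
  "has_order scale \<theta> m \<longleftrightarrow> m > 0 \<and> (\<forall>x\<in>gl scale. (\<theta> ^^ m) x = x) \<and>
     (\<forall>k. 0 < k \<and> k < m \<longrightarrow> (\<exists>x\<in>gl scale. (\<theta> ^^ k) x \<noteq> x))"

definition eigenspace ::
    "('a::field \<Rightarrow> 'v::ab_group_add \<Rightarrow> 'v) \<Rightarrow> (('v \<Rightarrow> 'v) \<Rightarrow> 'v \<Rightarrow> 'v) \<Rightarrow> 'a \<Rightarrow> ('v \<Rightarrow> 'v) set" where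
  "eigenspace scale \<theta> c = {x \<in> gl scale. \<theta> x = pscale scale c x}"

text \<open>The product of the groups \<open>GL (V t)\<close> for \<open>t < m\<close>, embedded block-diagonally.\<close>

definition block_GL ::
    "('a::field \<Rightarrow> 'v::ab_group_add \<Rightarrow> 'v) \<Rightarrow> nat \<Rightarrow> (nat \<Rightarrow> 'v set) \<Rightarrow> ('v \<Rightarrow> 'v) set" where
  "block_GL scale m V = {g \<in> GL scale. \<forall>t<m. g ` V t = V t}"

text \<open>
  GIB of the automorphism \<open>\<theta>\<close> given by conjugation by the element acting as \<open>\<zeta> ^ t\<close> on \<open>V t\<close>.
\<close>

definition aut_GIB ::
    "('a::field \<Rightarrow> 'v::ab_group_add \<Rightarrow> 'v) \<Rightarrow> nat \<Rightarrow> 'a \<Rightarrow> (nat \<Rightarrow> 'v set) \<Rightarrow>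
     (('v \<Rightarrow> 'v) \<Rightarrow> 'v \<Rightarrow> 'v) \<Rightarrow> bool" where
  "aut_GIB scale m \<zeta> V \<theta> \<longleftrightarrow>
     adjoint_pair_GIB scale (block_GL scale m V) (eigenspace scale \<theta> \<zeta>)"

end

theory Submission
  imports Defs
begin

text \<open>
  Write \<open>q\<close> for the degree-zero and \<open>M\<close> for the degree-one component of the grading. By double
  duality the two indices are codimensions of generic orbits of \<open>q\<close> in \<open>M\<close> and of \<open>q_x\<close> in \<open>M / [q, x]\<close>.
  Vinberg's inequality bounds the first by the second, so it suffices to find, for every \<open>x\<close>, a
  direction \<open>\<xi>\<close> for which \<open>[q, x] + [q_x, \<xi>]\<close> has codimension at most the generic one, which is \<open>0\<close>
  if some component of the vector space vanishes and \<open>1\<close> otherwise (if \<open>[q, x] = M\<close>, the same holds on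
  a generic line through \<open>x\<close>; then the Euler relation \<open>[a, x] = x\<close> forces \<open>x\<^sup>m\<close> to vanish on the
  component of dimension one along that line, which is absurd).

  A functional on \<open>M\<close> vanishing on \<open>[q, x] + [q_x, \<xi>]\<close> is, via the trace form, some \<open>y\<close> of degree
  \<open>-1\<close> with a \<open>z\<close> such that \<open>y + t z\<close> commutes with \<open>x + t \<xi>\<close> modulo \<open>t\<^sup>2\<close>. The trace of the product
  of these two is the same on all components. On the hyperplane where it vanishes, the product
  vanishes on each component of dimension at most one, so the cyclic quiver falls apart into blocks
  of the shapes \<open>1 \<rightarrow> 1\<close>, \<open>1 \<rightarrow> V \<rightarrow> 1\<close> and \<open>1 \<rightarrow> V \<rightarrow> W \<rightarrow> 1\<close>. On each block \<open>\<xi>\<close> can be chosen so that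
  \<open>y\<close> vanishes.
\<close>

section \<open>Linear maps between subspaces\<close>

text \<open>The functional kills [q_x, \<xi>], so a -> -F([a, \<xi>]) depends only on [a, x]; this
  yields a second functional \<open>H\<close>, and with it z. That no three consecutive components
  are large means that every interior vertex of a block is adjacent to one of its ends. At such a
  vertex one of the products x y, y x passes through a line, so both have rank at most one. A vertex
  between two large neighbours need not have such a relation. In the longest block, with maps v, A,
  \<psi>, the unknowns \<alpha>, B, w always admit the solution (\<alpha>, B, w) = c (\<psi> A, v
  \<psi>, A v) of the interior relations. A perturbation of A in general position with respect to
  its kernel and cokernel leaves only the scalar c free in the constant terms. The conditions at the
  two ends then read c (\<psi> A v) = 0, so a perturbation that makes the composite \<psi> A v
  nonzero to the right order kills c. The trace hyperplane costs one dimension, which is what the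
  generic codimension allows when no component is zero.\<close>

lemma sum_fun_apply: "(\<Sum>b\<in>B. h b) v = (\<Sum>b\<in>B. h b v)"
  by (induction B rule: infinite_finite_induct) simp_all

locale vspace = vector_space scale
  for scale :: "'a::field \<Rightarrow> 'b::ab_group_add \<Rightarrow> 'b" (infixr \<open>*s\<close> 75)

lemma vspace_field: "vspace ((*) :: 'a::field \<Rightarrow> 'a \<Rightarrow> 'a)"
  by unfold_locales (auto simp: algebra_simps)

context vspace
begin

abbreviation lin :: "('b \<Rightarrow> 'b) \<Rightarrow> bool" where "lin \<equiv> Vector_Spaces.linear scale scale"
abbreviation fnl :: "('b \<Rightarrow> 'a) \<Rightarrow> bool" where "fnl \<equiv> Vector_Spaces.linear scale (*)"

section \<open>Rules for linear maps and functionals\<close>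

lemma linI: "\<lbrakk>\<And>x y. T (x + y) = T x + T y; \<And>c x. T (c *s x) = c *s T x\<rbrakk> \<Longrightarrow> lin T"
  by (simp add: Vector_Spaces.linear_iff vector_space_axioms)

lemma fnlI: "\<lbrakk>\<And>x y. \<phi> (x + y) = \<phi> x + \<phi> y; \<And>c x. \<phi> (c *s x) = c * \<phi> x\<rbrakk> \<Longrightarrow> fnl \<phi>"
  by (simp add: Vector_Spaces.linear_iff vector_space_axioms vspace.axioms[OF vspace_field])

lemma lin_add: "lin T \<Longrightarrow> T (x + y) = T x + T y"
  and lin_scale: "lin T \<Longrightarrow> T (c *s x) = c *s T x"
  by (simp_all add: Vector_Spaces.linear_iff)

lemma fnl_add: "fnl \<phi> \<Longrightarrow> \<phi> (x + y) = \<phi> x + \<phi> y"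
  and fnl_scale: "fnl \<phi> \<Longrightarrow> \<phi> (c *s x) = c * \<phi> x"
  by (simp_all add: Vector_Spaces.linear_iff)

lemma lin_0: "lin T \<Longrightarrow> T 0 = 0"
  using lin_scale[of T 0 0] by simp

lemma fnl_0: "fnl \<phi> \<Longrightarrow> \<phi> 0 = 0"
  using fnl_scale[of \<phi> 0 0] by simp

lemma lin_minus: "lin T \<Longrightarrow> T (- x) = - T x"
  using lin_scale[of T "-1" x] by simp

lemma fnl_minus: "fnl \<phi> \<Longrightarrow> \<phi> (- x) = - \<phi> x"
  using fnl_scale[of \<phi> "-1" x] by simp

lemma lin_diff: "lin T \<Longrightarrow> T (x - y) = T x - T y"
  using lin_add[of T x "- y"] by (simp add: lin_minus)

lemma fnl_diff: "fnl \<phi> \<Longrightarrow> \<phi> (x - y) = \<phi> x - \<phi> y"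
  using fnl_add[of \<phi> x "- y"] by (simp add: fnl_minus)

lemmas lin_simps = lin_add lin_scale lin_0 lin_minus lin_diff
  fnl_add fnl_scale fnl_0 fnl_minus fnl_diff

lemma lin_zero: "lin (\<lambda>_. 0)"
  by (rule linI) auto

lemma lin_plus: "lin S \<Longrightarrow> lin T \<Longrightarrow> lin (\<lambda>v. S v + T v)"
  by (rule linI) (simp_all add: lin_add lin_scale algebra_simps)

lemma lin_cmult: "lin S \<Longrightarrow> lin (\<lambda>v. c *s S v)"
  by (rule linI) (simp_all add: lin_add lin_scale algebra_simps)

lemma lin_comp: "lin S \<Longrightarrow> lin T \<Longrightarrow> lin (\<lambda>v. S (T v))"
  by (rule linI) (simp_all add: lin_add lin_scale)

lemma subspace_image: "lin T \<Longrightarrow> subspace S \<Longrightarrow> subspace (T ` S)"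
  by (rule vector_space_pair.linear_subspace_image
      [OF vector_space_pair.intro[OF vector_space_axioms vector_space_axioms]])

lemma fnl_zero: "fnl (\<lambda>_. 0)"
  by (rule fnlI) auto

lemma fnl_cmult: "fnl \<phi> \<Longrightarrow> fnl (\<lambda>x. c * \<phi> x)"
  by (rule fnlI) (auto simp: fnl_add fnl_scale algebra_simps)

lemma separating_fnl:
  assumes S: "subspace S" and u: "u \<notin> S"
  obtains \<phi> where "fnl \<phi>" "\<And>x. x \<in> S \<Longrightarrow> \<phi> x = 0" "\<phi> u = 1"
proof -
  interpret p: vector_space_pair scale "(*)"
    by (rule vector_space_pair.intro[OF vector_space_axioms vspace.axioms[OF vspace_field]])
  obtain B where B: "B \<subseteq> S" "independent B" "S \<subseteq> span B"
    by (rule basis_exists[of S])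
  have "span B \<subseteq> S" using B(1) S by (simp add: span_minimal)
  then have "independent (insert u B)" using u B by (intro independent_insertI) auto
  then obtain \<phi> where \<phi>: "fnl \<phi>" "\<And>x. x \<in> insert u B \<Longrightarrow> \<phi> x = (if x = u then 1 else 0)"
    using p.linear_independent_extend[of "insert u B" "\<lambda>x. if x = u then 1 else 0"] by blast
  have "\<phi> x = 0" if "x \<in> S" for x
  proof (rule p.linear_eq_0_on_span[OF \<phi>(1)])
    show "x \<in> span B" using that B by blast
    show "\<phi> b = 0" if "b \<in> B" for b using \<phi>(2)[of b] that u B(1) by auto
  qed
  then show thesis using that[OF \<phi>(1)] \<phi>(2)[of u] by simp
qed

lemma separating_fnl_value:
  assumes "subspace S" "u \<notin> S"
  obtains \<phi> where "fnl \<phi>" "\<And>x. x \<in> S \<Longrightarrow> \<phi> x = 0" "\<phi> u = c"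
proof -
  obtain \<phi> where "fnl \<phi>" "\<And>x. x \<in> S \<Longrightarrow> \<phi> x = 0" "\<phi> u = 1"
    using separating_fnl[OF assms] by blast
  then show thesis by (intro that[of "\<lambda>x. c * \<phi> x"]) (auto intro: fnl_cmult)
qed

lemma fnl_with_value: 
  assumes "u \<noteq> 0" obtains \<phi> where "fnl \<phi>" "\<phi> u = c"
  using separating_fnl_value[of "{0}" u c] assms by auto

text \<open>Two equal tensors of rank at most one have proportional factors as soon as one factor on
  each side is nonzero. The resulting scalar c is the unknown that survives in all block
  computations.\<close>

lemma rank_one_eq:
  assumes eq: "\<And>p. p \<in> V \<Longrightarrow> \<alpha> p *s a = \<beta> p *s w"
    and "a \<noteq> 0" "q \<in> V" "\<beta> q \<noteq> 0"
  obtains c where "w = c *s a" "\<And>p. p \<in> V \<Longrightarrow> \<alpha> p = c * \<beta> p"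
proof -
  define c where "c = \<alpha> q / \<beta> q"
  have "c *s a = inverse (\<beta> q) *s (\<alpha> q *s a)" by (simp add: c_def field_simps)
  also have "\<dots> = w" using eq[OF \<open>q \<in> V\<close>] \<open>\<beta> q \<noteq> 0\<close> by simp
  finally have w: "w = c *s a" by simp
  have "\<alpha> p = c * \<beta> p" if "p \<in> V" for p
    using eq[OF that] \<open>a \<noteq> 0\<close> by (simp add: w mult.commute)
  with w show thesis by (rule that)
qed

text \<open>\<open>T\<close> induces a map of maximal rank from the kernel to the cokernel of \<open>A\<close>, in general position
  with respect to \<open>v\<close> (when \<open>v\<close> lies in the kernel) and \<open>\<psi>\<close> (when \<open>\<psi>\<close> factors through the cokernel).\<close>

definition transversal :: "'b set \<Rightarrow> 'b set \<Rightarrow> ('b \<Rightarrow> 'b) \<Rightarrow> 'b \<Rightarrow> ('b \<Rightarrow> 'a) \<Rightarrow> ('b \<Rightarrow> 'b) \<Rightarrow> bool" where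
  "transversal V W A v \<psi> T \<longleftrightarrow>
     lin T \<and> T ` V \<subseteq> W \<and>
     ((\<forall>k\<in>V. A k = 0 \<longrightarrow> T k \<in> A ` V \<longrightarrow> k = 0) \<or> (\<forall>w\<in>W. \<exists>k\<in>V. A k = 0 \<and> w - T k \<in> A ` V)) \<and>
     (A v = 0 \<longrightarrow> v \<noteq> 0 \<longrightarrow> T v \<in> A ` V \<longrightarrow> W \<subseteq> A ` V) \<and>
     ((\<forall>p\<in>V. \<psi> (A p) = 0) \<longrightarrow> (\<exists>f\<in>W. \<psi> f \<noteq> 0) \<longrightarrow>
        (\<exists>k\<in>V. A k = 0 \<and> \<psi> (T k) \<noteq> 0) \<or> (\<forall>k\<in>V. A k = 0 \<longrightarrow> k = 0)) \<and>
     (A v = 0 \<longrightarrow> v \<noteq> 0 \<longrightarrow> (\<forall>p\<in>V. \<psi> (A p) = 0) \<longrightarrow> (\<exists>f\<in>W. \<psi> f \<noteq> 0) \<longrightarrow> \<psi> (T v) \<noteq> 0)"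

text \<open>By \<open>DK\<close> and \<open>DA\<close>, \<open>D\<close> descends to a map from the
  cokernel to the kernel of \<open>A\<close>, while \<open>T\<close> goes the other way. Both
  composites have rank at most one and \<open>T\<close> is injective or surjective, so
  \<open>D\<close> itself has rank at most one. The general-position clauses of
  \<open>transversal\<close> then exclude rank exactly one; \<open>H\<close> is the trace that the
  end conditions of a block leave here.\<close>

lemma transversal_vanish:
  assumes V: "subspace V" and W: "subspace W"
    and A: "lin A" "A ` V \<subseteq> W" and D: "lin D" and \<psi>: "fnl \<psi>" and v: "v \<in> V"
    and T: "transversal V W A v \<psi> T"
    and DK: "\<And>g. g \<in> W \<Longrightarrow> D g \<in> V" "\<And>g. g \<in> W \<Longrightarrow> A (D g) = 0"
    and DA: "\<And>p. p \<in> V \<Longrightarrow> D (A p) = 0"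
    and TD: "\<And>g. g \<in> W \<Longrightarrow> T (D g) - \<psi> g *s u \<in> A ` V"
    and DT: "\<And>k. k \<in> V \<Longrightarrow> A k = 0 \<Longrightarrow> D (T k) = \<delta> k *s v"
    and H: "u = 0 \<or> (\<forall>k\<in>V. A k = 0 \<longrightarrow> \<delta> k = 0) \<or> \<delta> v = 0"
    and g: "g \<in> W"
  shows "D g = 0"
proof -
  note ls = lin_simps(1-5)[OF A(1)] lin_simps(1-5)[OF D] lin_simps(6-10)[OF \<psi>]
  note t = T[unfolded transversal_def]
  note t2 = t[THEN conjunct2, THEN conjunct2]
  note t3 = t2[THEN conjunct2, THEN conjunct2]
  note T1 = t[THEN conjunct1] t[THEN conjunct2, THEN conjunct1]
    and N0 = t2[THEN conjunct1] and N1 = t2[THEN conjunct2, THEN conjunct1, rule_format]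
  have N2: "(\<exists>k\<in>V. A k = 0 \<and> \<psi> (T k) \<noteq> 0) \<or> (\<forall>k\<in>V. A k = 0 \<longrightarrow> k = 0)"
    if "\<forall>p\<in>V. \<psi> (A p) = 0" "f \<in> W" "\<psi> f \<noteq> 0" for f
    using t3[THEN conjunct1] that by simp blast
  have N3: "\<psi> (T v) \<noteq> 0"
    if "A v = 0" "v \<noteq> 0" "\<forall>p\<in>V. \<psi> (A p) = 0" "f \<in> W" "\<psi> f \<noteq> 0" for f
    using t3[THEN conjunct2] that by simp blast
  have S: "subspace (A ` V)" by (rule subspace_image[OF A(1) V])
  \<comment> \<open>Contrapositively, if \<open>u\<close> is outside the image of \<open>A\<close>,
    then \<open>\<psi>\<close> vanishes on the kernel of \<open>D\<close>, in particular on the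
    image of \<open>A\<close>. This makes the clauses about \<open>\<psi>\<close>
    applicable.\<close>
  have uS: "u \<in> A ` V" if "h \<in> W" "D h = 0" "\<psi> h \<noteq> 0" for h
  proof -
    have "- (\<psi> h *s u) \<in> A ` V" using TD[OF that(1)] that(2) by (simp add: lin_simps(1-5)[OF T1(1)])
    then have "(- inverse (\<psi> h)) *s (- (\<psi> h *s u)) \<in> A ` V" by (rule subspace_scale[OF S])
    then show ?thesis using that(3) by simp
  qed
  show ?thesis
    using N0
  proof
    assume inj: "\<forall>k\<in>V. A k = 0 \<longrightarrow> T k \<in> A ` V \<longrightarrow> k = 0"
    have van: "D h = 0" if "h \<in> W" "u \<in> A ` V \<or> \<psi> h = 0" for h
    proof -
      have "\<psi> h *s u \<in> A ` V" using that(2) S by (auto simp: subspace_0 subspace_scale)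
      from subspace_add[OF S TD[OF that(1)] this] have "T (D h) \<in> A ` V" by simp
      then show ?thesis using inj DK that(1) by blast
    qed
    show "D g = 0"
    proof (rule ccontr)
      assume nz: "D g \<noteq> 0"
      then have u: "u \<notin> A ` V" and \<psi>g: "\<psi> g \<noteq> 0" using van[OF g] by auto
      have \<psi>A: "\<forall>p\<in>V. \<psi> (A p) = 0" using uS DA u A(2) by blast
      define k where "k = inverse (\<psi> g) *s D g"
      have k: "D h = \<psi> h *s k" if "h \<in> W" for h
      proof -
        have "h - (\<psi> h / \<psi> g) *s g \<in> W" using that g W by (simp add: subspace_diff subspace_scale)
        moreover have "\<psi> (h - (\<psi> h / \<psi> g) *s g) = 0" using \<psi>g by (simp add: ls)
        ultimately have "D (h - (\<psi> h / \<psi> g) *s g) = 0" using van by blast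
        then show ?thesis by (simp add: ls k_def field_simps)
      qed
      have k0: "k \<noteq> 0" using nz k[OF g] by auto
      have "A (D g) = 0" "D g \<in> V" using DK g by auto
      then obtain \<kappa> where \<kappa>: "\<kappa> \<in> V" "A \<kappa> = 0" "\<psi> (T \<kappa>) \<noteq> 0" using N2[OF \<psi>A g \<psi>g] nz by blast
      have eq: "\<psi> (T l) *s k = \<delta> l *s v" if "l \<in> V" "A l = 0" for l
        using DT[OF that] k[of "T l"] T1 that by auto
      show False
        using H
      proof (elim disjE)
        assume "u = 0" then show False using u S subspace_0 by blast
      next
        assume "\<forall>k\<in>V. A k = 0 \<longrightarrow> \<delta> k = 0" then show False using eq[OF \<kappa>(1,2)] \<kappa> k0 by auto
      next
        assume dv: "\<delta> v = 0"
        show False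
        proof (cases "A v = 0 \<and> v \<noteq> 0")
          case True
          then show False using N3[OF _ _ \<psi>A g \<psi>g] eq[OF v] dv k0 by auto
        next
          case False
          have "A (\<psi> (T \<kappa>) *s k) = 0" using \<open>A (D g) = 0\<close> by (simp add: ls k_def)
          then have "\<delta> \<kappa> *s A v = 0" using eq[OF \<kappa>(1,2)] by (simp add: ls)
          then have "\<delta> \<kappa> *s v = 0" using False by auto
          then show False using eq[OF \<kappa>(1,2)] \<kappa> k0 by auto
        qed
      qed
    qed
  next
    assume sur: "\<forall>w\<in>W. \<exists>k\<in>V. A k = 0 \<and> w - T k \<in> A ` V"
    \<comment> \<open>Lifting \<open>h\<close> along \<open>T\<close> modulo the image of
      \<open>A\<close> shows that all values of \<open>D\<close> lie on the line of
      \<open>v\<close>.\<close>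
    have ex: "\<exists>k\<in>V. A k = 0 \<and> D h = \<delta> k *s v" if "h \<in> W" for h
    proof -
      obtain k p where k: "k \<in> V" "A k = 0" "p \<in> V" "h - T k = A p" using sur \<open>h \<in> W\<close> by blast
      have "D (h - T k) = 0" using DA k by simp
      then have "D h = D (T k)" by (simp add: ls)
      then show ?thesis using DT k by auto
    qed
    show "D g = 0"
    proof (rule ccontr)
      assume nz: "D g \<noteq> 0"
      obtain k where k: "k \<in> V" "A k = 0" "D g = \<delta> k *s v" using ex[OF g] by blast
      have v0: "v \<noteq> 0" "\<delta> k \<noteq> 0" using nz k by auto
      have "\<delta> k *s A v = 0" using DK(2)[OF g] k by (simp add: ls)
      then have Av: "A v = 0" using v0 by simp
      have "\<not> W \<subseteq> A ` V" using DA g nz by blast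
      then have Tv: "T v \<notin> A ` V" using N1[OF Av v0(1)] by blast
      have TDg: "T (D g) = \<delta> k *s T v" using k by (simp add: lin_simps(1-5)[OF T1(1)])
      have uN: "u \<notin> A ` V"
      proof
        assume "u \<in> A ` V"
        then have "\<psi> g *s u \<in> A ` V" using S by (simp add: subspace_scale)
        from subspace_add[OF S TD[OF g] this] have "T (D g) \<in> A ` V" by simp
        then have "inverse (\<delta> k) *s (\<delta> k *s T v) \<in> A ` V" using TDg subspace_scale[OF S] by metis
        then show False using Tv v0 by simp
      qed
      have \<psi>A: "\<forall>p\<in>V. \<psi> (A p) = 0" using uS DA uN A(2) by blast
      have \<psi>g: "\<psi> g \<noteq> 0"
      proof
        assume "\<psi> g = 0"
        then have "\<delta> k *s T v \<in> A ` V" using TD[OF g] TDg by simp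
        then have "inverse (\<delta> k) *s (\<delta> k *s T v) \<in> A ` V" using subspace_scale[OF S] by metis
        then show False using Tv v0 by simp
      qed
      show False
        using H
      proof (elim disjE)
        assume "u = 0" then show False using uN S subspace_0 by blast
      next
        assume "\<forall>k\<in>V. A k = 0 \<longrightarrow> \<delta> k = 0" then show False using k v0 by auto
      next
        assume dv: "\<delta> v = 0"
        have "D (T v) = 0" using DT[OF v Av] dv by simp
        moreover have "\<psi> (T v) \<noteq> 0" using N3[OF Av v0(1) \<psi>A g \<psi>g] .
        ultimately show False using uS[of "T v"] T1 v uN by blast
      qed
    qed
  qed
qed

end

locale fin_vspace = finite_dimensional_vector_space scale Basis + vspace scale
  for scale :: "'a::field \<Rightarrow> 'b::ab_group_add \<Rightarrow> 'b" (infixr \<open>*s\<close> 75)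
    and Basis :: "'b set"
begin

text \<open>Match a basis of \<open>K\<close> through \<open>k\<close> with a basis of a complement
  of \<open>S\<close> through \<open>c\<close>: the smaller one is injected into the larger one so
  that \<open>k\<close> and \<open>c\<close> correspond. This gives maximal rank modulo
  \<open>S\<close>.\<close>

lemma ex_partial_isomorphism:
  assumes K: "subspace K" and S: "subspace S" and W: "subspace W" "S \<subseteq> W"
    and k: "k \<in> K" "k \<noteq> 0" and c: "c \<in> W" "c \<notin> S"
  obtains T where "lin T" "T k = c" "\<And>v. T v \<in> W"
    "(\<forall>x\<in>K. T x \<in> S \<longrightarrow> x = 0) \<or> (\<forall>w\<in>W. \<exists>x\<in>K. w - T x \<in> S)"
proof -
  interpret p: vector_space_pair scale scale
    by (rule vector_space_pair.intro[OF vector_space_axioms vector_space_axioms])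
  obtain BK where BK: "{k} \<subseteq> BK" "BK \<subseteq> K" "independent BK" "K \<subseteq> span BK"
    using maximal_independent_subset_extend[of "{k}" K] k by auto
  obtain BS where BS: "BS \<subseteq> S" "independent BS" "S \<subseteq> span BS"
    by (rule basis_exists[of S])
  have sBS: "span BS = S" using BS S by (simp add: span_minimal subset_antisym)
  have "independent (insert c BS)" using c BS sBS by (intro independent_insertI) auto
  moreover have "insert c BS \<subseteq> W" using c BS W by auto
  ultimately obtain BW where BW: "insert c BS \<subseteq> BW" "BW \<subseteq> W" "independent BW" "W \<subseteq> span BW"
    using maximal_independent_subset_extend[of "insert c BS" W] by auto
  define C where "C = BW - BS"
  have cC: "c \<in> C" using BW c BS by (auto simp: C_def)
  have indC: "independent C" using BW independent_mono by (auto simp: C_def)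
  have fin: "finite BK" "finite C" using BK indC finiteI_independent by auto
  have kBK: "k \<in> BK" using BK by auto
  show thesis
  proof (cases "card BK \<le> card C")
    case True
    then have "card (BK - {k}) \<le> card (C - {c})" using fin kBK cC by simp
    then obtain f0 where f0: "f0 ` (BK - {k}) \<subseteq> C - {c}" "inj_on f0 (BK - {k})"
      using card_le_inj[of "BK - {k}" "C - {c}"] fin by auto
    define f where "f = f0(k := c)"
    have f: "f k = c" "f ` BK \<subseteq> C" "inj_on f BK"
      using f0 cC by (auto simp: f_def inj_on_def)
    obtain T where T: "lin T" "\<forall>x\<in>BK. T x = f x" "range T = span (f ` BK)"
      using p.linear_independent_extend_subspace[OF BK(3), of f] by blast
    \<comment> \<open>\<open>Q\<close> is the projection onto the span of \<open>C\<close> along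
      \<open>S\<close>. It fixes \<open>T x\<close> and kills \<open>S\<close>, so a value of
      \<open>T\<close> in \<open>S\<close> must be zero.\<close>
    obtain Q where Q: "lin Q" "\<forall>x\<in>BW. Q x = (if x \<in> C then x else 0)"
      using p.linear_independent_extend[OF BW(3), of "\<lambda>x. if x \<in> C then x else 0"] by blast
    have injT: "inj_on T (span BK)"
    proof -
      have "T ` BK = f ` BK" using T(2) by auto
      then have "independent (T ` BK)" using f indC independent_mono by metis
      moreover have "inj_on T BK" using T(2) f(3) by (auto simp: inj_on_def)
      ultimately show ?thesis using p.linear_inj_on_span_iff_independent_image[OF T(1)] by blast
    qed
    have "x = 0" if "x \<in> K" "T x \<in> S" for x
    proof -
      have "T x \<in> span C" using T(3) f(2) span_mono by blast
      then have "Q (T x) = T x"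
        using p.linear_eq_on[OF Q(1) module_hom_id[unfolded module_hom_iff_linear], of "T x" C] Q(2)
        by (auto simp: C_def)
      moreover have "Q (T x) = 0"
      proof (rule p.linear_eq_0_on_span[OF Q(1)])
        show "T x \<in> span BS" using that sBS by simp
        show "Q b = 0" if "b \<in> BS" for b using Q(2) that BW(1) by (auto simp: C_def)
      qed
      ultimately have "T x = T 0" using lin_0[OF T(1)] by simp
      then show ?thesis using injT that BK(4) by (meson inj_onD span_zero subsetD)
    qed
    moreover have "T v \<in> W" for v
    proof -
      have "span (f ` BK) \<subseteq> W" using f(2) BW(2) W by (intro span_minimal) (auto simp: C_def)
      then show ?thesis using T(3) by blast
    qed
    ultimately show thesis using that[of T] T kBK f by auto
  next
    case False
    then have "card (C - {c}) \<le> card (BK - {k})" using fin kBK cC by simp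
    then obtain f0 where f0: "f0 ` (C - {c}) \<subseteq> BK - {k}" "inj_on f0 (C - {c})"
      using card_le_inj[of "C - {c}" "BK - {k}"] fin by auto
    define f where "f = f0(c := k)"
    have f: "f c = k" "f ` C \<subseteq> BK" "inj_on f C"
      using f0 kBK by (auto simp: f_def inj_on_def)
    \<comment> \<open>\<open>h\<close> inverts \<open>f\<close> and hence sends \<open>k\<close> to
      \<open>c\<close>; the basis vectors of \<open>K\<close> that are not matched go to 0.\<close>
    define h where "h = (\<lambda>b. if b \<in> f ` C then inv_into C f b else 0)"
    obtain T where T: "lin T" "\<forall>x\<in>BK. T x = h x" "range T = span (h ` BK)"
      using p.linear_independent_extend_subspace[OF BK(3), of h] by blast
    have hf: "h (f x) = x" if "x \<in> C" for x using that f by (auto simp: h_def)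
    have hW: "h b \<in> W" for b
      using inv_into_into[of b f C] BW(2) W(1) by (auto simp: h_def C_def subspace_0)
    have "\<exists>x\<in>K. w - T x \<in> S" if "w \<in> W" for w
    proof -
      have "w \<in> span BW" using that BW by blast
      then show ?thesis
      proof (induction rule: span_induct_alt)
        case base
        then show ?case using K S subspace_0 lin_0[OF T(1)] by (intro bexI[of _ 0]) auto
      next
        case (step r b y)
        then obtain x where x: "x \<in> K" "y - T x \<in> S" by blast
        show ?case
        proof (cases "b \<in> C")
          case True
          then have "T (f b) = b" "f b \<in> K" using T(2) f hf BK by auto
          then have "(r *s b + y) - T (r *s f b + x) = y - T x" by (simp add: lin_simps(1-5)[OF T(1)])
          then show ?thesis using x K \<open>f b \<in> K\<close> by (metis subspace_add subspace_scale)
        next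
          case False
          then have "b \<in> S" using step(1) BS by (auto simp: C_def)
          then have "r *s b + (y - T x) \<in> S" using x S by (simp add: subspace_add subspace_scale)
          then show ?thesis using x by (intro bexI[of _ x]) (auto simp: algebra_simps)
        qed
      qed
    qed
    moreover have "T v \<in> W" for v
    proof -
      have "span (h ` BK) \<subseteq> W" using hW W by (intro span_minimal) auto
      then show ?thesis using T(3) by blast
    qed
    moreover have "T k = c" using T(2) kBK hf[OF cC] f by auto
    ultimately show thesis using that[of T] T(1) by blast
  qed
qed

lemma ex_transversal:
  assumes V: "subspace V" and W: "subspace W" and A: "lin A" "A ` V \<subseteq> W" and \<psi>: "fnl \<psi>" and v: "v \<in> V"
  obtains T where "transversal V W A v \<psi> T"
proof -
  have S: "subspace (A ` V)" by (rule subspace_image[OF A(1) V])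
  have K: "subspace {k \<in> V. A k = 0}"
    using V by (auto simp: subspace_def lin_simps(1-5)[OF A(1)])
  consider "\<forall>k\<in>V. A k = 0 \<longrightarrow> k = 0" | "W \<subseteq> A ` V" 
    | "\<exists>k\<in>V. A k = 0 \<and> k \<noteq> 0" "\<exists>c\<in>W. c \<notin> A ` V" by blast
  then show thesis
  proof cases
    case 1
    then have "transversal V W A v \<psi> (\<lambda>_. 0)"
      using v W by (auto simp: transversal_def lin_zero subspace_0)
    then show thesis by (rule that)
  next
    case 2
    then have "transversal V W A v \<psi> (\<lambda>_. 0)"
      using v W V lin_0[OF A(1)] unfolding transversal_def
      by (auto simp: lin_zero subspace_0)
    then show thesis by (rule that)
  next
    case 3
    \<comment> \<open>A nonzero kernel vector, equal to \<open>v\<close> whenever \<open>v\<close>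
      qualifies. Prescribing the single value \<open>T k = c\<close> then settles every clause about
      \<open>v\<close> and \<open>\<psi>\<close>.\<close>
    define k where "k = (if A v = 0 \<and> v \<noteq> 0 then v else (SOME k. k \<in> V \<and> A k = 0 \<and> k \<noteq> 0))"
    have k: "k \<in> V" "A k = 0" "k \<noteq> 0"
      using v 3(1) someI_ex[of "\<lambda>k. k \<in> V \<and> A k = 0 \<and> k \<noteq> 0"] by (auto simp: k_def)
    \<comment> \<open>If \<open>\<psi>\<close> kills the image of \<open>A\<close>, a vector with
      nonzero \<open>\<psi>\<close> already lies outside that image and can serve as
      \<open>c\<close>.\<close>
    obtain c where c: "c \<in> W" "c \<notin> A ` V"
      "(\<forall>p\<in>V. \<psi> (A p) = 0) \<longrightarrow> (\<exists>f\<in>W. \<psi> f \<noteq> 0) \<longrightarrow> \<psi> c \<noteq> 0"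
      using 3(2) by blast
    obtain T where T: "lin T" "T k = c" "\<And>v. T v \<in> W"
      "(\<forall>x\<in>{k \<in> V. A k = 0}. T x \<in> A ` V \<longrightarrow> x = 0) \<or> (\<forall>w\<in>W. \<exists>x\<in>{k \<in> V. A k = 0}. w - T x \<in> A ` V)"
      using ex_partial_isomorphism[OF K S W A(2) _ k(3) c(1,2)] k by blast
    have "transversal V W A v \<psi> T"
      unfolding transversal_def
    proof (intro conjI impI)
      show "(\<forall>k\<in>V. A k = 0 \<longrightarrow> T k \<in> A ` V \<longrightarrow> k = 0) \<or> (\<forall>w\<in>W. \<exists>k\<in>V. A k = 0 \<and> w - T k \<in> A ` V)"
        using T(4) by blast
      show "W \<subseteq> A ` V" if "A v = 0" "v \<noteq> 0" "T v \<in> A ` V"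
        using that T(2) c(2) by (simp add: k_def)
      show "(\<exists>k\<in>V. A k = 0 \<and> \<psi> (T k) \<noteq> 0) \<or> (\<forall>k\<in>V. A k = 0 \<longrightarrow> k = 0)"
        if "\<forall>p\<in>V. \<psi> (A p) = 0" "\<exists>f\<in>W. \<psi> f \<noteq> 0" using that c(3) k T(2) by auto
      show "\<psi> (T v) \<noteq> 0" if "A v = 0" "v \<noteq> 0" "\<forall>p\<in>V. \<psi> (A p) = 0" "\<exists>f\<in>W. \<psi> f \<noteq> 0"
        using that T(2) c(3) by (simp add: k_def)
    qed (use T in auto)
    then show thesis by (rule that)
  qed
qed

end


section \<open>First-order deformations of a block\<close>

text \<open>With \<open>t\<^sup>2 = 0\<close>, \<open>v = v0 + t v1\<close> and so on, the maps \<open>v\<close>, \<open>A\<close>, \<open>\<psi>\<close> form a representation of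
  \<open>1 \<rightarrow> V \<rightarrow> W \<rightarrow> 1\<close>, and \<open>\<alpha>\<close>, \<open>B\<close>, \<open>w\<close> go in the opposite direction with \<open>\<alpha> v = 0\<close>, \<open>B A = v \<alpha>\<close>,
  \<open>A B = w \<psi>\<close> and \<open>\<psi> w = 0\<close>.\<close>

locale block = vspace scale
  for scale :: "'a::field \<Rightarrow> 'b::ab_group_add \<Rightarrow> 'b" (infixr \<open>*s\<close> 75) +
  fixes V W :: "'b set" and v0 v1 :: 'b and A0 A1 :: "'b \<Rightarrow> 'b" and \<psi>0 \<psi>1 :: "'b \<Rightarrow> 'a"
    and \<alpha>0 \<alpha>1 :: "'b \<Rightarrow> 'a" and B0 B1 :: "'b \<Rightarrow> 'b" and w0 w1 :: 'b
  assumes V: "subspace V" and W: "subspace W"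
    and v: "v0 \<in> V" "v1 \<in> V" and w: "w0 \<in> W" "w1 \<in> W"
    and A0: "lin A0" "A0 ` V \<subseteq> W" and A1: "lin A1" "A1 ` V \<subseteq> W"
    and \<psi>0: "fnl \<psi>0" and \<psi>1: "fnl \<psi>1" and \<alpha>0: "fnl \<alpha>0" and \<alpha>1: "fnl \<alpha>1"
    and B0: "lin B0" "B0 ` W \<subseteq> V" and B1: "lin B1" "B1 ` W \<subseteq> V"
    and \<alpha>v: "\<alpha>0 v0 = 0" "\<alpha>0 v1 + \<alpha>1 v0 = 0"
    and BA: "\<And>p. p \<in> V \<Longrightarrow> B0 (A0 p) = \<alpha>0 p *s v0"
      "\<And>p. p \<in> V \<Longrightarrow> B0 (A1 p) + B1 (A0 p) = \<alpha>0 p *s v1 + \<alpha>1 p *s v0"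
    and AB: "\<And>f. f \<in> W \<Longrightarrow> A0 (B0 f) = \<psi>0 f *s w0"
      "\<And>f. f \<in> W \<Longrightarrow> A0 (B1 f) + A1 (B0 f) = \<psi>0 f *s w1 + \<psi>1 f *s w0"
    and \<psi>w: "\<psi>0 w0 = 0" "\<psi>0 w1 + \<psi>1 w0 = 0"
begin

lemmas ls = lin_simps(1-5)[OF A0(1)] lin_simps(1-5)[OF A1(1)]
  lin_simps(1-5)[OF B0(1)] lin_simps(1-5)[OF B1(1)]
  lin_simps(6-10)[OF \<psi>0] lin_simps(6-10)[OF \<psi>1] lin_simps(6-10)[OF \<alpha>0] lin_simps(6-10)[OF \<alpha>1]

lemma in_spaces: "p \<in> V \<Longrightarrow> A0 p \<in> W" "p \<in> V \<Longrightarrow> A1 p \<in> W" "f \<in> W \<Longrightarrow> B0 f \<in> V" "f \<in> W \<Longrightarrow> B1 f \<in> V"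
  using A0 A1 B0 B1 by auto

text \<open>Evaluating A B A in two ways eliminates B and leaves an equation between tensors of rank
  one. This is its constant term; \<open>R1\<close> is the coefficient of t.\<close>

lemma R0:
  assumes "p \<in> V" shows "\<alpha>0 p *s A0 v0 = \<psi>0 (A0 p) *s w0"
  using AB(1)[of "A0 p"] BA(1)[OF assms] in_spaces(1)[OF assms] by (simp add: ls)

lemma R1:
  assumes p: "p \<in> V"
  shows "\<alpha>0 p *s (A1 v0 + A0 v1) + \<alpha>1 p *s A0 v0 =
    \<psi>0 (A0 p) *s w1 + (\<psi>0 (A1 p) + \<psi>1 (A0 p)) *s w0"
proof -
  have "\<alpha>0 p *s (A1 v0 + A0 v1) + \<alpha>1 p *s A0 v0 = A0 (\<alpha>0 p *s v1 + \<alpha>1 p *s v0) + A1 (\<alpha>0 p *s v0)"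
    by (simp add: ls algebra_simps)
  also have "\<dots> = A0 (B0 (A1 p) + B1 (A0 p)) + A1 (B0 (A0 p))"
    by (simp add: BA p)
  also have "\<dots> = A0 (B0 (A1 p)) + (A0 (B1 (A0 p)) + A1 (B0 (A0 p)))"
    by (simp add: ls)
  also have "\<dots> = \<psi>0 (A1 p) *s w0 + (\<psi>0 (A0 p) *s w1 + \<psi>1 (A0 p) *s w0)"
    using AB(1)[of "A1 p"] AB(2)[of "A0 p"] in_spaces p by simp
  finally show ?thesis by (simp add: algebra_simps)
qed

text \<open>When the constant terms of \<alpha> and w vanish, the coefficients of t say that
  \<open>B0\<close> is inverse to \<open>A1\<close> up to tensors of rank one, which is the
  situation of \<open>transversal_vanish\<close>. The end condition supplies
  \<open>\<alpha>1 v0 = 0\<close>.\<close>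

lemma B_vanish:
  assumes T: "transversal V W A0 v0 \<psi>0 A1" and \<alpha>: "\<And>p. p \<in> V \<Longrightarrow> \<alpha>0 p = 0" and w0: "w0 = 0"
    and f: "f \<in> W"
  shows "B0 f = 0"
proof (rule transversal_vanish[OF V W A0 B0(1) \<psi>0 v(1) T, where u = w1 and \<delta> = \<alpha>1])
  show "A1 (B0 g) - \<psi>0 g *s w1 \<in> A0 ` V" if "g \<in> W" for g
  proof -
    have "A1 (B0 g) - \<psi>0 g *s w1 = A0 (- B1 g)"
      using AB(2)[OF that] w0 by (simp add: ls eq_neg_iff_add_eq_0 algebra_simps)
    then show ?thesis using in_spaces(4)[OF that] V by (simp add: subspace_neg)
  qed
  show "B0 (A1 k) = \<alpha>1 k *s v0" if "k \<in> V" "A0 k = 0" for k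
    using BA(2)[OF that(1)] that \<alpha> by (simp add: ls)
  show "w1 = 0 \<or> (\<forall>k\<in>V. A0 k = 0 \<longrightarrow> \<alpha>1 k = 0) \<or> \<alpha>1 v0 = 0"
    using \<alpha>v(2) \<alpha> v by simp
qed (use f in_spaces AB BA w0 \<alpha> in auto)

text \<open>\<open>Q1\<close> and \<open>Q2\<close> express that the composite \<psi> A v is nonzero
  to the order that matters: modulo t^2 in \<open>Q1\<close>; in \<open>Q2\<close>, where A v and
  \<psi> A are divisible by t, at t or, if \<open>v0\<close> or \<open>\<psi>0\<close> vanishes, at
  t^2. Each case identifies the constant terms with c times the obvious solution and then derives c
  = 0 from an end condition.\<close>

lemma vanish_nondegenerate:
  assumes T: "transversal V W A0 v0 \<psi>0 A1"
    and Q1: "A0 v0 \<noteq> 0 \<or> (\<exists>p\<in>V. \<psi>0 (A0 p) \<noteq> 0) \<Longrightarrow>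
      \<psi>0 (A0 v0) \<noteq> 0 \<or> \<psi>0 (A0 v1) + \<psi>0 (A1 v0) + \<psi>1 (A0 v0) \<noteq> 0"
    and Q2: "A0 v0 = 0 \<Longrightarrow> \<forall>p\<in>V. \<psi>0 (A0 p) = 0 \<Longrightarrow>
      A1 v0 + A0 v1 \<noteq> 0 \<and> (\<exists>p\<in>V. \<psi>0 (A1 p) + \<psi>1 (A0 p) \<noteq> 0) \<and>
      (\<psi>0 (A1 v0) + \<psi>1 (A0 v0) \<noteq> 0 \<or> v0 = 0 \<and> \<psi>0 (A1 v1) + \<psi>1 (A0 v1) \<noteq> 0 \<or>
        (\<forall>f\<in>W. \<psi>0 f = 0) \<and> \<psi>1 (A1 v0 + A0 v1) \<noteq> 0)"
  shows "(\<forall>p\<in>V. \<alpha>0 p = 0) \<and> (\<forall>f\<in>W. B0 f = 0) \<and> w0 = 0"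
proof -
  consider (i) q where "A0 v0 \<noteq> 0" "q \<in> V" "\<psi>0 (A0 q) \<noteq> 0"
    | (ii) q where "A0 v0 = 0" "q \<in> V" "\<psi>0 (A0 q) \<noteq> 0"
    | (iii) "A0 v0 \<noteq> 0" "\<forall>p\<in>V. \<psi>0 (A0 p) = 0"
    | (iv) "A0 v0 = 0" "\<forall>p\<in>V. \<psi>0 (A0 p) = 0" by blast
  then show ?thesis
  proof cases
    case i
    obtain c where c: "w0 = c *s A0 v0" "\<And>p. p \<in> V \<Longrightarrow> \<alpha>0 p = c * \<psi>0 (A0 p)"
      using rank_one_eq[where \<alpha> = \<alpha>0 and \<beta> = "\<lambda>p. \<psi>0 (A0 p)", OF R0 i] by blast
    have "(\<alpha>1 p - c * (\<psi>0 (A1 p) + \<psi>1 (A0 p))) *s A0 v0 = \<psi>0 (A0 p) *s (w1 - c *s (A1 v0 + A0 v1))"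
      if "p \<in> V" for p
      using R1[OF that] c that by (simp add: algebra_simps)
    then obtain d where d: "\<And>p. p \<in> V \<Longrightarrow> \<alpha>1 p - c * (\<psi>0 (A1 p) + \<psi>1 (A0 p)) = d * \<psi>0 (A0 p)"
      using rank_one_eq[where \<alpha> = "\<lambda>p. \<alpha>1 p - c * (\<psi>0 (A1 p) + \<psi>1 (A0 p))"
          and \<beta> = "\<lambda>p. \<psi>0 (A0 p)", OF _ i] by blast
    \<comment> \<open>The end condition \<alpha> v = 0 says that c times the first nonzero
      coefficient of \<psi> A v vanishes.\<close>
    have "c = 0"
    proof (cases "\<psi>0 (A0 v0) = 0")
      case True
      have "\<alpha>1 v0 = c * (\<psi>0 (A1 v0) + \<psi>1 (A0 v0))" using d[OF v(1)] True by simp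
      then have "c * (\<psi>0 (A0 v1) + \<psi>0 (A1 v0) + \<psi>1 (A0 v0)) = 0"
        using \<alpha>v(2) c(2)[OF v(2)] by (simp add: algebra_simps)
      then show ?thesis using Q1 True i by auto
    next
      case False
      then show ?thesis using \<alpha>v(1) c(2)[OF v(1)] by simp
    qed
    then show ?thesis using c B_vanish[OF T] by simp
  next
    case ii
    have \<theta>: "\<psi>0 (A0 v1) + \<psi>0 (A1 v0) \<noteq> 0" using Q1 ii by (auto simp: ls)
    have w00: "w0 = 0" using R0[OF ii(2)] ii by simp
    have "A1 v0 + A0 v1 \<noteq> 0"
    proof
      assume "A1 v0 + A0 v1 = 0"
      then have "\<psi>0 (A1 v0 + A0 v1) = 0" by (simp add: ls)
      then show False using \<theta> by (simp add: ls add.commute)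
    qed
    moreover have "\<alpha>0 p *s (A1 v0 + A0 v1) = \<psi>0 (A0 p) *s w1" if "p \<in> V" for p
      using R1[OF that] w00 ii by simp
    ultimately obtain c where c: "w1 = c *s (A1 v0 + A0 v1)" "\<And>p. p \<in> V \<Longrightarrow> \<alpha>0 p = c * \<psi>0 (A0 p)"
      using rank_one_eq[where \<alpha> = \<alpha>0 and \<beta> = "\<lambda>p. \<psi>0 (A0 p)", OF _ _ ii(2,3)] by blast
    \<comment> \<open>\<open>D\<close> is what remains of \<open>B0\<close> after subtracting the
      obvious solution c v \<psi>. It satisfies the equations of \<open>transversal_vanish\<close>
      with \<open>u = 0\<close>.\<close>
    define D where "D g = B0 g - (c * \<psi>0 g) *s v0" for g
    have D: "lin D" by (rule linI) (simp_all add: D_def ls algebra_simps)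
    have "D g = 0" if g: "g \<in> W" for g
    proof (rule transversal_vanish[OF V W A0 D \<psi>0 v(1) T, where u = 0 and \<delta> = "\<lambda>k. \<alpha>1 k - c * \<psi>0 (A1 k)"])
      show "A1 (D g) - \<psi>0 g *s 0 \<in> A0 ` V" if g: "g \<in> W" for g
      proof -
        have "A1 (B0 g) = \<psi>0 g *s w1 - A0 (B1 g)" using AB(2)[OF g] w00 by (simp add: algebra_simps)
        then have "A1 (D g) - \<psi>0 g *s 0 = A0 ((c * \<psi>0 g) *s v1 - B1 g)"
          by (simp add: D_def ls c(1) algebra_simps)
        then show ?thesis using V v in_spaces(4)[OF g] by (simp add: subspace_diff subspace_scale)
      qed
      show "D (A1 k) = (\<alpha>1 k - c * \<psi>0 (A1 k)) *s v0" if "k \<in> V" "A0 k = 0" for k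
        using BA(2)[OF that(1)] that c(2)[OF that(1)] by (simp add: D_def ls algebra_simps)
      show "D g \<in> V" if "g \<in> W" for g
        using V v in_spaces(3)[OF that] by (simp add: D_def subspace_diff subspace_scale)
      show "A0 (D g) = 0" if "g \<in> W" for g
        using AB(1)[OF that] w00 ii by (simp add: D_def ls)
      show "D (A0 p) = 0" if "p \<in> V" for p
        using BA(1)[OF that] c(2)[OF that] by (simp add: D_def)
    qed (use g in auto)
    then have B: "B0 g = (c * \<psi>0 g) *s v0" if "g \<in> W" for g using that by (simp add: D_def)
    have "\<alpha>1 v0 = c * \<psi>0 (A1 v0)"
    proof (cases "v0 = 0")
      case False
      have "(c * \<psi>0 (A1 v0)) *s v0 = \<alpha>1 v0 *s v0"
        using BA(2)[OF v(1)] B[of "A1 v0"] in_spaces v \<alpha>v ii by (simp add: ls)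
      then show ?thesis using False by simp
    qed (simp add: ls)
    then have "c * (\<psi>0 (A0 v1) + \<psi>0 (A1 v0)) = 0"
      using \<alpha>v(2) c(2)[OF v(2)] by (simp add: algebra_simps)
    then have "c = 0" using \<theta> by simp
    then show ?thesis using B c w00 by simp
  next
    case iii
    have \<alpha>00: "\<alpha>0 p = 0" if "p \<in> V" for p using R0[OF that] iii that by simp
    have \<theta>: "\<psi>0 (A1 v0) + \<psi>1 (A0 v0) \<noteq> 0" using Q1 iii v by (auto simp: add.assoc)
    have "\<alpha>1 p *s A0 v0 = (\<psi>0 (A1 p) + \<psi>1 (A0 p)) *s w0" if "p \<in> V" for p
      using R1[OF that] \<alpha>00[OF that] iii that by simp
    then obtain c where c: "w0 = c *s A0 v0" "\<And>p. p \<in> V \<Longrightarrow> \<alpha>1 p = c * (\<psi>0 (A1 p) + \<psi>1 (A0 p))"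
      using rank_one_eq[where \<alpha> = \<alpha>1 and \<beta> = "\<lambda>p. \<psi>0 (A1 p) + \<psi>1 (A0 p)", OF _ iii(1) v(1) \<theta>] by blast
    \<comment> \<open>Dual to the preceding case: now \<alpha> has no constant term and
      \<open>\<delta>\<close> is 0, so another alternative of \<open>transversal_vanish\<close>
      applies and \<open>u\<close> may be nonzero. Accordingly c is killed by \<psi> w = 0 instead
      of \<alpha> v = 0.\<close>
    define D where "D g = B0 g - (c * \<psi>0 g) *s v0" for g
    have D: "lin D" by (rule linI) (simp_all add: D_def ls algebra_simps)
    have "D g = 0" if g: "g \<in> W" for g
    proof (rule transversal_vanish[OF V W A0 D \<psi>0 v(1) T, where u = "w1 - c *s A1 v0" and \<delta> = "\<lambda>k. 0"])
      show "A1 (D g) - \<psi>0 g *s (w1 - c *s A1 v0) \<in> A0 ` V" if g: "g \<in> W" for g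
      proof -
        have "A1 (B0 g) = \<psi>0 g *s w1 + \<psi>1 g *s w0 - A0 (B1 g)" using AB(2)[OF g] by (simp add: algebra_simps)
        then have "A1 (D g) - \<psi>0 g *s (w1 - c *s A1 v0) = A0 ((c * \<psi>1 g) *s v0 - B1 g)"
          by (simp add: D_def ls c(1) algebra_simps)
        then show ?thesis using V v in_spaces(4)[OF g] by (simp add: subspace_diff subspace_scale)
      qed
      show "D (A1 k) = 0 *s v0" if "k \<in> V" "A0 k = 0" for k
        using BA(2)[OF that(1)] that c(2)[OF that(1)] \<alpha>00[OF that(1)] by (simp add: D_def ls algebra_simps)
      show "D g \<in> V" if "g \<in> W" for g
        using V v in_spaces(3)[OF that] by (simp add: D_def subspace_diff subspace_scale)
      show "A0 (D g) = 0" if "g \<in> W" for g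
        using AB(1)[OF that] c by (simp add: D_def ls mult.commute)
      show "D (A0 p) = 0" if "p \<in> V" for p
        using BA(1)[OF that] iii that \<alpha>00[OF that] by (simp add: D_def)
    qed (use g in auto)
    then have B: "B0 g = (c * \<psi>0 g) *s v0" if "g \<in> W" for g using that by (simp add: D_def)
    have "\<psi>0 w1 = c * \<psi>0 (A1 v0)"
    proof (cases "\<forall>g\<in>W. \<psi>0 g = 0")
      case True
      then show ?thesis using w in_spaces v by simp
    next
      case False
      then obtain g where g: "g \<in> W" "\<psi>0 g \<noteq> 0" by blast
      have "\<psi>0 (A0 (B1 g) + A1 (B0 g)) = \<psi>0 (\<psi>0 g *s w1 + \<psi>1 g *s w0)" using AB(2)[OF g(1)] by simp
      then have "\<psi>0 g * (c * \<psi>0 (A1 v0)) = \<psi>0 g * \<psi>0 w1"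
        using iii in_spaces(4)[OF g(1)] B[OF g(1)] \<psi>w(1) by (simp add: ls mult_ac)
      then show ?thesis using g by simp
    qed
    then have "c * (\<psi>0 (A1 v0) + \<psi>1 (A0 v0)) = 0" using \<psi>w(2) c(1) by (simp add: ls algebra_simps)
    then have "c = 0" using \<theta> by simp
    then show ?thesis using B c \<alpha>00 by simp
  next
    case iv
    note Q = Q2[OF iv]
    obtain q where q: "q \<in> V" "\<psi>0 (A1 q) + \<psi>1 (A0 q) \<noteq> 0" using Q by blast
    have "\<alpha>0 p *s (A1 v0 + A0 v1) = (\<psi>0 (A1 p) + \<psi>1 (A0 p)) *s w0" if "p \<in> V" for p
      using R1[OF that] iv that by simp
    then obtain c where c: "w0 = c *s (A1 v0 + A0 v1)" "\<And>p. p \<in> V \<Longrightarrow> \<alpha>0 p = c * (\<psi>0 (A1 p) + \<psi>1 (A0 p))"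
      using rank_one_eq[where \<alpha> = \<alpha>0 and \<beta> = "\<lambda>p. \<psi>0 (A1 p) + \<psi>1 (A0 p)", OF _ _ q] Q by blast
    have "c = 0"
      using Q
    proof (elim conjE disjE)
      assume "\<psi>0 (A1 v0) + \<psi>1 (A0 v0) \<noteq> 0"
      then show "c = 0" using c(2)[OF v(1)] \<alpha>v(1) by simp
    next
      assume "v0 = 0" "\<psi>0 (A1 v1) + \<psi>1 (A0 v1) \<noteq> 0"
      then show "c = 0" using c(2)[OF v(2)] \<alpha>v(2) by (simp add: ls)
    next
      assume *: "\<forall>f\<in>W. \<psi>0 f = 0" "\<psi>1 (A1 v0 + A0 v1) \<noteq> 0"
      then have "\<psi>1 w0 = 0" using \<psi>w(2) w by simp
      then show "c = 0" using * c(1) by (simp add: ls(27))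
    qed
    then show ?thesis using c B_vanish[OF T] by simp
  qed
qed

text \<open>With \<open>A0 = 0\<close> on \<open>V\<close>, the kernel is all of \<open>V\<close>
  and the cokernel all of \<open>W\<close>. The rank-one relations then involve the leading
  coefficients of v and \<psi>, of order 0 or 1, so these are the data with respect to which
  \<open>A1\<close> must be in general position.\<close>

lemma vanish_degenerate:
  assumes A00: "\<forall>p\<in>V. A0 p = 0"
    and T: "transversal V W A0 (if v0 = 0 then v1 else v0) (if \<forall>f\<in>W. \<psi>0 f = 0 then \<psi>1 else \<psi>0) A1"
    and nz: "v0 = 0 \<Longrightarrow> v1 \<noteq> 0" "\<forall>f\<in>W. \<psi>0 f = 0 \<Longrightarrow> \<exists>f\<in>W. \<psi>1 f \<noteq> 0"
  shows "(\<forall>p\<in>V. \<alpha>0 p = 0) \<and> (\<forall>f\<in>W. B0 f = 0) \<and> w0 = 0"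
proof -
  let ?v = "if v0 = 0 then v1 else v0" and ?\<psi> = "if \<forall>f\<in>W. \<psi>0 f = 0 then \<psi>1 else \<psi>0"
  have BA0: "\<alpha>0 p *s v0 = 0" if "p \<in> V" for p using BA(1)[OF that] A00 that by (simp add: ls)
  have BA1: "B0 (A1 p) = \<alpha>0 p *s v1 + \<alpha>1 p *s v0" if "p \<in> V" for p
    using BA(2)[OF that] A00 that by (simp add: ls)
  have AB0: "\<psi>0 f *s w0 = 0" if "f \<in> W" for f using AB(1)[OF that] A00 in_spaces(3)[OF that] by simp
  have AB1: "A1 (B0 f) = \<psi>0 f *s w1 + \<psi>1 f *s w0" if "f \<in> W" for f
    using AB(2)[OF that] A00 in_spaces(4)[OF that] by simp
  have v': "?v \<in> V" and \<psi>': "fnl ?\<psi>" using v \<psi>0 \<psi>1 by auto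
  have B: "B0 f = 0" if f: "f \<in> W" for f
  proof (rule transversal_vanish[OF V W A0 B0(1) \<psi>' v' T,
        where u = "if \<forall>f\<in>W. \<psi>0 f = 0 then w0 else w1" and \<delta> = "if v0 = 0 then \<alpha>0 else \<alpha>1"])
    show "A1 (B0 g) - ?\<psi> g *s (if \<forall>f\<in>W. \<psi>0 f = 0 then w0 else w1) \<in> A0 ` V" if "g \<in> W" for g
    proof -
      have "A1 (B0 g) - ?\<psi> g *s (if \<forall>f\<in>W. \<psi>0 f = 0 then w0 else w1) = 0"
        using AB1[OF that] AB0 that by auto
      then show ?thesis using V subspace_0 ls(3) by (metis image_eqI)
    qed
    show "B0 (A1 k) = (if v0 = 0 then \<alpha>0 else \<alpha>1) k *s ?v" if "k \<in> V" "A0 k = 0" for k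
      using BA1[OF that(1)] BA0[OF that(1)] by auto
    show "(if \<forall>f\<in>W. \<psi>0 f = 0 then w0 else w1) = 0 \<or>
        (\<forall>k\<in>V. A0 k = 0 \<longrightarrow> (if v0 = 0 then \<alpha>0 else \<alpha>1) k = 0) \<or> (if v0 = 0 then \<alpha>0 else \<alpha>1) ?v = 0"
      using \<alpha>v(2) BA0[OF v(2)] by (auto simp: ls)
  qed (use f in_spaces A00 in \<open>auto simp: ls\<close>)
  have "\<alpha>0 p = 0" if "p \<in> V" for p
    using BA0[OF that] BA1[OF that] B[OF in_spaces(2)[OF that]] nz(1) by (cases "v0 = 0") auto
  moreover have "w0 = 0"
    using AB0 AB1 B nz(2) by (metis add_0_left lin_0[OF A1(1)] scale_eq_0_iff)
  ultimately show ?thesis using B by blast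
qed

end

context fin_vspace
begin

text \<open>The choice depends on \<open>v0\<close>, \<open>A0\<close>, \<open>\<psi>0\<close> alone
  and must work for all solutions at once. If \<open>A0\<close> vanishes on \<open>V\<close>, then
  \<open>v1\<close> and \<open>\<psi>1\<close> supply nonzero leading terms for v and \<psi>.
  Otherwise \<open>A1\<close> is fixed first by transversality, and \<open>v1\<close>,
  \<open>\<psi>1\<close> are solved for so that the composite \<psi> A v is nonzero.\<close>

lemma ex_block_direction:
  assumes V: "subspace V" and W: "subspace W" and nz: "p0 \<in> V" "p0 \<noteq> 0" "f0 \<in> W" "f0 \<noteq> 0"
    and v0: "v0 \<in> V" and A0: "lin A0" "A0 ` V \<subseteq> W" and \<psi>0: "fnl \<psi>0"
  obtains v1 A1 \<psi>1 where "v1 \<in> V" "lin A1" "A1 ` V \<subseteq> W" "fnl \<psi>1"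
    "\<And>\<alpha>0 \<alpha>1 B0 B1 w0 w1. block scale V W v0 v1 A0 A1 \<psi>0 \<psi>1 \<alpha>0 \<alpha>1 B0 B1 w0 w1 \<Longrightarrow>
      (\<forall>p\<in>V. \<alpha>0 p = 0) \<and> (\<forall>f\<in>W. B0 f = 0) \<and> w0 = 0"
proof (cases "\<forall>p\<in>V. A0 p = 0")
  case True
  obtain \<psi>1 where \<psi>1: "fnl \<psi>1" "\<psi>1 f0 = 1" using fnl_with_value[OF nz(4)] by blast
  have \<psi>f: "\<exists>f\<in>W. \<psi>1 f \<noteq> 0" using nz(3) \<psi>1(2) by (intro bexI[of _ f0]) auto
  let ?v = "if v0 = 0 then p0 else v0" and ?\<psi> = "if \<forall>f\<in>W. \<psi>0 f = 0 then \<psi>1 else \<psi>0"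
  have "?v \<in> V" "fnl ?\<psi>" using nz v0 \<psi>1 \<psi>0 by auto
  then obtain A1 where T: "transversal V W A0 ?v ?\<psi> A1" using ex_transversal[OF V W A0] by blast
  have A1: "lin A1" "A1 ` V \<subseteq> W" using T by (simp_all add: transversal_def)
  show thesis
  proof (rule that[OF nz(1) A1 \<psi>1(1)])
    fix \<alpha>0 \<alpha>1 B0 B1 w0 w1
    assume "block scale V W v0 p0 A0 A1 \<psi>0 \<psi>1 \<alpha>0 \<alpha>1 B0 B1 w0 w1"
    then show "(\<forall>p\<in>V. \<alpha>0 p = 0) \<and> (\<forall>f\<in>W. B0 f = 0) \<and> w0 = 0"
      using True T nz \<psi>f by (intro block.vanish_degenerate) auto
  qed
next
  case False
  then obtain p where p: "p \<in> V" "A0 p \<noteq> 0" by blast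
  obtain A1 where T: "transversal V W A0 v0 \<psi>0 A1" using ex_transversal[OF V W A0 \<psi>0 v0] by blast
  have A1: "lin A1" "A1 ` V \<subseteq> W" using T by (simp_all add: transversal_def)
  have A1W: "A1 q \<in> W" if "q \<in> V" for q using A1 that by blast
  note l = lin_simps(1-5)[OF A0(1)] lin_simps(1-5)[OF A1(1)] lin_simps(6-10)[OF \<psi>0]
  have "\<exists>v1 \<psi>1. v1 \<in> V \<and> fnl \<psi>1 \<and>
     (A0 v0 \<noteq> 0 \<or> (\<exists>p\<in>V. \<psi>0 (A0 p) \<noteq> 0) \<longrightarrow>
      \<psi>0 (A0 v0) \<noteq> 0 \<or> \<psi>0 (A0 v1) + \<psi>0 (A1 v0) + \<psi>1 (A0 v0) \<noteq> 0) \<and>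
     (A0 v0 = 0 \<longrightarrow> (\<forall>p\<in>V. \<psi>0 (A0 p) = 0) \<longrightarrow>
      A1 v0 + A0 v1 \<noteq> 0 \<and> (\<exists>p\<in>V. \<psi>0 (A1 p) + \<psi>1 (A0 p) \<noteq> 0) \<and>
      (\<psi>0 (A1 v0) + \<psi>1 (A0 v0) \<noteq> 0 \<or> v0 = 0 \<and> \<psi>0 (A1 v1) + \<psi>1 (A0 v1) \<noteq> 0 \<or>
        (\<forall>f\<in>W. \<psi>0 f = 0) \<and> \<psi>1 (A1 v0 + A0 v1) \<noteq> 0))" (is "\<exists>v1 \<psi>1. ?P v1 \<psi>1")
  proof (cases "A0 v0 = 0")
    case False
    \<comment> \<open>With \<open>v1 = 0\<close> this value makes the sum of the terms of order t in
      \<psi> A v equal to 1. The scalar in front of \<open>q\<close> below has the same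
      purpose.\<close>
    obtain \<psi>1 where "fnl \<psi>1" "\<psi>1 (A0 v0) = 1 - \<psi>0 (A1 v0)" using fnl_with_value[OF False] by blast
    then have "?P 0 \<psi>1" using False V by (auto simp: l subspace_0)
    then show ?thesis by blast
  next
    case A0v: True
    show ?thesis
    proof (cases "\<forall>p\<in>V. \<psi>0 (A0 p) = 0")
      case False
      then obtain q where q: "q \<in> V" "\<psi>0 (A0 q) \<noteq> 0" by blast
      have "?P (((1 - \<psi>0 (A1 v0)) / \<psi>0 (A0 q)) *s q) (\<lambda>_. 0)"
        using q V A0v by (auto simp: l fnl_zero subspace_scale)
      then show ?thesis by blast
    next
      case \<psi>A: True
      consider "v0 \<noteq> 0" "\<exists>f\<in>W. \<psi>0 f \<noteq> 0" | "v0 = 0" | "\<forall>f\<in>W. \<psi>0 f = 0" by blast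
      then show ?thesis
      proof cases
        case 1
        then have "\<psi>0 (A1 v0) \<noteq> 0" using T A0v \<psi>A unfolding transversal_def by simp
        then have "?P 0 (\<lambda>_. 0)" using V v0 \<psi>A A0v by (auto simp: l fnl_zero subspace_0)
        then show ?thesis by blast
      next
        case 2
        \<comment> \<open>Here v is divisible by t, and with \<open>v1 = p\<close> the coefficient
          of t^2 in \<psi> A v becomes 1.\<close>
        obtain \<psi>1 where \<psi>1: "fnl \<psi>1" "\<psi>1 (A0 p) = 1 - \<psi>0 (A1 p)" using fnl_with_value[OF p(2)] by blast
        then have "\<psi>0 (A1 p) + \<psi>1 (A0 p) \<noteq> 0" by simp
        then have "?P p \<psi>1" using 2 p \<psi>1(1) \<psi>A A0v by (auto simp: l)
        then show ?thesis by blast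
      next
        case 3
        obtain \<psi>1 where \<psi>1: "fnl \<psi>1" "\<psi>1 (A0 p) = 1" using fnl_with_value[OF p(2)] by blast
        \<comment> \<open>Now \<psi> is divisible by t; the factor of \<open>p\<close> normalises
          the coefficient of t^2 in \<psi> A v to 1.\<close>
        define v1 where "v1 = (1 - \<psi>1 (A1 v0)) *s p"
        have e: "\<psi>1 (A1 v0 + A0 v1) = 1" by (simp add: v1_def l lin_simps(6-10)[OF \<psi>1(1)] \<psi>1(2))
        then have "A1 v0 + A0 v1 \<noteq> 0" using fnl_0[OF \<psi>1(1)] by auto
        moreover have "\<psi>0 (A1 p) + \<psi>1 (A0 p) \<noteq> 0" using 3 A1W p \<psi>1 by simp
        moreover have "v1 \<in> V" using V p by (simp add: v1_def subspace_scale)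
        ultimately have "?P v1 \<psi>1" using 3 p \<psi>1(1) \<psi>A A0v e by auto
        then show ?thesis by blast
      qed
    qed
  qed
  then obtain v1 \<psi>1 where v1: "v1 \<in> V" "fnl \<psi>1" and
     Q1: "A0 v0 \<noteq> 0 \<or> (\<exists>p\<in>V. \<psi>0 (A0 p) \<noteq> 0) \<longrightarrow>
      \<psi>0 (A0 v0) \<noteq> 0 \<or> \<psi>0 (A0 v1) + \<psi>0 (A1 v0) + \<psi>1 (A0 v0) \<noteq> 0" and
     Q2: "A0 v0 = 0 \<longrightarrow> (\<forall>p\<in>V. \<psi>0 (A0 p) = 0) \<longrightarrow>
      A1 v0 + A0 v1 \<noteq> 0 \<and> (\<exists>p\<in>V. \<psi>0 (A1 p) + \<psi>1 (A0 p) \<noteq> 0) \<and>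
      (\<psi>0 (A1 v0) + \<psi>1 (A0 v0) \<noteq> 0 \<or> v0 = 0 \<and> \<psi>0 (A1 v1) + \<psi>1 (A0 v1) \<noteq> 0 \<or>
        (\<forall>f\<in>W. \<psi>0 f = 0) \<and> \<psi>1 (A1 v0 + A0 v1) \<noteq> 0)"
    by (elim exE conjE)
  show thesis
  proof (rule that[OF v1(1) A1 v1(2)])
    fix \<alpha>0 \<alpha>1 B0 B1 w0 w1
    assume "block scale V W v0 v1 A0 A1 \<psi>0 \<psi>1 \<alpha>0 \<alpha>1 B0 B1 w0 w1"
    then show "(\<forall>p\<in>V. \<alpha>0 p = 0) \<and> (\<forall>f\<in>W. B0 f = 0) \<and> w0 = 0"
      by (rule block.vanish_nondegenerate[OF _ T Q1[THEN mp] Q2[THEN mp, THEN mp]])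
  qed
qed

text \<open>On a block with one interior space the obvious solution is \<alpha> = c \<phi>, w = c v.
  The perturbation makes a coefficient of order at most two of the composite \<phi> v nonzero, and
  this excludes every c except 0.\<close>

lemma ex_short_block_direction:
  assumes V: "subspace V" and nz: "p0 \<in> V" "p0 \<noteq> 0" and v0: "v0 \<in> V" and \<phi>0: "fnl \<phi>0"
  obtains v1 \<phi>1 where "v1 \<in> V" "fnl \<phi>1"
    "\<And>\<alpha>0 \<alpha>1 w0 w1. \<lbrakk>fnl \<alpha>0; fnl \<alpha>1; w0 \<in> V; w1 \<in> V; \<alpha>0 v0 = 0; \<alpha>0 v1 + \<alpha>1 v0 = 0;
      \<phi>0 w0 = 0; \<phi>0 w1 + \<phi>1 w0 = 0; \<And>p. p \<in> V \<Longrightarrow> \<alpha>0 p *s v0 = \<phi>0 p *s w0;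
      \<And>p. p \<in> V \<Longrightarrow> \<alpha>0 p *s v1 + \<alpha>1 p *s v0 = \<phi>0 p *s w1 + \<phi>1 p *s w0\<rbrakk> \<Longrightarrow>
      (\<forall>p\<in>V. \<alpha>0 p = 0) \<and> w0 = 0"
proof (cases "v0 = 0")
  case v00: False
  then obtain \<phi>1 where \<phi>1: "fnl \<phi>1" "\<phi>1 v0 = 1" using fnl_with_value by blast
  show thesis
  proof (rule that[OF subspace_0[OF V] \<phi>1(1)])
    fix \<alpha>0 \<alpha>1 w0 w1
    assume *: "fnl \<alpha>0" "fnl \<alpha>1" "w0 \<in> V" "w1 \<in> V" "\<alpha>0 v0 = 0" "\<alpha>0 0 + \<alpha>1 v0 = 0"
      "\<phi>0 w0 = 0" "\<phi>0 w1 + \<phi>1 w0 = 0"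
      and e0: "\<And>p. p \<in> V \<Longrightarrow> \<alpha>0 p *s v0 = \<phi>0 p *s w0"
      and e1: "\<And>p. p \<in> V \<Longrightarrow> \<alpha>0 p *s 0 + \<alpha>1 p *s v0 = \<phi>0 p *s w1 + \<phi>1 p *s w0"
    have \<alpha>1v: "\<alpha>1 v0 = 0" using *(1,6) by (simp add: fnl_0)
    show "(\<forall>p\<in>V. \<alpha>0 p = 0) \<and> w0 = 0"
    proof (cases "\<forall>q\<in>V. \<phi>0 q = 0")
      case True
      then have \<alpha>: "\<forall>p\<in>V. \<alpha>0 p = 0" using e0 v00 by auto
      have "w0 = 0" using e1[OF v0] True v0 \<phi>1 \<alpha>1v by simp
      with \<alpha> show ?thesis by blast
    next
      case False
      then obtain q where q: "q \<in> V" "\<phi>0 q \<noteq> 0" by blast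
      obtain c where c: "w0 = c *s v0" "\<And>p. p \<in> V \<Longrightarrow> \<alpha>0 p = c * \<phi>0 p"
        using rank_one_eq[where \<alpha> = \<alpha>0 and \<beta> = \<phi>0, OF e0 v00 q] by blast
      have "c * \<phi>0 v0 = 0" using c(2)[OF v0] *(5) by simp
      moreover have "c = 0" if "\<phi>0 v0 = 0"
        using e1[OF v0] that \<alpha>1v \<phi>1 c v00 by simp
      ultimately have "c = 0" by auto
      then show ?thesis using c by simp
    qed
  qed
next
  case v00: True
  show thesis
  proof (cases "\<forall>q\<in>V. \<phi>0 q = 0")
    case True
    obtain \<phi>1 where \<phi>1: "fnl \<phi>1" "\<phi>1 p0 = 1" using fnl_with_value[OF nz(2)] by blast
    show thesis
    proof (rule that[OF nz(1) \<phi>1(1)])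
      fix \<alpha>0 \<alpha>1 w0 w1
      assume *: "fnl \<alpha>0" "fnl \<alpha>1" "\<alpha>0 p0 + \<alpha>1 v0 = 0"
        and e1: "\<And>p. p \<in> V \<Longrightarrow> \<alpha>0 p *s p0 + \<alpha>1 p *s v0 = \<phi>0 p *s w1 + \<phi>1 p *s w0"
      have "w0 = 0" using e1[OF nz(1)] True nz * v00 \<phi>1 by (simp add: fnl_0)
      then show "(\<forall>p\<in>V. \<alpha>0 p = 0) \<and> w0 = 0" using e1 True v00 nz by auto
    qed
  next
    case False
    then obtain q where q: "q \<in> V" "\<phi>0 q \<noteq> 0" by blast
    show thesis
    proof (rule that[OF q(1) fnl_zero])
      fix \<alpha>0 \<alpha>1 w0 w1
      assume *: "fnl \<alpha>0" "fnl \<alpha>1" "\<alpha>0 q + \<alpha>1 v0 = 0"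
        and e0: "\<And>p. p \<in> V \<Longrightarrow> \<alpha>0 p *s v0 = \<phi>0 p *s w0"
        and e1: "\<And>p. p \<in> V \<Longrightarrow> \<alpha>0 p *s q + \<alpha>1 p *s v0 = \<phi>0 p *s w1 + 0 *s w0"
      have q0: "q \<noteq> 0" using q fnl_0[OF \<phi>0] by auto
      have "w0 = 0" using e0[OF q(1)] q v00 by simp
      moreover have "w1 = 0" using e1[OF q(1)] * v00 q by (simp add: fnl_0)
      ultimately show "(\<forall>p\<in>V. \<alpha>0 p = 0) \<and> w0 = 0" using e1 v00 q0 by auto
    qed
  qed
qed

end


section \<open>Cyclic gradings\<close>

locale cyclic_grading = fin_vspace scale Basis
  for scale :: "'a::field \<Rightarrow> 'b::ab_group_add \<Rightarrow> 'b" (infixr \<open>*s\<close> 75)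
    and Basis :: "'b set" +
  fixes m :: nat and V :: "nat \<Rightarrow> 'b set"
  assumes m_pos: "m > 0" and decomposition: "direct_decomposition scale m V"
begin

text \<open>Indices are read modulo \<open>m\<close>, so that arrows can be followed around the
  cycle without a case distinction at its end.\<close>

definition U :: "nat \<Rightarrow> 'b set" where "U i = V (i mod m)"

definition components :: "'b \<Rightarrow> nat \<Rightarrow> 'b" where
  "components v = (THE u. (\<forall>t<m. u t \<in> V t) \<and> (\<forall>t\<ge>m. u t = 0) \<and> v = (\<Sum>t<m. u t))"

definition P :: "nat \<Rightarrow> 'b \<Rightarrow> 'b" where "P i v = components v (i mod m)"

lemma subspace_V: "t < m \<Longrightarrow> subspace (V t)"
  using decomposition by (auto simp: direct_decomposition_def)

lemma subspace_U: "subspace (U i)"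
  using subspace_V m_pos by (simp add: U_def)

lemma components:
  "(\<forall>t<m. components v t \<in> V t) \<and> (\<forall>t\<ge>m. components v t = 0) \<and> v = (\<Sum>t<m. components v t)"
proof -
  have "\<exists>!u. (\<forall>t<m. u t \<in> V t) \<and> (\<forall>t\<ge>m. u t = 0) \<and> v = (\<Sum>t<m. u t)"
    using decomposition by (simp add: direct_decomposition_def)
  from theI'[OF this] show ?thesis unfolding components_def .
qed

lemma components_unique:
  assumes "\<And>t. t < m \<Longrightarrow> u t \<in> V t" "\<And>t. t \<ge> m \<Longrightarrow> u t = 0" "v = (\<Sum>t<m. u t)"
  shows "components v = u"
proof -
  have ex: "\<exists>!u. (\<forall>t<m. u t \<in> V t) \<and> (\<forall>t\<ge>m. u t = 0) \<and> v = (\<Sum>t<m. u t)"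
    using decomposition by (simp add: direct_decomposition_def)
  show ?thesis unfolding components_def by (rule the1_equality[OF ex]) (use assms in auto)
qed

lemma P_in: "P i v \<in> U i"
  using components[of v] m_pos by (simp add: P_def U_def)

lemma P_sum: "(\<Sum>i<m. P i v) = v"
proof -
  have "(\<Sum>i<m. P i v) = (\<Sum>t<m. components v t)" by (rule sum.cong) (auto simp: P_def)
  then show ?thesis using components[of v] by simp
qed

lemma lin_P: "lin (P i)"
proof (rule linI)
  fix x y c
  have "components (x + y) = (\<lambda>t. components x t + components y t)"
    by (rule components_unique)
      (use components[of x] components[of y] subspace_V in \<open>auto simp: subspace_add sum.distrib\<close>)
  then show "P i (x + y) = P i x + P i y" by (simp add: P_def)
  have "components (c *s x) = (\<lambda>t. c *s components x t)"
    by (rule components_unique)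
      (use components[of x] subspace_V in \<open>auto simp: subspace_scale scale_sum_right[symmetric]\<close>)
  then show "P i (c *s x) = c *s P i x" by (simp add: P_def)
qed

lemma P_on:
  assumes "v \<in> U j" shows "P i v = (if i mod m = j mod m then v else 0)"
proof -
  have "components v = (\<lambda>t. if t = j mod m then v else 0)"
    by (rule components_unique)
      (use assms subspace_V m_pos mod_less_divisor[OF m_pos, of j] in \<open>auto simp: U_def subspace_0 if_distrib sum.delta\<close>)
  then show ?thesis by (simp add: P_def)
qed

lemma U_cong: "i mod m = j mod m \<Longrightarrow> U i = U j"
  by (simp add: U_def)

lemma P_cong: "i mod m = j mod m \<Longrightarrow> P i = P j"
  by (simp add: P_def fun_eq_iff)

lemma lin_eq_on_U:
  assumes "lin f" "lin g" and eq: "\<And>i u. i < m \<Longrightarrow> u \<in> U i \<Longrightarrow> f u = g u"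
  shows "f v = g v"
proof -
  have s: "h (\<Sum>i<n. P i v) = (\<Sum>i<n. h (P i v))" if "lin h" for h and n :: nat
    by (induction n) (auto simp: lin_simps(1-5)[OF that])
  have "f v = (\<Sum>i<m. f (P i v))" using s[OF assms(1), of m] by (simp add: P_sum)
  also have "\<dots> = (\<Sum>i<m. g (P i v))" by (rule sum.cong) (auto intro: eq P_in)
  also have "\<dots> = g v" using s[OF assms(2), of m] by (simp add: P_sum)
  finally show ?thesis .
qed

definition deg0 :: "('b \<Rightarrow> 'b) set" where "deg0 = {a. lin a \<and> (\<forall>i. a ` U i \<subseteq> U i)}"
definition deg1 :: "('b \<Rightarrow> 'b) set" where "deg1 = {x. lin x \<and> (\<forall>i. x ` U i \<subseteq> U (Suc i))}"

text \<open>The vector \<open>e\<close> may be 0: a zero component also ends a block.\<close>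

definition small :: "nat \<Rightarrow> bool" where "small i \<longleftrightarrow> (\<exists>e. U i = span {e})"

lemma deg1D: "x \<in> deg1 \<Longrightarrow> lin x" "x \<in> deg1 \<Longrightarrow> u \<in> U i \<Longrightarrow> x u \<in> U (Suc i)"
  by (auto simp: deg1_def)

lemma deg0D: "x \<in> deg0 \<Longrightarrow> lin x" "x \<in> deg0 \<Longrightarrow> u \<in> U i \<Longrightarrow> x u \<in> U i"
  by (auto simp: deg0_def)

lemma small_cong: "i mod m = j mod m \<Longrightarrow> small i = small j"
  using U_cong[of i j] by (simp add: small_def)

text \<open>The convention for \<open>e = 0\<close> lets a zero component be treated like a line
  whose coordinate vanishes identically.\<close>

lemma coordinate:
  assumes "small i"
  obtains e \<epsilon> where "e \<in> U i" "fnl \<epsilon>" "\<And>u. u \<in> U i \<Longrightarrow> u = \<epsilon> u *s e" "e = 0 \<Longrightarrow> \<epsilon> = (\<lambda>_. 0)"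
    "e \<noteq> 0 \<Longrightarrow> \<epsilon> e = 1"
proof -
  obtain e where e: "U i = span {e}" using assms by (auto simp: small_def)
  have eU: "e \<in> U i" by (simp add: e span_base)
  show thesis
  proof (cases "e = 0")
    case True
    then have "u = 0 *s e" if "u \<in> U i" for u using that e by simp
    then show thesis using that[OF eU fnl_zero] True by simp
  next
    case False
    obtain \<epsilon> where \<epsilon>: "fnl \<epsilon>" "\<epsilon> e = 1" using fnl_with_value[OF False] by blast
    have "u = \<epsilon> u *s e" if "u \<in> U i" for u
    proof -
      have "u \<in> range (\<lambda>k. k *s e)" using that e by (simp add: span_singleton)
      then obtain k where "u = k *s e" by blast
      then show ?thesis using \<epsilon> by (simp add: fnl_scale)
    qed
    then show thesis using that[OF eU \<epsilon>(1)] \<epsilon> False by simp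
  qed
qed

lemma lin_rank_one: "fnl \<phi> \<Longrightarrow> lin (\<lambda>v. \<phi> v *s u)"
  by (rule linI) (simp_all add: fnl_add fnl_scale algebra_simps)

text \<open>With \<open>t\<^sup>2 = 0\<close>, the endomorphism \<open>y + t z\<close> of degree \<open>-1\<close> commutes with \<open>x + t \<xi>\<close>, and the
  product of the two vanishes on the components of dimension at most one.\<close>

definition first_order_commuting ::
    "('b \<Rightarrow> 'b) \<Rightarrow> ('b \<Rightarrow> 'b) \<Rightarrow> ('b \<Rightarrow> 'b) \<Rightarrow> ('b \<Rightarrow> 'b) \<Rightarrow> bool" where
  "first_order_commuting x \<xi> y z \<longleftrightarrow>
     lin y \<and> lin z \<and> (\<forall>i. y ` U (Suc i) \<subseteq> U i) \<and> (\<forall>i. z ` U (Suc i) \<subseteq> U i) \<and>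
     (\<forall>i. \<forall>u\<in>U i. x (y u) = y (x u)) \<and> (\<forall>i. \<forall>u\<in>U i. \<xi> (y u) + x (z u) = y (\<xi> u) + z (x u)) \<and>
     (\<forall>i. small i \<longrightarrow> (\<forall>u\<in>U i. y (x u) = 0 \<and> y (\<xi> u) + z (x u) = 0))"

lemma first_order_commutingD:
  assumes "first_order_commuting x \<xi> y z"
  shows "lin y" "lin z" "u \<in> U (Suc i) \<Longrightarrow> y u \<in> U i" "u \<in> U (Suc i) \<Longrightarrow> z u \<in> U i"
    "u \<in> U i \<Longrightarrow> x (y u) = y (x u)" "u \<in> U i \<Longrightarrow> \<xi> (y u) + x (z u) = y (\<xi> u) + z (x u)"
    "small i \<Longrightarrow> u \<in> U i \<Longrightarrow> y (x u) = 0" "small i \<Longrightarrow> u \<in> U i \<Longrightarrow> y (\<xi> u) + z (x u) = 0"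
  using assms unfolding first_order_commuting_def by blast+

text \<open>\<open>g j\<close> is the direction on the \<open>j\<close>-th arrow of the block that starts at \<open>s\<close> and ends at the next
  small component; the values of \<open>g\<close> after the end of the block are irrelevant.\<close>

definition block_direction :: "('b \<Rightarrow> 'b) \<Rightarrow> nat \<Rightarrow> (nat \<Rightarrow> 'b \<Rightarrow> 'b) \<Rightarrow> bool" where
  "block_direction x s g \<longleftrightarrow> (\<forall>j. lin (g j) \<and> g j ` U (s + j) \<subseteq> U (Suc (s + j))) \<and>
     (\<forall>\<xi> y z. first_order_commuting x \<xi> y z \<longrightarrow>
        (\<forall>u\<in>U s. \<xi> u = g 0 u) \<longrightarrow>
        (\<not> small (s + 1) \<longrightarrow> (\<forall>u\<in>U (s + 1). \<xi> u = g 1 u)) \<longrightarrow>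
        (\<not> small (s + 1) \<longrightarrow> \<not> small (s + 2) \<longrightarrow> (\<forall>u\<in>U (s + 2). \<xi> u = g 2 u)) \<longrightarrow>
        (\<forall>u\<in>U (s + 1). y u = 0) \<and>
        (\<not> small (s + 1) \<longrightarrow> (\<forall>u\<in>U (s + 2). y u = 0)) \<and>
        (\<not> small (s + 1) \<longrightarrow> \<not> small (s + 2) \<longrightarrow> (\<forall>u\<in>U (s + 3). y u = 0)))"

lemma not_small_nonzero:
  assumes "\<not> small i" obtains u where "u \<in> U i" "u \<noteq> 0"
proof -
  have "U i \<noteq> {0}" using assms unfolding small_def by (metis insert_absorb2 span_0 span_empty span_insert_0)
  then show thesis using that subspace_0[OF subspace_U[of i]] by blast
qed

text \<open>In the coordinates \<open>\<epsilon>\<close>, \<open>\<eta>\<close> of the two ends, a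
  first-order commuting pair becomes the data of the preceding section: \<alpha> = \<epsilon> y, B =
  y and w = y f, with z in place of y in the coefficients of t. The vanishing of the product on
  small components gives the two end conditions.\<close>

lemma ex_block_direction_graded:
  assumes x: "x \<in> deg1" and s: "small s" and no3: "small (s + 1) \<or> small (s + 2) \<or> small (s + 3)"
  obtains g where "block_direction x s g"
proof -
  note x1 = deg1D[OF x]
  note lx = lin_simps(1-5)[OF x1(1)]
  obtain e \<epsilon> where e: "e \<in> U s" "fnl \<epsilon>" and u_e: "\<And>u. u \<in> U s \<Longrightarrow> u = \<epsilon> u *s e"
    and e0: "e = 0 \<Longrightarrow> \<epsilon> = (\<lambda>_. 0)" and e1: "e \<noteq> 0 \<Longrightarrow> \<epsilon> e = 1"
    by (rule coordinate[OF s], rule that)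
  have xe: "x e \<in> U (s + 1)" using x1(2)[OF e(1)] by simp
  consider (A) "small (s + 1)" | (B) "\<not> small (s + 1)" "small (s + 2)"
    | (C) "\<not> small (s + 1)" "\<not> small (s + 2)" "small (s + 3)" using no3 by blast
  then show thesis
  proof cases
    case A
    obtain f \<eta> where f: "f \<in> U (s + 1)" and "fnl \<eta>" and u_f: "\<And>u. u \<in> U (s + 1) \<Longrightarrow> u = \<eta> u *s f"
      and "f = 0 \<Longrightarrow> \<eta> = (\<lambda>_. 0)" and "f \<noteq> 0 \<Longrightarrow> \<eta> f = 1"
      by (rule coordinate[OF A], rule that)
    \<comment> \<open>On an arrow between two small components, y x = 0 kills y as soon as
      \<open>x e\<close> is nonzero; only when \<open>x e = 0\<close> is a perturbation made, and
      then the coefficient of t kills y.\<close>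
    define g where "g = (\<lambda>j::nat. if j = 0 then (\<lambda>v. \<epsilon> v *s (if x e = 0 then f else 0)) else (\<lambda>v. 0))"
    have "block_direction x s g"
      unfolding block_direction_def
    proof (intro conjI allI impI ballI; (use A in blast)?)
      show "lin (g j)" for j using lin_rank_one[OF e(2)] lin_zero by (simp add: g_def)
      show "g j ` U (s + j) \<subseteq> U (Suc (s + j))" for j
        using f subspace_U by (auto simp: g_def subspace_0 subspace_scale)
    next
      fix \<xi> y z u
      assume fo: "first_order_commuting x \<xi> y z" and \<xi>: "\<forall>u\<in>U s. \<xi> u = g 0 u" and u: "u \<in> U (s + 1)"
      note y = first_order_commutingD[OF fo]
      show "y u = 0"
      proof (cases "e = 0")
        case True
        have "y u \<in> U s" using y(3)[of u s] u by simp
        then show ?thesis using u_e True by fastforce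
      next
        case False
        have "y f = 0"
        proof (cases "x e = 0")
          case True
          then have "\<xi> e = f" using \<xi> e(1) e1[OF False] by (simp add: g_def)
          then show ?thesis using y(8)[OF s e(1)] True by (simp add: lin_0[OF y(2)])
        next
          case xe0: False
          have "\<eta> (x e) *s f = x e" using u_f[OF xe] by simp
          then have "\<eta> (x e) *s y f = 0" using y(7)[OF s e(1)] lin_scale[OF y(1)] by metis
          moreover have "\<eta> (x e) \<noteq> 0" using \<open>\<eta> (x e) *s f = x e\<close> xe0 by auto
          ultimately show ?thesis by simp
        qed
        then have "\<eta> u *s y f = 0" by simp
        then show ?thesis using u_f[OF u] lin_scale[OF y(1)] by metis
      qed
    qed
    then show thesis by (rule that)
  next
    case B
    obtain f \<eta> where f: "f \<in> U (s + 2)" "fnl \<eta>" and u_f: "\<And>u. u \<in> U (s + 2) \<Longrightarrow> u = \<eta> u *s f"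
      and f0: "f = 0 \<Longrightarrow> \<eta> = (\<lambda>_. 0)" and f1: "f \<noteq> 0 \<Longrightarrow> \<eta> f = 1"
      by (rule coordinate[OF B(2)], rule that)
    obtain p0 where p0: "p0 \<in> U (s + 1)" "p0 \<noteq> 0" using not_small_nonzero[OF B(1)] by blast
    have \<phi>0: "fnl (\<lambda>u. \<eta> (x u))" by (rule fnlI) (simp_all add: lx lin_simps(6-10)[OF f(2)])
    have x_f: "x u = \<eta> (x u) *s f" if "u \<in> U (s + 1)" for u using x1(2)[OF that] u_f by simp
    obtain v1 \<phi>1 where v1: "v1 \<in> U (s + 1)" "fnl \<phi>1"
      "\<And>\<alpha>0 \<alpha>1 w0 w1. \<lbrakk>fnl \<alpha>0; fnl \<alpha>1; w0 \<in> U (s + 1); w1 \<in> U (s + 1); \<alpha>0 (x e) = 0; \<alpha>0 v1 + \<alpha>1 (x e) = 0;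
        \<eta> (x w0) = 0; \<eta> (x w1) + \<phi>1 w0 = 0; \<And>p. p \<in> U (s + 1) \<Longrightarrow> \<alpha>0 p *s x e = \<eta> (x p) *s w0;
        \<And>p. p \<in> U (s + 1) \<Longrightarrow> \<alpha>0 p *s v1 + \<alpha>1 p *s x e = \<eta> (x p) *s w1 + \<phi>1 p *s w0\<rbrakk> \<Longrightarrow>
        (\<forall>p\<in>U (s + 1). \<alpha>0 p = 0) \<and> w0 = 0"
      using ex_short_block_direction[OF subspace_U p0 xe \<phi>0] by blast
    define g where "g = (\<lambda>j::nat. if j = 0 then (\<lambda>v. \<epsilon> v *s v1) else if j = 1 then (\<lambda>v. \<phi>1 v *s f) else (\<lambda>v. 0))"
    have "block_direction x s g"
      unfolding block_direction_def
    proof (intro conjI allI impI)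
      show "lin (g j)" for j using lin_rank_one[OF e(2)] lin_rank_one[OF v1(2)] lin_zero by (simp add: g_def)
      show "g j ` U (s + j) \<subseteq> U (Suc (s + j))" for j
        using v1(1) f(1) subspace_U by (auto simp: g_def subspace_0 subspace_scale)
    next
      fix \<xi> y z
      assume fo: "first_order_commuting x \<xi> y z" and \<xi>0: "\<forall>u\<in>U s. \<xi> u = g 0 u"
        and \<xi>1: "\<not> small (s + 1) \<longrightarrow> (\<forall>u\<in>U (s + 1). \<xi> u = g 1 u)"
      note y = first_order_commutingD[OF fo]
      note ly = lin_simps(1-5)[OF y(1)] and lz = lin_simps(1-5)[OF y(2)]
      have \<xi>e: "\<xi> e = v1" if "e \<noteq> 0" using \<xi>0 e(1) e1[OF that] by (simp add: g_def)
      have \<xi>V: "\<xi> p = \<phi>1 p *s f" if "p \<in> U (s + 1)" for p using \<xi>1 B that by (simp add: g_def)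
      have yV: "y p \<in> U s" "z p \<in> U s" if "p \<in> U (s + 1)" for p using y(3,4)[of p s] that by simp_all
      have ye: "y p = \<epsilon> (y p) *s e" "z p = \<epsilon> (z p) *s e" if "p \<in> U (s + 1)" for p
        using yV[OF that] u_e by simp_all
      have W: "y f \<in> U (s + 1)" "z f \<in> U (s + 1)" using y(3,4)[of f "s + 1"] f(1) by simp_all
      have \<xi>y: "\<xi> (y p) = \<epsilon> (y p) *s v1" if "p \<in> U (s + 1)" for p
        using \<xi>0 yV[OF that] by (simp add: g_def)
      have main: "(\<forall>p\<in>U (s + 1). \<epsilon> (y p) = 0) \<and> y f = 0"
      proof (rule v1(3)[where ?\<alpha>1.0 = "\<lambda>p. \<epsilon> (z p)" and ?w1.0 = "z f"])
        show "fnl (\<lambda>p. \<epsilon> (y p))" "fnl (\<lambda>p. \<epsilon> (z p))"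
          by (rule fnlI; simp add: ly lz lin_simps(6-10)[OF e(2)])+
        show "\<epsilon> (y (x e)) = 0" using y(7)[OF s e(1)] by (simp add: fnl_0[OF e(2)])
        show "\<epsilon> (y v1) + \<epsilon> (z (x e)) = 0"
        proof (cases "e = 0")
          case False
          then have "\<epsilon> (y (\<xi> e) + z (x e)) = 0" using y(8)[OF s e(1)] by (simp add: fnl_0[OF e(2)])
          then show ?thesis using \<xi>e[OF False] by (simp add: fnl_add[OF e(2)])
        qed (simp add: e0)
        show "\<eta> (x (y f)) = 0" using y(5)[OF f(1)] y(7)[OF B(2) f(1)] by (simp add: fnl_0[OF f(2)])
        show "\<eta> (x (z f)) + \<phi>1 (y f) = 0"
        proof (cases "f = 0")
          case True
          then show ?thesis using f0 by (simp add: ly fnl_0[OF v1(2)])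
        next
          case False
          have "\<xi> (y f) + x (z f) = 0" using y(6)[OF f(1)] y(8)[OF B(2) f(1)] by simp
          then have "\<eta> (\<phi>1 (y f) *s f + x (z f)) = 0" using \<xi>V[OF W(1)] by (simp add: fnl_0[OF f(2)])
          then show ?thesis using f1[OF False] by (simp add: lin_simps(6-10)[OF f(2)] add.commute)
        qed
        show "\<epsilon> (y p) *s x e = \<eta> (x p) *s y f" if "p \<in> U (s + 1)" for p
        proof -
          have "\<epsilon> (y p) *s x e = x (y p)" using ye(1)[OF that] lx(2) by metis
          also have "\<dots> = y (x p)" using y(5)[OF that] .
          also have "\<dots> = \<eta> (x p) *s y f" using x_f[OF that] ly(2) by metis
          finally show ?thesis .
        qed
        show "\<epsilon> (y p) *s v1 + \<epsilon> (z p) *s x e = \<eta> (x p) *s z f + \<phi>1 p *s y f" if "p \<in> U (s + 1)" for p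
        proof -
          have "\<epsilon> (z p) *s x e = x (z p)" using ye(2)[OF that] lx(2) by metis
          moreover have "\<eta> (x p) *s z f = z (x p)" using x_f[OF that] lz(2) by metis
          ultimately show ?thesis using y(6)[OF that] \<xi>y[OF that] \<xi>V[OF that] by (simp add: ly add.commute)
        qed
      qed (rule W)+
      show "\<forall>u\<in>U (s + 1). y u = 0" using main ye by force
      show "\<forall>u\<in>U (s + 2). y u = 0" using main u_f ly(2) by (metis scale_zero_right)
    qed (use B in blast)+
    then show thesis by (rule that)
  next
    case C
    obtain f \<eta> where f: "f \<in> U (s + 3)" "fnl \<eta>" and u_f: "\<And>u. u \<in> U (s + 3) \<Longrightarrow> u = \<eta> u *s f"
      and f0: "f = 0 \<Longrightarrow> \<eta> = (\<lambda>_. 0)" and f1: "f \<noteq> 0 \<Longrightarrow> \<eta> f = 1"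
      by (rule coordinate[OF C(3)], rule that)
    obtain p0 where p0: "p0 \<in> U (s + 1)" "p0 \<noteq> 0" using not_small_nonzero[OF C(1)] by blast
    obtain q0 where q0: "q0 \<in> U (s + 2)" "q0 \<noteq> 0" using not_small_nonzero[OF C(2)] by blast
    have \<psi>0: "fnl (\<lambda>u. \<eta> (x u))" by (rule fnlI) (simp_all add: lx lin_simps(6-10)[OF f(2)])
    have x_f: "x u = \<eta> (x u) *s f" if "u \<in> U (s + 2)" for u
      using x1(2)[OF that] u_f by (simp add: numeral_eq_Suc)
    have xVW: "x ` U (s + 1) \<subseteq> U (s + 2)" using x1(2)[of _ "s + 1"] by auto
    obtain v1 A1 \<psi>1 where v1: "v1 \<in> U (s + 1)" "lin A1" "A1 ` U (s + 1) \<subseteq> U (s + 2)" "fnl \<psi>1"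
      and blk: "\<And>\<alpha>0 \<alpha>1 B0 B1 w0 w1.
        block scale (U (s + 1)) (U (s + 2)) (x e) v1 x A1 (\<lambda>u. \<eta> (x u)) \<psi>1 \<alpha>0 \<alpha>1 B0 B1 w0 w1 \<Longrightarrow>
        (\<forall>p\<in>U (s + 1). \<alpha>0 p = 0) \<and> (\<forall>f\<in>U (s + 2). B0 f = 0) \<and> w0 = 0"
      using ex_block_direction[OF subspace_U subspace_U p0 q0 xe x1(1) xVW \<psi>0] by blast
    define g where "g = (\<lambda>j::nat. if j = 0 then (\<lambda>v. \<epsilon> v *s v1) else if j = 1 then A1
      else if j = 2 then (\<lambda>v. \<psi>1 v *s f) else (\<lambda>v. 0))"
    have "block_direction x s g"
      unfolding block_direction_def
    proof (intro conjI allI impI)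
      show "lin (g j)" for j
        using lin_rank_one[OF e(2)] lin_rank_one[OF v1(4)] v1(2) lin_zero by (simp add: g_def)
      show "g j ` U (s + j) \<subseteq> U (Suc (s + j))" for j
        using v1(1,3) f(1) subspace_U by (auto simp: g_def subspace_0 subspace_scale numeral_eq_Suc)
    next
      fix \<xi> y z
      assume fo: "first_order_commuting x \<xi> y z" and \<xi>0: "\<forall>u\<in>U s. \<xi> u = g 0 u"
        and \<xi>1: "\<not> small (s + 1) \<longrightarrow> (\<forall>u\<in>U (s + 1). \<xi> u = g 1 u)"
        and \<xi>2: "\<not> small (s + 1) \<longrightarrow> \<not> small (s + 2) \<longrightarrow> (\<forall>u\<in>U (s + 2). \<xi> u = g 2 u)"
      note y = first_order_commutingD[OF fo]
      note ly = lin_simps(1-5)[OF y(1)] and lz = lin_simps(1-5)[OF y(2)]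
      have \<xi>e: "\<xi> e = v1" if "e \<noteq> 0" using \<xi>0 e(1) e1[OF that] by (simp add: g_def)
      have \<xi>V: "\<xi> p = A1 p" if "p \<in> U (s + 1)" for p using \<xi>1 C that by (simp add: g_def)
      have \<xi>W: "\<xi> p = \<psi>1 p *s f" if "p \<in> U (s + 2)" for p using \<xi>2 C that by (simp add: g_def)
      have yV: "y p \<in> U s" "z p \<in> U s" if "p \<in> U (s + 1)" for p using y(3,4)[of p s] that by simp_all
      have ye: "y p = \<epsilon> (y p) *s e" "z p = \<epsilon> (z p) *s e" if "p \<in> U (s + 1)" for p
        using yV[OF that] u_e by simp_all
      have yW: "y p \<in> U (s + 1)" "z p \<in> U (s + 1)" if "p \<in> U (s + 2)" for p
        using y(3,4)[of p "s + 1"] that by simp_all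
      have yf: "y f \<in> U (s + 2)" "z f \<in> U (s + 2)"
        using y(3,4)[of f "s + 2"] f(1) by (simp_all add: numeral_eq_Suc)
      have \<xi>y: "\<xi> (y p) = \<epsilon> (y p) *s v1" if "p \<in> U (s + 1)" for p
        using \<xi>0 yV[OF that] by (simp add: g_def)
      have main: "(\<forall>p\<in>U (s + 1). \<epsilon> (y p) = 0) \<and> (\<forall>f\<in>U (s + 2). y f = 0) \<and> y f = 0"
      proof (rule blk[where ?\<alpha>1.0 = "\<lambda>p. \<epsilon> (z p)" and ?w1.0 = "z f" and ?B1.0 = z],
          intro block.intro[OF vspace_axioms] block_axioms.intro)
        show "fnl (\<lambda>p. \<epsilon> (y p))" "fnl (\<lambda>p. \<epsilon> (z p))"
          by (rule fnlI; simp add: ly lz lin_simps(6-10)[OF e(2)])+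
        show "\<epsilon> (y (x e)) = 0" using y(7)[OF s e(1)] by (simp add: fnl_0[OF e(2)])
        show "\<epsilon> (y v1) + \<epsilon> (z (x e)) = 0"
        proof (cases "e = 0")
          case False
          then have "\<epsilon> (y (\<xi> e) + z (x e)) = 0" using y(8)[OF s e(1)] by (simp add: fnl_0[OF e(2)])
          then show ?thesis using \<xi>e[OF False] by (simp add: fnl_add[OF e(2)])
        qed (simp add: e0)
        show "\<eta> (x (y f)) = 0" using y(5)[OF f(1)] y(7)[OF C(3) f(1)] by (simp add: fnl_0[OF f(2)])
        show "\<eta> (x (z f)) + \<psi>1 (y f) = 0"
        proof (cases "f = 0")
          case True
          then show ?thesis using f0 by (simp add: ly fnl_0[OF v1(4)])
        next
          case False
          have "\<xi> (y f) + x (z f) = 0" using y(6)[OF f(1)] y(8)[OF C(3) f(1)] by simp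
          then have "\<eta> (\<psi>1 (y f) *s f + x (z f)) = 0" using \<xi>W[OF yf(1)] by (simp add: fnl_0[OF f(2)])
          then show ?thesis using f1[OF False] by (simp add: lin_simps(6-10)[OF f(2)] add.commute)
        qed
        show "y (x p) = \<epsilon> (y p) *s x e" if "p \<in> U (s + 1)" for p
          using ye(1)[OF that] lx(2) y(5)[OF that] by metis
        show "y (A1 p) + z (x p) = \<epsilon> (y p) *s v1 + \<epsilon> (z p) *s x e" if "p \<in> U (s + 1)" for p
        proof -
          have "\<epsilon> (z p) *s x e = x (z p)" using ye(2)[OF that] lx(2) by metis
          then show ?thesis using y(6)[OF that] \<xi>y[OF that] \<xi>V[OF that] by simp
        qed
        show "x (y p) = \<eta> (x p) *s y f" if "p \<in> U (s + 2)" for p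
          using x_f[OF that] ly(2) y(5)[OF that] by metis
        show "x (z p) + A1 (y p) = \<eta> (x p) *s z f + \<psi>1 p *s y f" if "p \<in> U (s + 2)" for p
        proof -
          have "\<eta> (x p) *s z f = z (x p)" using x_f[OF that] lz(2) by metis
          then show ?thesis
            using y(6)[OF that] \<xi>V[OF yW(1)[OF that]] \<xi>W[OF that] by (simp add: ly add.commute)
        qed
      qed (use subspace_U xe v1 yf x1 xVW \<psi>0 y yW in auto)
      show "\<forall>u\<in>U (s + 1). y u = 0" using main ye by force
      show "\<forall>u\<in>U (s + 2). y u = 0" using main by blast
      show "\<forall>u\<in>U (s + 3). y u = 0" using main u_f ly(2) by (metis scale_zero_right)
    qed
    then show thesis by (rule that)
  qed
qed

text \<open>The small components cut the cycle into blocks with disjoint sets of arrows, so the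
  block directions can be glued. If there is only one small component, its block starts and ends
  there; reading indices modulo \<open>m\<close> covers this as well.\<close>

lemma ex_generic_direction:
  assumes x: "x \<in> deg1" and no3: "\<And>i. small i \<or> small (i + 1) \<or> small (i + 2)"
  obtains \<xi> where "\<xi> \<in> deg1" "\<And>y z v. first_order_commuting x \<xi> y z \<Longrightarrow> y v = 0"
proof -
  have "\<forall>s. \<exists>g. small s \<longrightarrow> block_direction x s g"
  proof
    fix s show "\<exists>g. small s \<longrightarrow> block_direction x s g"
      using ex_block_direction_graded[OF x, of s] no3[of "s + 1"] by (auto simp: numeral_eq_Suc)
  qed
  then obtain g where g: "\<And>s. small s \<Longrightarrow> block_direction x s (g s)" by metis
  \<comment> \<open>The arrow leaving \<open>i\<close> belongs to the block starting at \<open>i\<close>, \<open>i - 1\<close> or \<open>i - 2\<close>; the multiples of \<open>m\<close>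
    keep the subtraction of natural numbers from truncating.\<close>
  define h where "h = (\<lambda>i. if small i then g i 0
    else if small (i + m - 1) then g ((i + m - 1) mod m) 1 else g ((i + 2 * m - 2) mod m) 2)"
  define \<xi> where "\<xi> = (\<lambda>v. \<Sum>i<m. h i (P i v))"
  have small_mod: "small (i mod m)" if "small i" for i using that small_cong[of i "i mod m"] by simp
  have smallU: "block_direction x (i mod m) (g (i mod m))" if "small i" for i
    using g[OF small_mod[OF that]] .
  have gU: "lin (g (i mod m) j)" "u \<in> U (i + j) \<Longrightarrow> g (i mod m) j u \<in> U (Suc (i + j))" if "small i" for i j u
  proof -
    have "U (i mod m + j) = U (i + j)" "U (Suc (i mod m + j)) = U (Suc (i + j))"
      using mod_add_left_eq[of i m "Suc j"] by (auto intro!: U_cong simp: mod_simps)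
    then show "lin (g (i mod m) j)" "u \<in> U (i + j) \<Longrightarrow> g (i mod m) j u \<in> U (Suc (i + j))"
      using smallU[OF that, unfolded block_direction_def, THEN conjunct1, rule_format, of j] by auto
  qed
  have big: "small (i + 2 * m - 2)" if "\<not> small i" "\<not> small (i + m - 1)" for i
  proof -
    have "small (i + 2 * m - 2 + 1) = small (i + m - 1)"
    proof (rule small_cong)
      have "i + 2 * m - 2 + 1 = (i + m - 1) + m" using m_pos by simp
      then show "(i + 2 * m - 2 + 1) mod m = (i + m - 1) mod m" by (simp only: mod_add_self2)
    qed
    moreover have "small (i + 2 * m - 2 + 2) = small i"
    proof (rule small_cong)
      have "i + 2 * m - 2 + 2 = i + m + m" using m_pos by simp
      then show "(i + 2 * m - 2 + 2) mod m = i mod m" by simp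
    qed
    ultimately show ?thesis using no3[of "i + 2 * m - 2"] that by auto
  qed
  have h: "lin (h i)" "u \<in> U i \<Longrightarrow> h i u \<in> U (Suc i)" if "i < m" for i u
  proof -
    consider "small i" | "\<not> small i" "small (i + m - 1)" | "\<not> small i" "\<not> small (i + m - 1)" by blast
    then have "lin (h i) \<and> (u \<in> U i \<longrightarrow> h i u \<in> U (Suc i))"
    proof cases
      case 1
      then show ?thesis using gU(1)[OF 1, of 0] gU(2)[OF 1, of u 0] that by (simp add: h_def)
    next
      case 2
      have "U (i + m - 1 + 1) = U i" "U (Suc (i + m - 1 + 1)) = U (Suc i)"
        using m_pos by (auto intro!: U_cong simp flip: add_Suc)
      then show ?thesis using gU(1)[OF 2(2), of 1] gU(2)[OF 2(2), of u 1] 2 by (simp add: h_def)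
    next
      case 3
      have e: "i + 2 * m - 2 + 2 = i + m + m" using m_pos by simp
      then have "U (i + 2 * m - 2 + 2) = U i" "U (Suc (i + 2 * m - 2 + 2)) = U (Suc i)"
        unfolding e by (auto intro!: U_cong simp flip: add_Suc)
      then show ?thesis using gU(1)[OF big[OF 3], of 2] gU(2)[OF big[OF 3], of u 2] 3 by (simp add: h_def)
    qed
    then show "lin (h i)" "u \<in> U i \<Longrightarrow> h i u \<in> U (Suc i)" by auto
  qed
  have \<xi>U: "\<xi> u = h (i mod m) u" if "u \<in> U i" for i u
  proof -
    have "h j (P j u) = (if j = i mod m then h (i mod m) u else 0)" if "j < m" for j
      using P_on[OF \<open>u \<in> U i\<close>, of j] that lin_0[OF h(1)[OF that]] by auto
    then have "\<xi> u = (\<Sum>j<m. if j = i mod m then h (i mod m) u else 0)" unfolding \<xi>_def by simp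
    then show ?thesis using m_pos by simp
  qed
  have lin_sum: "lin (\<lambda>v. \<Sum>i<n. h i (P i v))" if "n \<le> m" for n
    using that
  proof (induction n)
    case (Suc n)
    have "lin (h n)" using h(1) Suc by simp
    then show ?case using Suc lin_plus[OF _ lin_comp[OF _ lin_P[of n]], of _ "h n"] by simp
  qed (simp add: lin_zero)
  have "\<xi> \<in> deg1"
    unfolding deg1_def
  proof (intro CollectI conjI allI subsetI)
    show "lin \<xi>" unfolding \<xi>_def using lin_sum[of m] by simp
    fix i u assume "u \<in> \<xi> ` U i"
    then obtain v where v: "v \<in> U i" "u = h (i mod m) v" using \<xi>U by auto
    have "U (Suc (i mod m)) = U (Suc i)" "U (i mod m) = U i" by (auto intro!: U_cong simp: mod_Suc_eq)
    then show "u \<in> U (Suc i)" using h(2)[of "i mod m" v] v m_pos by simp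
  qed
  moreover have "y v = 0" if fo: "first_order_commuting x \<xi> y z" for y z v
  proof -
    \<comment> \<open>At \<open>s + 1\<close> and \<open>s + 2\<close> the backward search in the
      definition of \<open>h\<close> finds \<open>s\<close> again, so along the block
      \<open>\<xi>\<close> is the direction \<open>g s\<close>.\<close>
    have blk: "(\<forall>u\<in>U (s + 1). y u = 0) \<and>
        (\<not> small (s + 1) \<longrightarrow> (\<forall>u\<in>U (s + 2). y u = 0)) \<and>
        (\<not> small (s + 1) \<longrightarrow> \<not> small (s + 2) \<longrightarrow> (\<forall>u\<in>U (s + 3). y u = 0))" if s: "small s" "s < m" for s
    proof -
      have "\<xi> u = g s 0 u" if "u \<in> U s" for u using \<xi>U[OF that] s by (simp add: h_def)
      moreover have "\<xi> u = g s 1 u" if "u \<in> U (s + 1)" "\<not> small (s + 1)" for u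
      proof -
        have *: "((s + 1) mod m + m - 1) mod m = s"
        proof -
          have "((s + 1) mod m + m - 1) mod m = ((s + 1) mod m + (m - 1)) mod m" using m_pos by simp
          also have "\<dots> = (s + 1 + (m - 1)) mod m" by (rule mod_add_left_eq)
          also have "\<dots> = s" using s m_pos by simp
          finally show ?thesis .
        qed
        have "\<not> small ((s + 1) mod m)" using that small_cong[of "s + 1" "(s + 1) mod m"] by simp
        moreover have "small ((s + 1) mod m + m - 1)" using s * small_cong[of "(s + 1) mod m + m - 1" s] by simp
        ultimately have "h ((s + 1) mod m) = g s 1" unfolding h_def * by simp
        then show ?thesis using \<xi>U[OF that(1)] by simp
      qed
      moreover have "\<xi> u = g s 2 u" if "u \<in> U (s + 2)" "\<not> small (s + 1)" "\<not> small (s + 2)" for u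
      proof -
        have *: "((s + 2) mod m + 2 * m - 2) mod m = s"
        proof -
          have "((s + 2) mod m + 2 * m - 2) mod m = ((s + 2) mod m + (2 * m - 2)) mod m" using m_pos by simp
          also have "\<dots> = (s + 2 + (2 * m - 2)) mod m" by (rule mod_add_left_eq)
          also have "\<dots> = (s + m + m) mod m"
            by (rule arg_cong[of _ _ "\<lambda>k. k mod m"]) (use m_pos in simp)
          also have "\<dots> = s" using s by simp
          finally show ?thesis .
        qed
        have **: "((s + 2) mod m + m - 1) mod m = (s + 1) mod m"
        proof -
          have "((s + 2) mod m + m - 1) mod m = ((s + 2) mod m + (m - 1)) mod m" using m_pos by simp
          also have "\<dots> = (s + 2 + (m - 1)) mod m" by (rule mod_add_left_eq)
          also have "\<dots> = (s + 1 + m) mod m"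
            by (rule arg_cong[of _ _ "\<lambda>k. k mod m"]) (use m_pos in simp)
          also have "\<dots> = (s + 1) mod m" by (simp only: mod_add_self2)
          finally show ?thesis .
        qed
        have "\<not> small ((s + 2) mod m)" using that small_cong[of "s + 2" "(s + 2) mod m"] by simp
        moreover have "\<not> small ((s + 2) mod m + m - 1)"
          using that ** small_cong[of "(s + 2) mod m + m - 1" "s + 1"] by simp
        ultimately have "h ((s + 2) mod m) = g s 2" unfolding h_def * by simp
        then show ?thesis using \<xi>U[OF that(1)] by simp
      qed
      ultimately show ?thesis using g[OF s(1)] fo unfolding block_direction_def by blast
    qed
    have blk': "\<forall>u\<in>U (i + 1). y u = 0" "\<not> small (i + 1) \<Longrightarrow> \<forall>u\<in>U (i + 2). y u = 0"
        "\<not> small (i + 1) \<Longrightarrow> \<not> small (i + 2) \<Longrightarrow> \<forall>u\<in>U (i + 3). y u = 0" if s: "small i" for i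
    proof -
      have "U (i mod m + k) = U (i + k)" "small (i mod m + k) = small (i + k)" for k
        by (auto intro!: U_cong small_cong simp: mod_simps)
      note this[of 1] this[of 2] this[of 3]
      note blk[OF small_mod[OF s] mod_less_divisor[OF m_pos], unfolded this]
      then show "\<forall>u\<in>U (i + 1). y u = 0" "\<not> small (i + 1) \<Longrightarrow> \<forall>u\<in>U (i + 2). y u = 0"
        "\<not> small (i + 1) \<Longrightarrow> \<not> small (i + 2) \<Longrightarrow> \<forall>u\<in>U (i + 3). y u = 0"
        by simp_all
    qed
    have "y u = 0" if "u \<in> U i" for i u
    proof -
      \<comment> \<open>Three steps before \<open>i\<close> on the cycle: the last small component
        strictly before \<open>i\<close> is among \<open>j\<close>, \<open>j + 1\<close>,
        \<open>j + 2\<close>.\<close>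
      define j where "j = i + 3 * m - 3"
      have "j + 3 = i + m * 3" using m_pos by (simp add: j_def)
      then have "U (j + 3) = U i" using U_cong[of "i + m * 3" i] by simp
      then have u: "u \<in> U (j + 3)" using that by simp
      consider "small (j + 2)" | "small (j + 1)" "\<not> small (j + 2)"
        | "small j" "\<not> small (j + 1)" "\<not> small (j + 2)" using no3[of j] by blast
      then show ?thesis
      proof cases
        case 1
        then show ?thesis using blk'(1)[OF 1] u by (simp add: numeral_eq_Suc)
      next
        case 2
        then show ?thesis using blk'(2)[OF 2(1)] u by (simp add: numeral_eq_Suc)
      next
        case 3
        then show ?thesis using blk'(3)[OF 3] u by simp
      qed
    qed
    then show "y v = 0" using lin_eq_on_U[OF first_order_commutingD(1)[OF fo] lin_zero] by blast
  qed
  ultimately show thesis by (rule that)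
qed

end


section \<open>Functionals on the component of degree one\<close>

context vspace
begin

lemma vspace_pscale: "vspace (pscale scale :: 'a \<Rightarrow> ('w \<Rightarrow> 'b) \<Rightarrow> 'w \<Rightarrow> 'b)"
  by unfold_locales (auto simp: pscale_def fun_eq_iff algebra_simps)

lemma lin_commutator:
  fixes x :: "'b \<Rightarrow> 'b"
  assumes x: "lin x"
  shows "Vector_Spaces.linear (pscale scale) (pscale scale) (\<lambda>a. commutator a x)"
    "Vector_Spaces.linear (pscale scale) (pscale scale) (commutator x)"
proof -
  interpret E: vspace "pscale scale :: 'a \<Rightarrow> ('b \<Rightarrow> 'b) \<Rightarrow> 'b \<Rightarrow> 'b" by (rule vspace_pscale)
  show "E.lin (\<lambda>a. commutator a x)" "E.lin (commutator x)"
    by (rule E.linI; auto simp: commutator_def pscale_def fun_eq_iff lin_simps(1-5)[OF x] algebra_simps)+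
qed

lemma lin_commutatorI: "lin a \<Longrightarrow> lin b \<Longrightarrow> lin (commutator a b)"
  by (rule linI) (simp_all add: commutator_def lin_add lin_scale algebra_simps)

end

context cyclic_grading
begin

interpretation E: vspace "pscale scale :: 'a \<Rightarrow> ('b \<Rightarrow> 'b) \<Rightarrow> 'b \<Rightarrow> 'b" by (rule vspace_pscale)

section \<open>Trace duality between the components of degree 1 and -1\<close>

lemma P_Suc_deg1:
  assumes x: "x \<in> deg1" shows "P (Suc i) (x v) = x (P i v)"
proof -
  have "P (Suc i) (x v) = x (P i v)" if "u = v" for u
  proof (rule lin_eq_on_U[where f = "\<lambda>v. P (Suc i) (x v)" and g = "\<lambda>v. x (P i v)"])
    show "lin (\<lambda>v. P (Suc i) (x v))" "lin (\<lambda>v. x (P i v))"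
      using deg1D(1)[OF x] lin_P lin_comp by blast+
    fix j u assume u: "j < m" "u \<in> U j"
    have "Suc i mod m = Suc j mod m \<longleftrightarrow> i mod m = j mod m"
    proof
      assume "Suc i mod m = Suc j mod m"
      then have "(Suc i + (m - 1)) mod m = (Suc j + (m - 1)) mod m" by (metis mod_add_left_eq)
      then show "i mod m = j mod m" using m_pos by simp
    qed (metis mod_Suc_eq)
    then show "P (Suc i) (x u) = x (P i u)"
      using P_on[OF deg1D(2)[OF x u(2)]] P_on[OF u(2)] lin_0[OF deg1D(1)[OF x]] by simp
  qed
  then show ?thesis by simp
qed

lemma rank_one_deg0: "u \<in> U i \<Longrightarrow> fnl \<phi> \<Longrightarrow> (\<lambda>v. \<phi> (P i v) *s u) \<in> deg0"
  unfolding deg0_def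
proof (intro CollectI conjI allI subsetI)
  assume u: "u \<in> U i" and \<phi>: "fnl \<phi>"
  show "lin (\<lambda>v. \<phi> (P i v) *s u)"
    by (rule linI) (simp_all add: lin_simps(1-5)[OF lin_P] lin_simps(6-10)[OF \<phi>] algebra_simps)
  fix j w assume "w \<in> (\<lambda>v. \<phi> (P i v) *s u) ` U j"
  then obtain v where v: "v \<in> U j" "w = \<phi> (P i v) *s u" by blast
  show "w \<in> U j"
    using v P_on[OF v(1), of i] u U_cong[of i j] subspace_U[of j] lin_simps(6-10)[OF \<phi>]
    by (cases "i mod m = j mod m") (auto simp: subspace_scale subspace_0)
qed

lemma fnl_expand:
  assumes "fnl \<phi>" shows "\<phi> v = (\<Sum>b\<in>Basis. representation Basis v b * \<phi> b)"
proof -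
  have fs: "\<phi> (\<Sum>b\<in>B. c b *s b) = (\<Sum>b\<in>B. c b * \<phi> b)" for B and c :: "'b \<Rightarrow> 'a"
    by (induction B rule: infinite_finite_induct) (auto simp: lin_simps(6-10)[OF assms])
  have "(\<Sum>b\<in>Basis. representation Basis v b *s b) = v"
    by (rule sum_representation_eq[OF independent_Basis]) (auto simp: span_Basis finite_Basis)
  then show ?thesis using fs[of "representation Basis v" Basis] by simp
qed

lemma lin_expand:
  assumes "lin T" shows "T v = (\<Sum>b\<in>Basis. representation Basis v b *s T b)"
proof -
  have fs: "T (\<Sum>b\<in>B. c b *s b) = (\<Sum>b\<in>B. c b *s T b)" for B and c :: "'b \<Rightarrow> 'a"
    by (induction B rule: infinite_finite_induct) (auto simp: lin_simps(1-5)[OF assms])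
  have "(\<Sum>b\<in>Basis. representation Basis v b *s b) = v"
    by (rule sum_representation_eq[OF independent_Basis]) (auto simp: span_Basis finite_Basis)
  then show ?thesis using fs[of "representation Basis v" Basis] by simp
qed

lemma fnl_representation: "fnl (\<lambda>v. representation Basis v b)"
  by (rule fnlI) (simp_all add: representation_add representation_scale independent_Basis span_Basis)

lemma E_fnl_sum:
  assumes "E.fnl F" shows "F (\<Sum>b\<in>B. h b) = (\<Sum>b\<in>B. F (h b))"
  by (induction B rule: infinite_finite_induct)
    (simp_all only: sum.infinite sum.empty sum.insert E.fnl_add[OF assms] E.fnl_0[OF assms] if_False not_False_eq_True)

text \<open>The trace pairing of \<open>Hom (U i, U (i + 1))\<close> with \<open>Hom (U (i + 1), U i)\<close>, in terms of maps
  of rank one.\<close>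

definition represents :: "('b \<Rightarrow> 'b) \<Rightarrow> (('b \<Rightarrow> 'b) \<Rightarrow> 'a) \<Rightarrow> bool" where
  "represents y F \<longleftrightarrow> lin y \<and> (\<forall>i. y ` U (Suc i) \<subseteq> U i) \<and>
     (\<forall>i u \<phi>. u \<in> U (Suc i) \<longrightarrow> fnl \<phi> \<longrightarrow> F (\<lambda>v. \<phi> (P i v) *s u) = \<phi> (y u))"

lemma representsD:
  assumes "represents y F"
  shows "lin y" "u \<in> U (Suc i) \<Longrightarrow> y u \<in> U i"
    "u \<in> U (Suc i) \<Longrightarrow> fnl \<phi> \<Longrightarrow> F (\<lambda>v. \<phi> (P i v) *s u) = \<phi> (y u)"
  using assms unfolding represents_def by blast+

lemma fnl_eqI:
  assumes "\<And>\<phi>. fnl \<phi> \<Longrightarrow> \<phi> u = \<phi> w" shows "u = w"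
proof (rule ccontr)
  assume "u \<noteq> w"
  then obtain \<phi> where \<phi>: "fnl \<phi>" "\<phi> (u - w) = 1" using fnl_with_value[of "u - w" 1] by auto
  then show False using assms[OF \<phi>(1)] by (simp add: fnl_diff)
qed

text \<open>The values of \<open>F\<close> on maps of rank one are the matrix coefficients of the
  map sought; they are assembled in the coordinates of \<open>Basis\<close>.\<close>

lemma ex_represents:
  assumes F: "E.fnl F"
  obtains y where "represents y F"
proof -
  \<comment> \<open>The sum over all components makes \<open>y\<close> linear on the whole space; on
    \<open>U (Suc i)\<close> only the summand of index \<open>i\<close> modulo \<open>m\<close>
    survives.\<close>
  define G where "G u \<phi> = (\<Sum>i<m. F (\<lambda>v. \<phi> (P i v) *s P (Suc i) u))" for u and \<phi> :: "'b \<Rightarrow> 'a"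
  define y where "y u = (\<Sum>b\<in>Basis. G u (\<lambda>v. representation Basis v b) *s b)" for u
  have Fadd: "F (\<lambda>v. f v + g v) = F f + F g" for f g
    using E.fnl_add[OF F, of f g] by (simp add: plus_fun_def)
  have Fscale: "F (\<lambda>v. c *s f v) = c * F f" for c f
    using E.fnl_scale[OF F, of c f] by (simp add: pscale_def)
  have Gadd: "G (u + w) \<phi> = G u \<phi> + G w \<phi>" for u w \<phi>
    by (simp add: G_def lin_add[OF lin_P] scale_right_distrib Fadd sum.distrib)
  have Gscale: "G (c *s u) \<phi> = c * G u \<phi>" for c u \<phi>
  proof -
    have "F (\<lambda>v. \<phi> (P i v) *s P (Suc i) (c *s u)) = c * F (\<lambda>v. \<phi> (P i v) *s P (Suc i) u)" for i
      unfolding Fscale[symmetric] by (simp add: lin_scale[OF lin_P] mult.commute)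
    then show ?thesis by (simp add: G_def sum_distrib_left)
  qed
  have liny: "lin y"
    by (rule linI) (simp_all add: y_def Gadd Gscale scale_left_distrib sum.distrib scale_sum_right)
  have GU: "G u \<phi> = F (\<lambda>v. \<phi> (P i v) *s u)" if "u \<in> U (Suc i)" for u \<phi> i
  proof -
    have "F (\<lambda>v. \<phi> (P j v) *s P (Suc j) u) = (if j = i mod m then F (\<lambda>v. \<phi> (P i v) *s u) else 0)"
      if "j < m" for j
    proof (cases "j = i mod m")
      case True
      have "P j = P i" "P (Suc j) u = u"
        using P_on[OF \<open>u \<in> U (Suc i)\<close>, of "Suc j"] True by (auto intro: P_cong simp: mod_Suc_eq)
      then show ?thesis using True by simp
    next
      case False
      have "Suc j mod m \<noteq> Suc i mod m"
      proof
        assume "Suc j mod m = Suc i mod m"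
        then have "(Suc j + (m - 1)) mod m = (Suc i + (m - 1)) mod m" by (metis mod_add_left_eq)
        then show False using m_pos False \<open>j < m\<close> by simp
      qed
      then have "P (Suc j) u = 0" using P_on[OF \<open>u \<in> U (Suc i)\<close>, of "Suc j"] by simp
      then show ?thesis using False Fscale[of 0 "\<lambda>_. 0"] by simp
    qed
    then have "G u \<phi> = (\<Sum>j<m. if j = i mod m then F (\<lambda>v. \<phi> (P i v) *s u) else 0)"
      unfolding G_def by simp
    then show ?thesis using m_pos by simp
  qed
  have rep: "F (\<lambda>v. \<phi> (P i v) *s u) = \<phi> (y u)" if u: "u \<in> U (Suc i)" and \<phi>: "fnl \<phi>" for i u \<phi>
  proof -
    have fs: "\<phi> (\<Sum>b\<in>B. c b *s b) = (\<Sum>b\<in>B. c b * \<phi> b)" for B and c :: "'b \<Rightarrow> 'a"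
      by (induction B rule: infinite_finite_induct) (auto simp: lin_simps(6-10)[OF \<phi>])
    have "(\<lambda>v. \<phi> (P i v) *s u) = (\<Sum>b\<in>Basis. (\<lambda>v. \<phi> b *s (representation Basis (P i v) b *s u)))"
      by (rule ext) (subst fnl_expand[OF \<phi>], simp add: scale_sum_left sum_fun_apply mult.commute)
    then have "F (\<lambda>v. \<phi> (P i v) *s u) = (\<Sum>b\<in>Basis. \<phi> b * F (\<lambda>v. representation Basis (P i v) b *s u))"
      by (simp only: E_fnl_sum[OF F] Fscale)
    also have "\<dots> = \<phi> (y u)"
      unfolding y_def fs by (rule sum.cong) (simp_all add: GU[OF u] mult.commute)
    finally show ?thesis .
  qed
  have "y u \<in> U i" if u: "u \<in> U (Suc i)" for i u
  proof -
    \<comment> \<open>Replacing \<phi> by its composite with the idempotent \<open>P i\<close> does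
      not change the map of rank one, so no functional distinguishes the two sides.\<close>
    have "P i (y u) = y u"
    proof (rule fnl_eqI)
      fix \<phi> assume \<phi>: "fnl \<phi>"
      have "fnl (\<lambda>v. \<phi> (P i v))"
        by (rule fnlI) (simp_all add: lin_simps(1-5)[OF lin_P] lin_simps(6-10)[OF \<phi>])
      from rep[OF u this] have "\<phi> (P i (y u)) = F (\<lambda>v. \<phi> (P i (P i v)) *s u)" by simp
      moreover have "P i (P i v) = P i v" for v using P_on[OF P_in[of i v], of i] by simp
      ultimately show "\<phi> (P i (y u)) = \<phi> (y u)" using rep[OF u \<phi>] by simp
    qed
    then show ?thesis using P_in[of i "y u"] by simp
  qed
  then have "represents y F" unfolding represents_def using liny rep by auto
  then show thesis by (rule that)
qed

text \<open>The commutator of a map of rank one with \<open>x\<close> is a difference of two such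
  maps. Thus \<open>F\<close> kills all commutators with \<open>x\<close> only if \<open>y\<close>
  commutes with \<open>x\<close>.\<close>

lemma represents_commutator:
  assumes F: "E.fnl F" and y: "represents y F" and x: "x \<in> deg1" and u: "u \<in> U i" and \<phi>: "fnl \<phi>"
  shows "F (commutator (\<lambda>v. \<phi> (P i v) *s u) x) = \<phi> (x (y u)) - \<phi> (y (x u))"
proof -
  \<comment> \<open>The predecessor of \<open>i\<close> on the cycle; \<open>m\<close> is added
    before subtracting 1 to avoid truncation.\<close>
  define j where "j = i + m - 1"
  have "Suc j = i + m" using m_pos by (simp add: j_def)
  then have j: "U (Suc j) = U i" "P (Suc j) = P i" using U_cong[of "i + m" i] P_cong[of "i + m" i] by simp_all
  note x1 = deg1D[OF x]
  have \<phi>x: "fnl (\<lambda>v. \<phi> (x v))"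
    by (rule fnlI) (simp_all add: lin_simps(1-5)[OF x1(1)] lin_simps(6-10)[OF \<phi>])
  have "commutator (\<lambda>v. \<phi> (P i v) *s u) x = (\<lambda>v. \<phi> (x (P j v)) *s u) - (\<lambda>v. \<phi> (P i v) *s x u)"
    using P_Suc_deg1[OF x, of j] j by (simp add: commutator_def fun_eq_iff lin_scale[OF x1(1)])
  then have "F (commutator (\<lambda>v. \<phi> (P i v) *s u) x) =
      F (\<lambda>v. \<phi> (x (P j v)) *s u) - F (\<lambda>v. \<phi> (P i v) *s x u)"
    by (simp add: E.fnl_diff[OF F])
  then show ?thesis
    using representsD(3)[OF y _ \<phi>x, of u j] representsD(3)[OF y x1(2)[OF u] \<phi>] u j by simp
qed

lemma P_deg0: "P i \<in> deg0"
  unfolding deg0_def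
  using P_on lin_P subspace_0[OF subspace_U] by (auto split: if_splits)

lemma deg1_comp_P:
  assumes x: "x \<in> deg1" shows "(\<lambda>v. x (P i v)) \<in> deg1"
  unfolding deg1_def
proof (intro CollectI conjI allI subsetI)
  show "lin (\<lambda>v. x (P i v))" using lin_comp[OF deg1D(1)[OF x] lin_P] .
  fix j u assume "u \<in> (\<lambda>v. x (P i v)) ` U j"
  then obtain v where "v \<in> U j" "u = x (P i v)" by blast
  then show "u \<in> U (Suc j)"
    using P_on[of v j i] deg1D[OF x] subspace_0[OF subspace_U] by (auto simp: lin_0)
qed

lemma commutator_P: "x \<in> deg1 \<Longrightarrow> commutator (P (Suc i)) x = (\<lambda>v. x (P i v)) - (\<lambda>v. x (P (Suc i) v))"
  using P_Suc_deg1[of x i] by (simp add: commutator_def fun_eq_iff)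

text \<open>\<open>F (\<lambda>v. x (P i v))\<close> is the trace of y x on the component
  \<open>U i\<close>; on a line an endomorphism is multiplication by its trace.\<close>

lemma represents_trace:
  assumes y: "represents y F" and x: "x \<in> deg1" and e: "e \<in> U i" and \<epsilon>: "fnl \<epsilon>"
    and u_e: "\<And>u. u \<in> U i \<Longrightarrow> u = \<epsilon> u *s e"
  shows "y (x e) = F (\<lambda>v. x (P i v)) *s e"
proof -
  have "x (P i v) = \<epsilon> (P i v) *s x e" for v
    using u_e[OF P_in[of i v]] lin_scale[OF deg1D(1)[OF x]] by metis
  then have "F (\<lambda>v. x (P i v)) = \<epsilon> (y (x e))"
    using representsD(3)[OF y deg1D(2)[OF x e] \<epsilon>] by simp
  then show ?thesis using u_e[OF representsD(2)[OF y deg1D(2)[OF x e]]] by simp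
qed

text \<open>\<open>F\<close> and \<open>H\<close> become \<open>y\<close> and \<open>z\<close>:
  \<open>F0\<close> and \<open>F1\<close> are the two orders of the commutation relation, and the
  trace conditions \<open>tr\<close> on one component spread to all of them.\<close>

lemma functional_vanish:
  assumes x: "x \<in> deg1" and \<xi>: "\<xi> \<in> deg1"
    and gen: "\<And>y z v. first_order_commuting x \<xi> y z \<Longrightarrow> y v = 0"
    and F: "E.fnl F" and H: "E.fnl H"
    and F0: "\<And>a. a \<in> deg0 \<Longrightarrow> F (commutator a x) = 0"
    and F1: "\<And>a. a \<in> deg0 \<Longrightarrow> F (commutator a \<xi>) + H (commutator a x) = 0"
    and tr: "F (\<lambda>v. x (P k v)) = 0" "F (\<lambda>v. \<xi> (P k v)) + H (\<lambda>v. x (P k v)) = 0"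
    and T: "T \<in> deg1"
  shows "F T = 0"
proof -
  obtain y where y: "represents y F" using ex_represents[OF F] by blast
  obtain z where z: "represents z H" using ex_represents[OF H] by blast
  note x1 = deg1D[OF x] and \<xi>1 = deg1D[OF \<xi>] and y1 = representsD[OF y] and z1 = representsD[OF z]
  have tr0: "F (\<lambda>v. x (P i v)) = 0" "F (\<lambda>v. \<xi> (P i v)) + H (\<lambda>v. x (P i v)) = 0" for i
  proof -
    \<comment> \<open>The commutator of \<open>P (Suc i)\<close> with \<open>x\<close> compares
      \<open>x\<close> on two neighbouring components, so the traces there agree.\<close>
    have s: "F (\<lambda>v. x (P (Suc i) v)) = F (\<lambda>v. x (P i v))"
      "F (\<lambda>v. \<xi> (P (Suc i) v)) + H (\<lambda>v. x (P (Suc i) v)) = F (\<lambda>v. \<xi> (P i v)) + H (\<lambda>v. x (P i v))" for i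
      using F0[OF P_deg0[of "Suc i"]] F1[OF P_deg0[of "Suc i"]]
      by (simp_all add: commutator_P x \<xi> E.fnl_diff[OF F] E.fnl_diff[OF H] algebra_simps)
    have c: "F (\<lambda>v. x (P i v)) = F (\<lambda>v. x (P 0 v))"
      "F (\<lambda>v. \<xi> (P i v)) + H (\<lambda>v. x (P i v)) = F (\<lambda>v. \<xi> (P 0 v)) + H (\<lambda>v. x (P 0 v))" for i
      by (induction i) (simp_all add: s)
    show "F (\<lambda>v. x (P i v)) = 0" "F (\<lambda>v. \<xi> (P i v)) + H (\<lambda>v. x (P i v)) = 0"
      using tr c[of k] c[of i] by simp_all
  qed
  have "first_order_commuting x \<xi> y z"
    unfolding first_order_commuting_def
  proof (intro conjI allI ballI impI)
    show "x (y u) = y (x u)" if u: "u \<in> U i" for i u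
    proof (rule fnl_eqI)
      fix \<phi> assume \<phi>: "fnl \<phi>"
      show "\<phi> (x (y u)) = \<phi> (y (x u))"
        using represents_commutator[OF F y x u \<phi>] F0[OF rank_one_deg0[OF u \<phi>]] by simp
    qed
    show "\<xi> (y u) + x (z u) = y (\<xi> u) + z (x u)" if u: "u \<in> U i" for i u
    proof (rule fnl_eqI)
      fix \<phi> assume \<phi>: "fnl \<phi>"
      have "\<phi> (\<xi> (y u)) - \<phi> (y (\<xi> u)) + (\<phi> (x (z u)) - \<phi> (z (x u))) = 0"
        using represents_commutator[OF F y \<xi> u \<phi>] represents_commutator[OF H z x u \<phi>]
          F1[OF rank_one_deg0[OF u \<phi>]] by simp
      then show "\<phi> (\<xi> (y u) + x (z u)) = \<phi> (y (\<xi> u) + z (x u))"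
        by (simp add: fnl_add[OF \<phi>] algebra_simps)
    qed
    fix i u assume i: "small i" and u: "u \<in> U i"
    obtain e \<epsilon> where e: "e \<in> U i" and \<epsilon>: "fnl \<epsilon>" and u_e: "\<And>u. u \<in> U i \<Longrightarrow> u = \<epsilon> u *s e"
      and "e = 0 \<Longrightarrow> \<epsilon> = (\<lambda>_. 0)" and "e \<noteq> 0 \<Longrightarrow> \<epsilon> e = 1"
      by (rule coordinate[OF i], rule that)
    have "y (x e) = 0" using represents_trace[OF y x e \<epsilon> u_e] tr0(1)[of i] by simp
    then show "y (x u) = 0"
      using u_e[OF u] lin_scale[OF x1(1)] lin_scale[OF y1(1)] by (metis scale_zero_right)
    have "y (\<xi> e) + z (x e) = (F (\<lambda>v. \<xi> (P i v)) + H (\<lambda>v. x (P i v))) *s e"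
      using represents_trace[OF y \<xi> e \<epsilon> u_e] represents_trace[OF z x e \<epsilon> u_e]
      by (simp add: scale_left_distrib)
    then have "\<epsilon> u *s (y (\<xi> e) + z (x e)) = 0" using tr0(2)[of i] by simp
    then show "y (\<xi> u) + z (x u) = 0"
      using u_e[OF u] lin_scale[OF x1(1)] lin_scale[OF \<xi>1(1)] lin_scale[OF y1(1)] lin_scale[OF z1(1)]
      by (metis scale_right_distrib)
  qed (use y z in \<open>auto simp: represents_def\<close>)
  then have y0: "y v = 0" for v by (rule gen)
  \<comment> \<open>\<open>T\<close> is a sum of maps of rank one between neighbouring components,
    so its value under \<open>F\<close> is computed from \<open>y\<close>.\<close>
  have Tv: "T v = (\<Sum>i<m. \<Sum>b\<in>Basis. representation Basis (P i v) b *s T (P i b))" for v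
  proof -
    have "T (P i v) = (\<Sum>b\<in>Basis. representation Basis (P i v) b *s T (P i b))" for i
    proof -
      have "T (P i (P i v)) = (\<Sum>b\<in>Basis. representation Basis (P i v) b *s T (P i b))"
        by (rule lin_expand[OF lin_comp[OF deg1D(1)[OF T] lin_P]])
      moreover have "P i (P i v) = P i v" using P_on[OF P_in[of i v], of i] by simp
      ultimately show ?thesis by simp
    qed
    moreover have "T v = (\<Sum>i<m. T (P i v))"
    proof -
      have "T (\<Sum>i<n. P i v) = (\<Sum>i<n. T (P i v))" for n :: nat
        by (induction n) (auto simp: lin_simps(1-5)[OF deg1D(1)[OF T]])
      from this[of m] show ?thesis by (simp add: P_sum)
    qed
    ultimately show ?thesis by simp
  qed
  have "T = (\<Sum>i<m. \<Sum>b\<in>Basis. (\<lambda>v. representation Basis (P i v) b *s T (P i b)))"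
    by (rule ext) (simp only: sum_fun_apply, rule Tv)
  then have "F T = F (\<Sum>i<m. \<Sum>b\<in>Basis. (\<lambda>v. representation Basis (P i v) b *s T (P i b)))"
    by (rule arg_cong)
  also have "\<dots> = (\<Sum>i<m. \<Sum>b\<in>Basis. F (\<lambda>v. representation Basis (P i v) b *s T (P i b)))"
    by (simp only: E_fnl_sum[OF F])
  also have "\<dots> = 0"
    using y1(3)[OF deg1D(2)[OF T P_in] fnl_representation] y0 fnl_0[OF fnl_representation] by simp
  finally show ?thesis .
qed

section \<open>Stability of the graded components, and the spanning direction\<close>

lemma deg0I: "lin a \<Longrightarrow> (\<And>i u. u \<in> U i \<Longrightarrow> a u \<in> U i) \<Longrightarrow> a \<in> deg0"
  by (auto simp: deg0_def)

lemma deg1I: "lin a \<Longrightarrow> (\<And>i u. u \<in> U i \<Longrightarrow> a u \<in> U (Suc i)) \<Longrightarrow> a \<in> deg1"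
  by (auto simp: deg1_def)

lemma subspace_deg0: "E.subspace deg0"
  unfolding E.subspace_def zero_fun_def plus_fun_def pscale_def
  by (intro conjI ballI allI deg0I)
    (auto intro: lin_zero lin_plus lin_cmult deg0D subspace_0[OF subspace_U]
      subspace_add[OF subspace_U] subspace_scale[OF subspace_U])

lemma subspace_deg1: "E.subspace deg1"
  unfolding E.subspace_def zero_fun_def plus_fun_def pscale_def
  by (intro conjI ballI allI deg1I)
    (auto intro: lin_zero lin_plus lin_cmult deg1D subspace_0[OF subspace_U]
      subspace_add[OF subspace_U] subspace_scale[OF subspace_U])

lemma commutator_deg1: "a \<in> deg0 \<Longrightarrow> x \<in> deg1 \<Longrightarrow> commutator a x \<in> deg1"
  by (rule deg1I) (auto simp: commutator_def intro!: subspace_diff[OF subspace_U]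
      intro: lin_commutatorI[unfolded commutator_def] deg0D deg1D)

lemma commutator_deg0: "a \<in> deg0 \<Longrightarrow> x \<in> deg0 \<Longrightarrow> commutator a x \<in> deg0"
  by (rule deg0I) (auto simp: commutator_def intro!: subspace_diff[OF subspace_U]
      intro: lin_commutatorI[unfolded commutator_def] deg0D)

text \<open>If the span were proper, a functional killing it but not \<open>deg1\<close> would
  satisfy the hypotheses of \<open>functional_vanish\<close>. The vector in \<open>X\<close>
  supplies the two trace conditions; on a zero component they hold trivially, so there
  \<open>X\<close> can be empty.\<close>

lemma ex_direction_spanning:
  assumes x: "x \<in> deg1" and no3: "\<And>i. small i \<or> small (i + 1) \<or> small (i + 2)"
  obtains \<xi> X where "\<xi> \<in> deg1" "X \<subseteq> deg1" "finite X" "card X \<le> 1" "\<exists>i. U i = {0} \<Longrightarrow> X = {}"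
    "deg1 \<subseteq> E.span ((\<lambda>a. commutator a x) ` deg0 \<union>
       (\<lambda>a. commutator a \<xi>) ` {a \<in> deg0. commutator a x = 0} \<union> X)"
proof -
  obtain \<xi> where \<xi>: "\<xi> \<in> deg1" and gen: "\<And>y z v. first_order_commuting x \<xi> y z \<Longrightarrow> y v = 0"
    using ex_generic_direction[OF x no3] by blast
  define N where "N = (\<lambda>a. commutator a x) ` deg0"
  define K where "K = (\<lambda>a. commutator a \<xi>) ` {a \<in> deg0. commutator a x = 0}"
  note linx = lin_commutator(1)[OF deg1D(1)[OF x]] and lin\<xi> = lin_commutator(1)[OF deg1D(1)[OF \<xi>]]
  have N: "E.subspace N" unfolding N_def by (rule E.subspace_image[OF linx subspace_deg0])
  interpret EE: vector_space_pair "pscale scale :: 'a \<Rightarrow> ('b \<Rightarrow> 'b) \<Rightarrow> 'b \<Rightarrow> 'b" "pscale scale :: 'a \<Rightarrow> ('b \<Rightarrow> 'b) \<Rightarrow> 'b \<Rightarrow> 'b"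
    by (rule vector_space_pair.intro[OF E.vector_space_axioms E.vector_space_axioms])
  obtain h where h: "range h \<subseteq> deg0" "E.lin h" "\<And>s. s \<in> N \<Longrightarrow> commutator (h s) x = s"
    using EE.linear_exists_right_inverse_on[OF linx subspace_deg0] unfolding N_def by blast
  define X0 where "X0 = (\<lambda>v. x (P 0 v))"
  define \<Xi>0 where "\<Xi>0 = (\<lambda>v. \<xi> (P 0 v))"
  \<comment> \<open>If \<open>X0\<close> lies in \<open>N\<close>, the first trace condition is
    automatic and \<open>F e = 0\<close> is the second one with \<open>H0 X0\<close> written out.
    Otherwise \<open>F e = 0\<close> is the first, and the second is reached by changing
    \<open>H0\<close> off \<open>N\<close>.\<close>
  define e where "e = (if X0 \<in> N then \<Xi>0 - commutator (h X0) \<xi> else X0)"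
  define X where "X = (if \<exists>i. U i = {0} then {} else {e})"
  have "X0 \<in> deg1" "\<Xi>0 \<in> deg1" unfolding X0_def \<Xi>0_def using deg1_comp_P x \<xi> by blast+
  then have e1: "e \<in> deg1"
    using commutator_deg1[of "h X0" \<xi>] h(1) \<xi> E.subspace_diff[OF subspace_deg1] by (auto simp: e_def)
  have "deg1 \<subseteq> E.span (N \<union> K \<union> X)"
  proof (rule ccontr)
    assume "\<not> deg1 \<subseteq> E.span (N \<union> K \<union> X)"
    then obtain T where T: "T \<in> deg1" "T \<notin> E.span (N \<union> K \<union> X)" by blast
    obtain F where F: "E.fnl F" "\<And>t. t \<in> E.span (N \<union> K \<union> X) \<Longrightarrow> F t = 0" "F T = 1"
      using E.separating_fnl[OF E.subspace_span T(2)] by blast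
    have FN: "F (commutator a x) = 0" if "a \<in> deg0" for a
      by (rule F(2), rule E.span_base) (use that in \<open>auto simp: N_def\<close>)
    have FK: "F (commutator a \<xi>) = 0" if "a \<in> deg0" "commutator a x = 0" for a
      by (rule F(2), rule E.span_base) (use that in \<open>auto simp: K_def\<close>)
    have FX: "F e = 0" if "\<not> (\<exists>i. U i = {0})"
      by (rule F(2), rule E.span_base) (use that in \<open>auto simp: X_def\<close>)
    \<comment> \<open>On \<open>N\<close> the choice made by \<open>h\<close> is immaterial: two
      preimages differ by an element of the annihilator of \<open>x\<close>, where \<open>FK\<close>
      applies.\<close>
    define H0 where "H0 t = - F (commutator (h t) \<xi>)" for t
    have H0: "E.fnl H0"
      by (rule E.fnlI) (simp_all add: H0_def E.lin_simps(1-5)[OF h(2)] E.lin_simps(1-5)[OF lin\<xi>] E.lin_simps(6-10)[OF F(1)])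
    have H0x: "H0 (commutator a x) = - F (commutator a \<xi>)" if a: "a \<in> deg0" for a
    proof -
      define b where "b = h (commutator a x)"
      have "commutator b x = commutator a x" unfolding b_def by (rule h(3)) (use a in \<open>auto simp: N_def\<close>)
      then have "commutator (a - b) x = 0" using E.lin_diff[OF linx, of a b] by simp
      moreover have "a - b \<in> deg0" using a h(1) E.subspace_diff[OF subspace_deg0] by (auto simp: b_def)
      ultimately have "F (commutator (a - b) \<xi>) = 0" using FK by blast
      then show ?thesis
        using E.lin_diff[OF lin\<xi>, of a b] by (simp add: H0_def E.fnl_diff[OF F(1)] b_def)
    qed
    obtain k H where H: "E.fnl H" "\<And>a. a \<in> deg0 \<Longrightarrow> H (commutator a x) = - F (commutator a \<xi>)"
      and k: "F (\<lambda>v. x (P k v)) = 0" "F (\<lambda>v. \<xi> (P k v)) + H (\<lambda>v. x (P k v)) = 0"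
    proof (cases "\<exists>i. U i = {0}")
      case True
      then obtain i where "U i = {0}" by blast
      then have "P i v = 0" for v using P_in[of i v] by simp
      then have "(\<lambda>v. x (P i v)) = 0" "(\<lambda>v. \<xi> (P i v)) = 0"
        using lin_0 deg1D(1) x \<xi> by (auto simp: fun_eq_iff)
      then show thesis using that[OF H0 H0x, of i] E.fnl_0[OF F(1)] E.fnl_0[OF H0] by simp
    next
      case nz: False
      show thesis
      proof (cases "X0 \<in> N")
        case True
        then have "F X0 = 0" using F(2)[OF E.span_base] by blast
        moreover have "F \<Xi>0 + H0 X0 = 0"
          using FX[OF nz] True by (simp add: e_def H0_def E.fnl_diff[OF F(1)])
        ultimately show thesis using that[OF H0 H0x, of 0] by (simp add: X0_def \<Xi>0_def)
      next
        case False
        \<comment> \<open>Only the values on \<open>N\<close> are prescribed; the value at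
          \<open>X0\<close> is free and is set to meet the second trace condition.\<close>
        obtain \<kappa> where \<kappa>: "E.fnl \<kappa>" "\<And>t. t \<in> N \<Longrightarrow> \<kappa> t = 0" "\<kappa> X0 = - F \<Xi>0 - H0 X0"
          using E.separating_fnl_value[OF N False] by blast
        have "E.fnl (\<lambda>t. H0 t + \<kappa> t)"
          by (rule E.fnlI) (simp_all add: E.fnl_add H0 \<kappa>(1) E.fnl_scale algebra_simps)
        moreover have "H0 (commutator a x) + \<kappa> (commutator a x) = - F (commutator a \<xi>)" if "a \<in> deg0" for a
          using H0x[OF that] \<kappa>(2)[of "commutator a x"] that by (simp add: N_def)
        moreover have "F X0 = 0" using FX[OF nz] False by (simp add: e_def)
        ultimately show thesis using that[of "\<lambda>t. H0 t + \<kappa> t" 0] \<kappa>(3) by (simp add: X0_def \<Xi>0_def)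
      qed
    qed
    have "F T = 0"
    proof (rule functional_vanish[OF x \<xi> _ F(1) H(1)])
      show "y v = 0" if "first_order_commuting x \<xi> y z" for y z v using gen[OF that] .
      show "F (\<lambda>v. x (P k v)) = 0" "F (\<lambda>v. \<xi> (P k v)) + H (\<lambda>v. x (P k v)) = 0" by (fact k)+
    qed (simp_all add: FN H(2) T(1))
    then show False using F(3) by simp
  qed
  then show thesis using that[OF \<xi>, of X] e1 by (auto simp: N_def K_def X_def)
qed

end


section \<open>Genericity and biduals\<close>

lemma dim_image_inj:
  assumes f: "Vector_Spaces.linear s1 s2 f" and inj: "inj_on f (module.span s1 S)"
  shows "vector_space.dim s2 (f ` S) = vector_space.dim s1 S"
proof -
  interpret f: Vector_Spaces.linear s1 s2 f by (rule f)
  interpret p: vector_space_pair s1 s2 by unfold_locales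
  obtain B where B: "B \<subseteq> S" "f.vs1.independent B" "S \<subseteq> f.vs1.span B" "card B = f.vs1.dim S"
    by (rule f.vs1.basis_exists[of S])
  have inj': "inj_on f (f.vs1.span B)" using inj inj_on_subset f.vs1.span_mono[OF B(1)] by blast
  have "f.vs2.independent (f ` B)" by (rule p.linear_independent_injective_image[OF f B(2) inj'])
  moreover have "card (f ` B) = card B"
    using inj' inj_on_subset[OF inj' f.vs1.span_superset] by (simp add: card_image)
  moreover have "f ` S \<subseteq> f.vs2.span (f ` B)" using B(3) by (auto simp: p.linear_span_image[OF f])
  ultimately show ?thesis using B by (intro f.vs2.dim_unique[of "f ` B"]) auto
qed

context vspace
begin

section \<open>Dimension bounds and exceptional parameters of perturbations\<close>

lemma dim_mono_finite:
  assumes "S \<subseteq> T" "T \<subseteq> span X" "finite X" shows "dim S \<le> dim T"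
proof -
  obtain B where B: "B \<subseteq> T" "independent B" "T \<subseteq> span B" "card B = dim T" by (rule basis_exists[of T])
  have "finite B" using independent_span_bound[OF assms(3) B(2)] B(1) assms(2) by blast
  then show ?thesis using dim_le_card[of S B] assms(1) B by auto
qed

lemma card_le_dim:
  assumes "B \<subseteq> S" "independent B" "S \<subseteq> span X" "finite X" shows "card B \<le> dim S"
  using dim_mono_finite[OF assms(1,3,4)] dim_eq_card_independent[OF assms(2)] by simp

text \<open>Applying N - d to the relation removes the term of \<open>d\<close> and multiplies every
  other coefficient by the nonzero number c - d; induction finishes.\<close>

lemma eigenvectors_scalars_zero:
  assumes N: "lin N" and "finite C" and "\<And>c. c \<in> C \<Longrightarrow> v c \<noteq> 0 \<and> N (v c) = c *s v c"
    and "(\<Sum>c\<in>C. k c *s v c) = 0" "c \<in> C"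
  shows "k c = 0"
  using assms(2-)
proof (induction C arbitrary: k c rule: finite_induct)
  case (insert d C)
  have Ns: "N (\<Sum>c\<in>C. k c *s v c) = (\<Sum>c\<in>C. k c *s N (v c))"
    by (induction C rule: infinite_finite_induct) (auto simp: lin_simps(1-5)[OF N])
  have s: "(\<Sum>c\<in>C. k c *s v c) = - (k d *s v d)"
    using insert by (simp add: eq_neg_iff_add_eq_0 add.commute)
  have "(\<Sum>c\<in>C. (k c * (c - d)) *s v c) = (\<Sum>c\<in>C. k c *s N (v c)) - d *s (\<Sum>c\<in>C. k c *s v c)"
    unfolding scale_sum_right sum_subtractf[symmetric]
    by (rule sum.cong) (use insert.prems(1) in \<open>auto simp: algebra_simps\<close>)
  also have "\<dots> = 0"
    using insert.prems(1)[of d] by (simp add: Ns[symmetric] s lin_simps(1-5)[OF N] mult.commute)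
  finally have z: "(\<Sum>c\<in>C. (k c * (c - d)) *s v c) = 0" .
  have kC: "k c = 0" if c: "c \<in> C" for c
  proof -
    have "k c * (c - d) = 0" by (rule insert.IH[OF _ z c]) (use insert.prems(1) in auto)
    then show ?thesis using c insert.hyps by auto
  qed
  moreover have "k d = 0" using s kC insert.prems(1)[of d] by simp
  ultimately show ?case using insert.prems by auto
qed simp

text \<open>\<open>N\<close> need not preserve \<open>span S\<close>, so there is no characteristic
  polynomial to count with. Eigenvectors for distinct eigenvalues are independent, which bounds
  their number by \<open>card S\<close>.\<close>

lemma finite_eigenvalues:
  assumes N: "lin N" and S: "finite S"
  shows "finite {c. \<exists>v\<in>span S. v \<noteq> 0 \<and> N v = c *s v}" (is "finite ?C")
proof -
  define X where "X = ?C"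
  have "\<forall>c\<in>X. \<exists>v. v \<in> span S \<and> v \<noteq> 0 \<and> N v = c *s v" unfolding X_def by blast
  from bchoice[OF this] obtain v where
    v: "\<forall>c\<in>X. v c \<in> span S \<and> v c \<noteq> 0 \<and> N (v c) = c *s v c" ..
  have "card C \<le> card S" if C: "C \<subseteq> X" "finite C" for C
  proof -
    have vC: "v c \<in> span S" "v c \<noteq> 0" "N (v c) = c *s v c" if "c \<in> C" for c
      using bspec[OF v subsetD[OF C(1) that]] by simp_all
    have inj: "inj_on v C"
    proof (rule inj_onI)
      fix c d assume *: "c \<in> C" "d \<in> C" "v c = v d"
      have "c *s v d = d *s v d" by (rule trans[OF sym[OF vC(3)[OF *(1), unfolded *(3)]] vC(3)[OF *(2)]])
      then show "c = d" using vC(2)[OF *(2)] by simp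
    qed
    have "independent (v ` C)"
    proof (rule independent_if_scalars_zero)
      show "finite (v ` C)" using C by simp
      fix f x assume s: "(\<Sum>x\<in>v ` C. f x *s x) = 0" and x: "x \<in> v ` C"
      then obtain c where c: "c \<in> C" "x = v c" by blast
      have z: "(\<Sum>c\<in>C. f (v c) *s v c) = 0" using s inj by (simp add: sum.reindex)
      have "f (v c) = 0"
        by (rule eigenvectors_scalars_zero[OF N C(2) _ z c(1)]) (simp add: vC)
      then show "f x = 0" using c by simp
    qed
    moreover have "v ` C \<subseteq> span S" using vC(1) by auto
    ultimately have "card (v ` C) \<le> card S" using independent_span_bound[OF S] by blast
    then show ?thesis using inj by (simp add: card_image)
  qed
  then show ?thesis using finite_if_finite_subsets_card_bdd[of X "card S"] unfolding X_def by blast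
qed

text \<open>A kernel vector of 1 + t N is an eigenvector of N for -1/t, so only finitely many t
  occur. This takes the place of a determinant that is a nonzero polynomial in t.\<close>

lemma finite_singular_perturbations:
  assumes N: "lin N" and S: "finite S"
  shows "finite {t. \<exists>v\<in>span S. v \<noteq> 0 \<and> v + t *s N v = 0}"
proof (rule finite_subset[OF _ finite_imageI[OF finite_eigenvalues[OF assms], of "\<lambda>c. - 1 / c"]], rule subsetI)
  fix t assume "t \<in> {t. \<exists>v\<in>span S. v \<noteq> 0 \<and> v + t *s N v = 0}"
  then obtain v where v: "v \<in> span S" "v \<noteq> 0" "v + t *s N v = 0" by blast
  then have t: "t \<noteq> 0" by auto
  have "t *s N v = - v" using v(3) by (simp add: eq_neg_iff_add_eq_0 add.commute)
  then have "inverse t *s (t *s N v) = inverse t *s (- v)" by simp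
  then have "N v = (- 1 / t) *s v" using t by (simp add: divide_inverse)
  then show "t \<in> (\<lambda>c. - 1 / c) ` {c. \<exists>v\<in>span S. v \<noteq> 0 \<and> N v = c *s v}"
    using v t by (intro image_eqI[of _ _ "- 1 / t"]) auto
qed

lemma independent_Un_kernel:
  assumes P: "lin P" and B: "independent B" "finite B" "\<And>b. b \<in> B \<Longrightarrow> P b = 0"
    and Y: "finite Y" "inj_on P Y" "independent (P ` Y)"
  shows "independent (B \<union> Y)" "B \<inter> Y = {}"
proof -
  show dis: "B \<inter> Y = {}"
  proof -
    have "0 \<notin> P ` Y" using Y(3) dependent_zero by blast
    then show ?thesis using B(3) by force
  qed
  show "independent (B \<union> Y)"
  proof (rule independent_if_scalars_zero)
    show "finite (B \<union> Y)" using B Y by simp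
    fix f x assume s: "(\<Sum>x\<in>B \<union> Y. f x *s x) = 0" and x: "x \<in> B \<union> Y"
    have Ps: "P (\<Sum>x\<in>A. f x *s x) = (\<Sum>x\<in>A. f x *s P x)" for A
      by (induction A rule: infinite_finite_induct) (auto simp: lin_simps(1-5)[OF P])
    have s': "(\<Sum>x\<in>B. f x *s x) + (\<Sum>x\<in>Y. f x *s x) = 0"
      using s dis B Y by (simp add: sum.union_disjoint)
    have "(\<Sum>x\<in>Y. f x *s P x) = 0"
      using arg_cong[OF s', of P] B(3) by (simp add: lin_simps(1-5)[OF P] Ps)
    then have "(\<Sum>z\<in>P ` Y. f (inv_into Y P z) *s z) = 0" using Y(2) by (simp add: sum.reindex)
    then have "f (inv_into Y P z) = 0" if "z \<in> P ` Y" for z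
      using that independentD[OF Y(3) finite_imageI[OF Y(1)] subset_refl, of "\<lambda>z. f (inv_into Y P z)" z] by blast
    then have fY: "f y = 0" if "y \<in> Y" for y using that Y(2) by fastforce
    then have "(\<Sum>x\<in>B. f x *s x) = 0" using s' by simp
    then have "f b = 0" if "b \<in> B" for b using that independentD[OF B(1,2) subset_refl, of f b] by blast
    then show "f x = 0" using x fY by blast
  qed
qed

end

text \<open>The bidual of a finite-dimensional module \<open>C\<close> is identified with a module \<open>D\<close> isomorphic to \<open>C\<close>
  by evaluation.\<close>

lemma ind_dual_space:
  fixes sc :: "'a::field \<Rightarrow> 'd::ab_group_add \<Rightarrow> 'd" and sm :: "'a \<Rightarrow> 'w \<Rightarrow> 'w"
    and act :: "'l \<Rightarrow> 'w \<Rightarrow> 'w" and act' :: "'l \<Rightarrow> 'd \<Rightarrow> 'd"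
  assumes vs: "vspace sc" and B: "finite B" "\<not> module.dependent sc B"
    and D: "D = module.span sc B" and \<phi>: "bij_betw \<phi> C D"
    and add: "\<And>u w. u \<in> C \<Longrightarrow> w \<in> C \<Longrightarrow> add u w \<in> C \<and> \<phi> (add u w) = \<phi> u + \<phi> w"
    and sm: "\<And>c w. w \<in> C \<Longrightarrow> sm c w \<in> C \<and> \<phi> (sm c w) = sc c (\<phi> w)"
    and act: "\<And>a w. a \<in> q \<Longrightarrow> w \<in> C \<Longrightarrow> act a w \<in> C \<and> \<phi> (act a w) = act' a (\<phi> w)"
    and act'_add: "\<And>a x y. a \<in> q \<Longrightarrow> x \<in> D \<Longrightarrow> y \<in> D \<Longrightarrow> act' a (x + y) = act' a x + act' a y"
    and act'_sc: "\<And>a c x. a \<in> q \<Longrightarrow> x \<in> D \<Longrightarrow> act' a (sc c x) = sc c (act' a x)"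
  shows "ind (pscale (*)) (dual_act act C) q (dual_space sm add C) =
    int (card B) - int (Max ((\<lambda>d. vector_space.dim sc (orbit_space act' q d)) ` D))"
proof -
  interpret V: vspace sc by (rule vs)
  interpret K: vspace "(*) :: 'a \<Rightarrow> 'a \<Rightarrow> 'a" by (rule vspace_field)
  interpret F: vspace "pscale (*) :: 'a \<Rightarrow> ('w \<Rightarrow> 'a) \<Rightarrow> 'w \<Rightarrow> 'a" by (rule K.vspace_pscale)
  interpret FF: vspace "pscale (*) :: 'a \<Rightarrow> (('w \<Rightarrow> 'a) \<Rightarrow> 'a) \<Rightarrow> ('w \<Rightarrow> 'a) \<Rightarrow> 'a" by (rule K.vspace_pscale)
  define M where "M = dual_space sm add C"
  define \<psi> where "\<psi> = inv_into C \<phi>"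
  have \<psi>: "\<psi> d \<in> C" "\<phi> (\<psi> d) = d" if "d \<in> D" for d
    using \<phi> that unfolding \<psi>_def bij_betw_def by (auto simp: inv_into_into f_inv_into_f)
  have \<psi>\<phi>: "\<psi> (\<phi> u) = u" if "u \<in> C" for u
    using \<phi> that unfolding \<psi>_def bij_betw_def by auto
  have \<phi>D: "\<phi> u \<in> D" if "u \<in> C" for u using \<phi> that by (auto simp: bij_betw_def)
  have Dsub: "V.subspace D" by (simp add: D)
  have \<psi>_add: "\<psi> (x + y) = add (\<psi> x) (\<psi> y)" if "x \<in> D" "y \<in> D" for x y
    using \<psi>\<phi>[of "add (\<psi> x) (\<psi> y)"] add[of "\<psi> x" "\<psi> y"] \<psi> that by simp
  have \<psi>_sc: "\<psi> (sc c x) = sm c (\<psi> x)" if "x \<in> D" for c x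
    using \<psi>\<phi>[of "sm c (\<psi> x)"] sm[of "\<psi> x" c] \<psi> that by simp
  have act'D: "act' a x \<in> D" "\<psi> (act' a x) = act a (\<psi> x)" if "a \<in> q" "x \<in> D" for a x
    using act[OF that(1) \<psi>(1)[OF that(2)]] \<psi>[OF that(2)] \<phi>D \<psi>\<phi> by metis+
  have MD: "f (add u w) = f u + f w" "f (sm c u) = c * f u" "v \<notin> C \<Longrightarrow> f v = 0"
    if "f \<in> M" "u \<in> C" "w \<in> C" for f u w c v
    using that by (auto simp: M_def dual_space_def)
  have MD0: "f v = 0" if "f \<in> M" "v \<notin> C" for f v
    using that by (auto simp: M_def dual_space_def)
  have f\<psi>_add: "f (\<psi> (x + y)) = f (\<psi> x) + f (\<psi> y)" if "f \<in> M" "x \<in> D" "y \<in> D" for f x y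
    using MD(1)[OF that(1) \<psi>(1)[OF that(2)] \<psi>(1)[OF that(3)]] \<psi>_add[OF that(2,3)] by simp
  have f\<psi>_sc: "f (\<psi> (sc c x)) = c * f (\<psi> x)" if "f \<in> M" "x \<in> D" for f c x
    using MD(2)[OF that(1) \<psi>(1)[OF that(2)] \<psi>(1)[OF that(2)]] \<psi>_sc[OF that(2)] by simp
  have f\<psi>_sum: "f (\<psi> (\<Sum>b\<in>A. sc (k b) b)) = (\<Sum>b\<in>A. k b * f (\<psi> b))" if f: "f \<in> M" and A: "A \<subseteq> B" for f k A
  proof -
    have "finite A" using A B(1) finite_subset by blast
    then show ?thesis using A
    proof (induction A rule: finite_induct)
      case empty
      have "f (\<psi> (sc 0 0)) = 0 * f (\<psi> 0)" by (rule f\<psi>_sc[OF f V.subspace_0[OF Dsub]])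
      then show ?case by simp
    next
      case (insert b A)
      have b: "b \<in> D" using insert D V.span_base by blast
      have "sc (k b) b \<in> D" by (rule V.subspace_scale[OF Dsub b])
      moreover have "(\<Sum>b\<in>A. sc (k b) b) \<in> D"
        by (rule V.subspace_sum[OF Dsub], rule V.subspace_scale[OF Dsub]) (use insert D V.span_base in blast)
      ultimately show ?case using insert f\<psi>_add[OF f] f\<psi>_sc[OF f b] by simp
    qed
  qed
  have expand: "(\<Sum>b\<in>B. sc (V.representation B d b) b) = d" if "d \<in> D" for d
    using V.sum_representation_eq[OF B(2) _ B(1) subset_refl, of d] that D by simp
  have fexp: "f (\<psi> d) = (\<Sum>b\<in>B. V.representation B d b * f (\<psi> b))" if "f \<in> M" "d \<in> D" for f d
    using f\<psi>_sum[OF that(1) subset_refl, of "V.representation B d"] expand[OF that(2)] by simp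
  \<comment> \<open>The basis of the dual of \<open>C\<close> that is dual to \<open>B\<close> under
    \<open>\<phi>\<close>, extended by 0 outside \<open>C\<close>.\<close>
  define \<beta> where "\<beta> b = (\<lambda>u. if u \<in> C then V.representation B (\<phi> u) b else 0)" for b
  have \<phi>span: "\<phi> u \<in> V.span B" if "u \<in> C" for u using \<phi>D[OF that] D by simp
  have \<beta>M: "\<beta> b \<in> M" for b
    unfolding M_def dual_space_def \<beta>_def
    using add sm \<phi>span by (auto simp: V.representation_add[OF B(2)] V.representation_scale[OF B(2)])
  have \<beta>\<psi>: "\<beta> b (\<psi> d) = V.representation B d b" if "d \<in> D" for b d
    using \<psi>[OF that] by (simp add: \<beta>_def)
  have BD: "b \<in> D" if "b \<in> B" for b using that D V.span_base by blast
  have \<beta>B: "\<beta> b (\<psi> b') = (if b' = b then 1 else 0)" if "b' \<in> B" for b b'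
    using \<beta>\<psi>[OF BD[OF that]] V.representation_basis[OF B(2) that] by auto
  have Mexp: "f = (\<Sum>b\<in>B. pscale (*) (f (\<psi> b)) (\<beta> b))" if f: "f \<in> M" for f
  proof (rule ext)
    fix u
    show "f u = (\<Sum>b\<in>B. pscale (*) (f (\<psi> b)) (\<beta> b)) u"
    proof (cases "u \<in> C")
      case True
      then show ?thesis using fexp[OF f \<phi>D[OF True]] \<psi>\<phi>[OF True]
        by (simp add: sum_fun_apply pscale_def \<beta>_def mult.commute)
    next
      case False
      then show ?thesis using MD0[OF f False] by (simp add: sum_fun_apply pscale_def \<beta>_def)
    qed
  qed
  have \<beta>inj: "inj_on \<beta> B" using \<beta>B by (metis inj_onI zero_neq_one)
  have dimM: "F.dim M = card B"
  proof (rule F.dim_unique[of "\<beta> ` B"])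
    show "\<beta> ` B \<subseteq> M" using \<beta>M by blast
    show "M \<subseteq> F.span (\<beta> ` B)"
    proof
      fix f assume "f \<in> M"
      show "f \<in> F.span (\<beta> ` B)"
        by (subst Mexp[OF \<open>f \<in> M\<close>]) (intro F.span_sum F.span_scale F.span_base imageI)
    qed
    show "F.independent (\<beta> ` B)"
    proof (rule F.independent_if_scalars_zero)
      show "finite (\<beta> ` B)" using B by simp
      fix k x assume s: "(\<Sum>x\<in>\<beta> ` B. pscale (*) (k x) x) = 0" and x: "x \<in> \<beta> ` B"
      then obtain b where b: "b \<in> B" "x = \<beta> b" by blast
      have "(\<Sum>b\<in>B. pscale (*) (k (\<beta> b)) (\<beta> b)) (\<psi> b) = 0"
        using s \<beta>inj by (simp add: sum.reindex)
      then have "(\<Sum>b'\<in>B. k (\<beta> b') * (if b = b' then 1 else 0)) = 0"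
        using \<beta>B[OF b(1)] by (simp add: sum_fun_apply pscale_def)
      then show "k x = 0" using b B(1) by (simp add: if_distrib cong: if_cong)
    qed
    show "card (\<beta> ` B) = card B" using \<beta>inj by (rule card_image)
  qed
  have Madd: "f + g \<in> M" if "f \<in> M" "g \<in> M" for f g
    using that by (auto simp: M_def dual_space_def algebra_simps)
  have Msc: "pscale (*) c f \<in> M" if "f \<in> M" for f c
    using that by (simp add: M_def dual_space_def pscale_def distrib_left mult.left_commute)
  \<comment> \<open>Evaluation at the element of \<open>C\<close> that corresponds to
    \<open>d\<close>, again extended by 0 as elements of a dual space are.\<close>
  define ev where "ev d = (\<lambda>f. if f \<in> M then f (\<psi> d) else 0)" for d
  have ev_dual: "ev d \<in> dual_space (pscale (*)) (+) M" for d
    unfolding dual_space_def using Madd Msc by (auto simp: ev_def pscale_def)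
  have dual_ev: "\<exists>d\<in>D. \<xi> = ev d" if \<xi>: "\<xi> \<in> dual_space (pscale (*)) (+) M" for \<xi>
  proof -
    define d where "d = (\<Sum>b\<in>B. sc (\<xi> (\<beta> b)) b)"
    have d: "d \<in> D" unfolding d_def by (rule V.subspace_sum[OF Dsub], rule V.subspace_scale[OF Dsub], rule BD)
    have \<xi>D: "\<xi> (f + g) = \<xi> f + \<xi> g" "\<xi> (pscale (*) c f) = c * \<xi> f" if "f \<in> M" "g \<in> M" for f g c
      using \<xi> that by (auto simp: dual_space_def)
    have \<xi>0: "\<xi> f = 0" if "f \<notin> M" for f using \<xi> that by (auto simp: dual_space_def)
    have M0: "(\<Sum>b\<in>A. pscale (*) (k b) (\<beta> b)) \<in> M" for A k
    proof (induction A rule: infinite_finite_induct)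
      case (insert b A)
      show ?case
        unfolding sum.insert[OF insert.hyps(1,2)] by (rule Madd[OF Msc[OF \<beta>M] insert.IH])
    qed (use Msc[OF \<beta>M, of 0] in \<open>auto simp: pscale_def zero_fun_def\<close>)
    have z: "\<xi> 0 = 0" using \<xi>D(2)[OF \<beta>M \<beta>M, of 0] by (simp add: pscale_def zero_fun_def)
    have "\<xi> (\<Sum>b\<in>A. pscale (*) (k b) (\<beta> b)) = (\<Sum>b\<in>A. k b * \<xi> (\<beta> b))" for A k
    proof (induction A rule: infinite_finite_induct)
      case (insert b A)
      show ?case
        by (simp only: sum.insert[OF insert.hyps(1,2)] \<xi>D(1)[OF Msc[OF \<beta>M] M0] \<xi>D(2)[OF \<beta>M \<beta>M] insert.IH)
    qed (simp_all only: sum.infinite sum.empty z if_False not_False_eq_True)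
    then have "\<xi> f = (\<Sum>b\<in>B. f (\<psi> b) * \<xi> (\<beta> b))" if "f \<in> M" for f
      using Mexp[OF that] by metis
    moreover have "f (\<psi> d) = (\<Sum>b\<in>B. \<xi> (\<beta> b) * f (\<psi> b))" if "f \<in> M" for f
      unfolding d_def by (rule f\<psi>_sum[OF that subset_refl])
    ultimately have "\<xi> f = ev d f" for f using \<xi>0 by (simp add: ev_def mult.commute)
    then show ?thesis using d by blast
  qed
  have act_dual: "dual_act act C a f \<in> M" if a: "a \<in> q" and f: "f \<in> M" for a f
  proof -
    have "act a (add u w) = add (act a u) (act a w)" if "u \<in> C" "w \<in> C" for u w
    proof -
      have "\<phi> (act a (add u w)) = \<phi> (add (act a u) (act a w))"
        using that add act[OF a] act'_add[OF a \<phi>D \<phi>D] by simp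
      then show ?thesis using \<psi>\<phi> act[OF a] add that by metis
    qed
    moreover have "act a (sm c u) = sm c (act a u)" if "u \<in> C" for c u
    proof -
      have "\<phi> (act a (sm c u)) = \<phi> (sm c (act a u))"
        using that sm act[OF a] act'_sc[OF a \<phi>D] by simp
      then show ?thesis using \<psi>\<phi> act[OF a] sm that by metis
    qed
    ultimately show ?thesis
      using f add sm act[OF a] unfolding M_def dual_space_def dual_act_def by auto
  qed
  have orbit: "orbit_space (dual_act (dual_act act C) M) q (ev d) = ev ` orbit_space act' q d" if d: "d \<in> D" for d
  proof -
    \<comment> \<open>The signs of the two dual actions cancel.\<close>
    have "dual_act (dual_act act C) M a (ev d) = ev (act' a d)" if a: "a \<in> q" for a
      using act_dual[OF a] act'D[OF a d] \<psi>(1)[OF d] by (auto simp: dual_act_def ev_def fun_eq_iff)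
    then show ?thesis by (auto simp: orbit_space_def image_image)
  qed
  interpret p: vector_space_pair sc "pscale (*) :: 'a \<Rightarrow> (('w \<Rightarrow> 'a) \<Rightarrow> 'a) \<Rightarrow> ('w \<Rightarrow> 'a) \<Rightarrow> 'a"
    by (rule vector_space_pair.intro[OF V.vector_space_axioms FF.vector_space_axioms])
  \<comment> \<open>\<open>ev\<close> behaves linearly on \<open>D\<close> only; \<open>L\<close> is
    a map that is linear on the whole space and agrees with it there, so that dimensions of images
    can be compared.\<close>
  obtain L where L: "Vector_Spaces.linear sc (pscale (*)) L" "\<And>b. b \<in> B \<Longrightarrow> L b = ev b"
    using p.linear_independent_extend[OF B(2), of ev] by blast
  have Lev: "L d = ev d" if "d \<in> D" for d
  proof
    fix f
    show "L d f = ev d f"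
    proof (cases "f \<in> M")
      case True
      have "L d = (\<Sum>b\<in>B. pscale (*) (V.representation B d b) (ev b))"
        by (subst expand[OF that, symmetric]) (simp add: p.linear_sum[OF L(1)] p.linear_scale[OF L(1)] L(2))
      then show ?thesis using fexp[OF True that] True by (simp add: sum_fun_apply pscale_def ev_def)
    next
      case False
      have "L d = (\<Sum>b\<in>B. pscale (*) (V.representation B d b) (ev b))"
        by (subst expand[OF that, symmetric]) (simp add: p.linear_sum[OF L(1)] p.linear_scale[OF L(1)] L(2))
      then show ?thesis using False by (simp add: sum_fun_apply pscale_def ev_def)
    qed
  qed
  have Linj: "inj_on L D"
  proof (rule inj_onI)
    fix x y assume xy: "x \<in> D" "y \<in> D" "L x = L y"
    then have "ev x (\<beta> b) = ev y (\<beta> b)" for b using Lev by metis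
    then have "V.representation B x b = V.representation B y b" for b
      using xy \<beta>M \<beta>\<psi> by (simp add: ev_def)
    then have "(\<Sum>b\<in>B. sc (V.representation B x b) b) = (\<Sum>b\<in>B. sc (V.representation B y b) b)"
      by simp
    then show "x = y" by (simp only: expand[OF xy(1)] expand[OF xy(2)])
  qed
  have dim_orbit: "FF.dim (orbit_space (dual_act (dual_act act C) M) q (ev d)) = V.dim (orbit_space act' q d)"
    if d: "d \<in> D" for d
  proof -
    have OD: "orbit_space act' q d \<subseteq> D" using act'D(1)[OF _ d] by (auto simp: orbit_space_def)
    then have "V.span (orbit_space act' q d) \<subseteq> D" using Dsub by (rule V.span_minimal)
    then have "FF.dim (L ` orbit_space act' q d) = V.dim (orbit_space act' q d)"
      using dim_image_inj[OF L(1)] inj_on_subset[OF Linj] by blast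
    moreover have "L ` orbit_space act' q d = ev ` orbit_space act' q d" using OD Lev by (auto intro!: image_cong)
    ultimately show ?thesis using orbit[OF d] by simp
  qed
  have "(\<lambda>\<xi>. FF.dim (orbit_space (dual_act (dual_act act C) M) q \<xi>)) ` dual_space (pscale (*)) (+) M =
      (\<lambda>d. V.dim (orbit_space act' q d)) ` D" (is "?l = ?r")
  proof
    show "?l \<subseteq> ?r"
    proof (rule image_subsetI)
      fix \<xi> assume "\<xi> \<in> dual_space (pscale (*)) (+) M"
      then obtain d where d: "d \<in> D" "\<xi> = ev d" using dual_ev by blast
      show "FF.dim (orbit_space (dual_act (dual_act act C) M) q \<xi>) \<in> ?r"
        unfolding d(2) dim_orbit[OF d(1)] using d(1) by (rule imageI)
    qed
    show "?r \<subseteq> ?l"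
    proof (rule image_subsetI)
      fix d assume d: "d \<in> D"
      show "V.dim (orbit_space act' q d) \<in> ?l"
        unfolding dim_orbit[OF d, symmetric] using ev_dual by (rule imageI)
    qed
  qed
  then show ?thesis unfolding ind_def M_def[symmetric] dimM by simp
qed


section \<open>A criterion for good index behaviour\<close>

text \<open>The ambient vector space consists of all functions and may have infinite dimension; the
  finite set \<open>G\<close> keeps every dimension in \<open>M\<close> finite.\<close>

locale lie_pair = vspace scale
  for scale :: "'a::field \<Rightarrow> 'b::ab_group_add \<Rightarrow> 'b" (infixr \<open>*s\<close> 75) +
  fixes q M G :: "('b \<Rightarrow> 'b) set"
  assumes infinite_field: "infinite (UNIV :: 'a set)"
    and q_lin: "a \<in> q \<Longrightarrow> lin a" and M_lin: "x \<in> M \<Longrightarrow> lin x"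
    and subspace_q: "module.subspace (pscale scale) q" and subspace_M: "module.subspace (pscale scale) M"
    and commutator_q: "a \<in> q \<Longrightarrow> b \<in> q \<Longrightarrow> commutator a b \<in> q"
    and commutator_M: "a \<in> q \<Longrightarrow> x \<in> M \<Longrightarrow> commutator a x \<in> M"
    and finite_G: "finite G" and M_span: "M \<subseteq> module.span (pscale scale) G"
begin

interpretation E: vspace "pscale scale :: 'a \<Rightarrow> ('b \<Rightarrow> 'b) \<Rightarrow> 'b \<Rightarrow> 'b" by (rule vspace_pscale)

interpretation EE: vector_space_pair "pscale scale :: 'a \<Rightarrow> ('b \<Rightarrow> 'b) \<Rightarrow> 'b \<Rightarrow> 'b" "pscale scale :: 'a \<Rightarrow> ('b \<Rightarrow> 'b) \<Rightarrow> 'b \<Rightarrow> 'b"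
  by (rule vector_space_pair.intro[OF E.vector_space_axioms E.vector_space_axioms])

lemma finite_independent: "E.independent B \<Longrightarrow> B \<subseteq> M \<Longrightarrow> finite B"
  using E.independent_span_bound[OF finite_G] M_span by blast

lemma orbit_subset: "w \<in> M \<Longrightarrow> orbit_space commutator q w \<subseteq> M"
  using commutator_M by (auto simp: orbit_space_def)

lemma orbit_subspace: "w \<in> M \<Longrightarrow> E.subspace (orbit_space commutator q w)"
  unfolding orbit_space_def by (rule E.subspace_image[OF lin_commutator(1)[OF M_lin] subspace_q])

lemma commutator_simps:
  assumes "lin a"
  shows "commutator (b + c) a = commutator b a + commutator c a"
    "commutator (b - c) a = commutator b a - commutator c a"
    "commutator (pscale scale k b) a = pscale scale k (commutator b a)"
    "commutator a (b + c) = commutator a b + commutator a c"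
    "commutator a (b - c) = commutator a b - commutator a c"
    "commutator a (pscale scale k b) = pscale scale k (commutator a b)"
  using E.lin_simps(1-5)[OF lin_commutator(1)[OF assms]] E.lin_simps(1-5)[OF lin_commutator(2)[OF assms]]
  by (simp_all only:)

text \<open>Vinberg's inequality: first-order perturbations of a basis of \<open>[q, w]\<close> and of lifts of a basis
  of the orbit of \<open>d\<close> modulo \<open>[q, w]\<close> lie in \<open>[q, w + t d]\<close> and stay independent for almost all \<open>t\<close>.\<close>

lemma finite_dim_drop:
  assumes w: "w \<in> M" and d: "d \<in> M" and P: "E.lin P"
    and PN: "\<And>n. n \<in> orbit_space commutator q w \<Longrightarrow> P n = 0"
  shows "finite {t. E.dim (orbit_space commutator q (w + pscale scale t d)) <
    E.dim (orbit_space commutator q w) + E.dim (P ` orbit_space commutator (annihilator commutator q w) d)}"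
proof -
  define N where "N = orbit_space commutator q w"
  define K where "K = orbit_space commutator (annihilator commutator q w) d"
  obtain BN where BN: "BN \<subseteq> N" "E.independent BN" "N \<subseteq> E.span BN" "card BN = E.dim N"
    by (rule E.basis_exists[of N])
  obtain BP where BP: "BP \<subseteq> P ` K" "E.independent BP" "P ` K \<subseteq> E.span BP" "card BP = E.dim (P ` K)"
    by (rule E.basis_exists[of "P ` K"])
  have NM: "N \<subseteq> M" using orbit_subset[OF w] by (simp add: N_def)
  have KM: "K \<subseteq> M" using commutator_M d by (auto simp: K_def orbit_space_def annihilator_def)
  have finBN: "finite BN" by (rule finite_independent[OF BN(2)]) (use BN(1) NM in blast)
  have "P ` K \<subseteq> E.span (P ` G)"
    using KM M_span EE.linear_span_image[OF P, of G] by blast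
  then have finBP: "finite BP" using E.independent_span_bound[OF finite_imageI[OF finite_G] BP(2)] BP(1) by blast
  have "\<forall>n\<in>BN. \<exists>a. a \<in> q \<and> commutator a w = n" using BN(1) by (auto simp: N_def orbit_space_def)
  from bchoice[OF this] obtain a where "\<forall>n\<in>BN. a n \<in> q \<and> commutator (a n) w = n" ..
  then have a: "a n \<in> q" "commutator (a n) w = n" if "n \<in> BN" for n using that by auto
  have "\<forall>p\<in>BP. \<exists>b. b \<in> q \<and> commutator b w = 0 \<and> P (commutator b d) = p"
    using BP(1) by (auto simp: K_def orbit_space_def annihilator_def)
  from bchoice[OF this] obtain b where
    "\<forall>p\<in>BP. b p \<in> q \<and> commutator (b p) w = 0 \<and> P (commutator (b p) d) = p" ..
  then have b: "b p \<in> q" "commutator (b p) w = 0" "P (commutator (b p) d) = p" if "p \<in> BP" for p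
    using that by auto
  define k where "k p = commutator (b p) d" for p
  have Pk: "P (k p) = p" if "p \<in> BP" for p using b(3)[OF that] by (simp add: k_def)
  have "inj_on P (k ` BP)" using Pk by (auto simp: inj_on_def)
  moreover have "P ` k ` BP = BP" using Pk by (force simp: image_image)
  moreover have "inj_on k BP" using Pk by (metis inj_onI)
  moreover have "P n = 0" if "n \<in> BN" for n using PN BN(1) that by (auto simp: N_def)
  ultimately have ind: "E.independent (BN \<union> k ` BP)" and dis: "BN \<inter> k ` BP = {}"
    and cardk: "card (k ` BP) = card BP"
    using E.independent_Un_kernel[OF P BN(2) finBN, of "k ` BP"] finBP BP(2) by (auto simp: card_image)
  define X where "X = BN \<union> k ` BP"
  have cardX: "card X = E.dim N + E.dim (P ` K)"
    unfolding X_def using card_Un_disjoint[OF finBN finite_imageI[OF finBP] dis] cardk BN(4) BP(4) by simp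
  have finX: "finite X" using finBN finBP by (simp add: X_def)
  \<comment> \<open>For \<open>n\<close> in \<open>BN\<close>, [a n, w + t d] = n + t [a n, d], so
    \<open>L\<close> is the first-order term. The vectors \<open>k p\<close> need no correction:
    \<open>b p\<close> annihilates \<open>w\<close>, so \<open>b p\<close> divided by t yields
    \<open>k p\<close> exactly.\<close>
  obtain L where L: "E.lin L" "\<And>x. x \<in> X \<Longrightarrow> L x = (if x \<in> BN then commutator (a x) d else 0)"
    using EE.linear_independent_extend[OF ind[folded X_def], of "\<lambda>x. if x \<in> BN then commutator (a x) d else 0"]
    by blast
  \<comment> \<open>The value 0 is added to the exceptional set because the lifts are divided by
    t.\<close>
  have fin: "finite (insert 0 {t. \<exists>v\<in>E.span X. v \<noteq> 0 \<and> v + pscale scale t (L v) = 0})"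
    using E.finite_singular_perturbations[OF L(1) finX] by simp
  have bound: "E.dim N + E.dim (P ` K) \<le> E.dim (orbit_space commutator q (w + pscale scale t d))"
    if t: "t \<noteq> 0" "\<not> (\<exists>v\<in>E.span X. v \<noteq> 0 \<and> v + pscale scale t (L v) = 0)" for t
  proof -
    define T where "T v = v + pscale scale t (L v)" for v
    have T: "E.lin T"
      by (rule E.linI) (simp_all only: T_def E.lin_add[OF L(1)] E.lin_scale[OF L(1)]
          E.scale_right_distrib E.scale_left_commute add.assoc add.left_commute)
    have inj: "inj_on T (E.span X)"
    proof (rule inj_onI)
      fix x y assume xy: "x \<in> E.span X" "y \<in> E.span X" "T x = T y"
      have "T (x - y) = 0" using E.lin_diff[OF T] xy(3) by simp
      then show "x = y" using t(2) E.span_diff[OF xy(1,2)] unfolding T_def by (metis right_minus_eq)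
    qed
    have wt: "w + pscale scale t d \<in> M" using w d subspace_M E.subspace_add E.subspace_scale by blast
    have "T x \<in> orbit_space commutator q (w + pscale scale t d)" if x: "x \<in> X" for x
    proof (cases "x \<in> BN")
      case True
      have "commutator (a x) (w + pscale scale t d) = T x"
        using a[OF True] L(2)[OF that] True commutator_simps[OF q_lin[OF a(1)[OF True]]] by (simp only: T_def if_True)
      then show ?thesis using a(1)[OF True] unfolding orbit_space_def by (metis image_eqI)
    next
      case False
      then obtain p where p: "p \<in> BP" "x = k p" using x by (auto simp: X_def)
      note bp = b[OF p(1)] and bl = commutator_simps[OF q_lin[OF b(1)[OF p(1)]]]
      note wl = commutator_simps[OF M_lin[OF wt]]
      have "commutator (pscale scale (inverse t) (b p)) (w + pscale scale t d) = k p"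
        unfolding wl(3) bl(4,6) bp(2) k_def using t by simp
      moreover have "T x = k p" using L(2)[OF that] False p(2) by (simp add: T_def E.scale_zero_right del: pscale_def)
      moreover have "pscale scale (inverse t) (b p) \<in> q" using E.subspace_scale[OF subspace_q bp(1)] .
      ultimately show ?thesis unfolding orbit_space_def by (metis image_eqI)
    qed
    then have sub: "T ` X \<subseteq> orbit_space commutator q (w + pscale scale t d)" by blast
    have "E.independent (T ` X)"
      by (rule EE.linear_independent_injective_image[OF T ind[folded X_def] inj])
    moreover have "card (T ` X) = card X"
      using inj_on_subset[OF inj E.span_superset] by (rule card_image)
    ultimately show ?thesis
      using E.card_le_dim[OF sub _ _ finite_G] orbit_subset[OF wt] M_span cardX by simp
  qed
  show ?thesis
    unfolding N_def[symmetric] K_def[symmetric]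
  proof (rule finite_subset[OF subsetI fin])
    fix t
    assume "t \<in> {t. E.dim (orbit_space commutator q (w + pscale scale t d)) < E.dim N + E.dim (P ` K)}"
    then have "\<not> E.dim N + E.dim (P ` K) \<le> E.dim (orbit_space commutator q (w + pscale scale t d))"
      by (simp only: mem_Collect_eq not_le)
    then have "t = 0 \<or> (\<exists>v\<in>E.span X. v \<noteq> 0 \<and> v + pscale scale t (L v) = 0)"
      using bound[of t] by argo
    then show "t \<in> insert 0 {t. \<exists>v\<in>E.span X. v \<noteq> 0 \<and> v + pscale scale t (L v) = 0}"
      by (simp only: mem_Collect_eq insert_iff)
  qed
qed

text \<open>For each \<open>w\<close>, with \<open>f\<close> and \<open>g\<close> below the orbit
  dimensions in \<open>M\<close> and in the quotient, equality of the indices means Max f = dim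
  [q, w] + Max g. Vinberg's inequality gives one direction. For the other, the spanning hypothesis
  bounds the orbit of the image of \<xi> in the quotient from below, and \<open>R\<close> bounds
  \<open>f\<close> from above.\<close>

lemma GIB_criterion:
  assumes R: "\<And>x. x \<in> M \<Longrightarrow> E.dim (orbit_space commutator q x) \<le> R"
    and ex: "\<And>w. w \<in> M \<Longrightarrow> \<exists>\<xi>\<in>M. \<exists>X. finite X \<and> card X + R \<le> E.dim M \<and> 
      M \<subseteq> E.span (orbit_space commutator q w \<union> orbit_space commutator (annihilator commutator q w) \<xi> \<union> X)"
  shows "lie_GIB (pscale scale) commutator q M"
  unfolding lie_GIB_def Let_def
proof
  fix w assume w: "w \<in> M"
  define N where "N = orbit_space commutator q w"
  define qw where "qw = annihilator commutator q w"
  obtain BN where BN: "BN \<subseteq> N" "E.independent BN" "N \<subseteq> E.span BN" "card BN = E.dim N"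
    by (rule E.basis_exists[of N])
  have NM: "N \<subseteq> M" using orbit_subset[OF w] by (simp add: N_def)
  have N: "E.subspace N" using orbit_subspace[OF w] by (simp add: N_def)
  obtain BM where BM: "BN \<subseteq> BM" "BM \<subseteq> M" "E.independent BM" "M \<subseteq> E.span BM"
    using E.maximal_independent_subset_extend[of BN M] BN NM by blast
  have sBM: "E.span BM = M" using BM(2,4) subspace_M E.span_minimal by blast
  have sBN: "E.span BN = N" using BN(1,3) N E.span_minimal by blast
  have finBM: "finite BM" using finite_independent BM by blast
  have finBN: "finite BN" using finBM BM(1) finite_subset by blast
  define B where "B = BM - BN"
  have B: "finite B" "E.independent B" using finBM BM(3) E.independent_mono by (auto simp: B_def)
  define D where "D = E.span B"
  have cardB: "card B + card BN = card BM"
    using card_Diff_subset[OF finBN BM(1)] card_mono[OF finBM BM(1)] by (simp add: B_def)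
  have dimM: "E.dim M = card BM" using E.dim_unique[OF BM(2,4,3)] by simp
  have DM: "D \<subseteq> M" unfolding D_def using E.span_mono[of B BM] sBM by (auto simp: B_def)
  have Dsub: "E.subspace D" unfolding D_def by (rule E.subspace_span)
  \<comment> \<open>The projection of \<open>M\<close> onto the complement \<open>D\<close> along
    \<open>N\<close>. It models the quotient by \<open>D\<close>, on which \<open>a\<close> acts by
    the commutator followed by \<open>P\<close>.\<close>
  obtain P where P: "E.lin P" "\<And>b. b \<in> BM \<Longrightarrow> P b = (if b \<in> BN then 0 else b)"
    using EE.linear_independent_extend[OF BM(3), of "\<lambda>b. if b \<in> BN then 0 else b"] by blast
  have PN: "P n = 0" if "n \<in> N" for n
    by (rule EE.linear_eq_0_on_span[OF P(1), of BN]) (use P(2) BM(1) that BN(3) in auto)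
  have Pdiff: "u - P u \<in> N \<and> P u \<in> D" if "u \<in> M" for u
  proof -
    have "u \<in> E.span BM" using that sBM by simp
    then show ?thesis
    proof (induction rule: E.span_induct_alt)
      case base
      show ?case
        unfolding E.lin_0[OF P(1)] diff_self using E.subspace_0[OF N] E.subspace_0[OF Dsub] by blast
    next
      case (step c b y)
      have "b - P b \<in> N \<and> P b \<in> D"
        using P(2)[OF step(1)] BN(1) E.subspace_0[OF N] E.subspace_0[OF Dsub] step(1) E.span_base[of b B]
        by (auto simp: B_def D_def simp del: zero_fun_def)
      moreover have "(pscale scale c b + y) - P (pscale scale c b + y) = pscale scale c (b - P b) + (y - P y)"
        unfolding E.lin_add[OF P(1)] E.lin_scale[OF P(1)] by (simp add: E.scale_right_diff_distrib)
      moreover have "P (pscale scale c b + y) = pscale scale c (P b) + P y"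
        unfolding E.lin_add[OF P(1)] E.lin_scale[OF P(1)] ..
      ultimately show ?case
        using step(2) E.subspace_add[OF N E.subspace_scale[OF N]] E.subspace_add[OF Dsub E.subspace_scale[OF Dsub]]
        by metis
    qed
  qed
  have PD: "P d = d" if "d \<in> D" for d
  proof -
    have "P d = id d"
      by (rule EE.linear_eq_on[OF P(1) E.module_hom_id[unfolded module_hom_iff_linear], of d B])
        (use that P(2) in \<open>auto simp: D_def B_def\<close>)
    then show ?thesis by simp
  qed
  have qwq: "a \<in> q" "commutator a w = 0" if "a \<in> qw" for a using that by (auto simp: qw_def annihilator_def)
  \<comment> \<open>Jacobi identity: since [a, w] = 0, [a, [b, w]] = [[a, b], w].\<close>
  have stab: "commutator a n \<in> N" if a: "a \<in> qw" and n: "n \<in> N" for a n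
  proof -
    obtain b where b: "b \<in> q" "n = commutator b w" using n by (auto simp: N_def orbit_space_def)
    note l = lin_simps(1-5)[OF q_lin[OF qwq(1)[OF a]]] lin_simps(1-5)[OF q_lin[OF b(1)]] lin_simps(1-5)[OF M_lin[OF w]]
    have aw: "a (w v) = w (a v)" for v using fun_cong[OF qwq(2)[OF a], of v] by (simp add: commutator_def)
    have "commutator a n = commutator (commutator a b) w"
      by (rule ext) (simp add: b(2) commutator_def l aw)
    then show ?thesis using commutator_q[OF qwq(1)[OF a] b(1)] by (auto simp: N_def orbit_space_def)
  qed
  have Pcomm: "P (commutator a u) = P (commutator a (P u))" if a: "a \<in> qw" and u: "u \<in> M" for a u
  proof -
    have "P (commutator a (u - P u)) = 0" using PN[OF stab[OF a]] Pdiff[OF u] by blast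
    then show ?thesis
      unfolding commutator_simps(5)[OF q_lin[OF qwq(1)[OF a]]] E.lin_diff[OF P(1)] by simp
  qed
  define f where "f x = E.dim (orbit_space commutator q x)" for x
  define g where "g d = E.dim (orbit_space (\<lambda>a u. P (commutator a u)) qw d)" for d
  have ind1: "ind (pscale (*)) (dual_act commutator M) q (dual_space (pscale scale) (+) M) =
      int (card BM) - int (Max (f ` M))"
    unfolding f_def
  proof (rule ind_dual_space[where \<phi> = "\<lambda>x. x"])
    show "vspace (pscale scale :: 'a \<Rightarrow> ('b \<Rightarrow> 'b) \<Rightarrow> 'b \<Rightarrow> 'b)" by (rule vspace_pscale)
    show "M = E.span BM" using sBM by simp
    show "bij_betw (\<lambda>x. x) M M" by (simp add: bij_betw_def)
    show "commutator a (x + y) = commutator a x + commutator a y" if "a \<in> q" for a x y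
      using commutator_simps(4)[OF q_lin[OF that]] .
    show "commutator a (pscale scale c x) = pscale scale c (commutator a x)" if "a \<in> q" for a c x
      using commutator_simps(6)[OF q_lin[OF that]] .
  qed (use finBM BM(3) E.subspace_add[OF subspace_M] E.subspace_scale[OF subspace_M] commutator_M in blast)+
  \<comment> \<open>\<open>P\<close> kills \<open>N\<close>, so it is constant on each coset and the
    image of a coset has a single element.\<close>
  define \<phi> where "\<phi> A = the_elem (P ` A)" for A :: "('b \<Rightarrow> 'b) set"
  have NN: "N + N = N"
  proof
    show "N + N \<subseteq> N" using E.subspace_add[OF N] by (auto simp: set_plus_def)
    show "N \<subseteq> N + N" using E.subspace_0[OF N] by (force simp: set_plus_def)
  qed
  have \<phi>: "\<phi> ({u} + N) = P u" if "u \<in> M" for u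
  proof -
    have "P ` ({u} + N) = {P u}"
      using PN E.subspace_0[OF N] by (force simp: set_plus_def E.lin_add[OF P(1)])
    then show ?thesis by (simp add: \<phi>_def)
  qed
  have coset_eq: "{u} + N = {v} + N" if "u - v \<in> N" for u v
  proof -
    have 1: "{u} + N \<subseteq> {v} + N" if "u - v \<in> N" for u v
    proof
      fix z assume "z \<in> {u} + N"
      then obtain n where n: "n \<in> N" "z = u + n" by (auto simp: set_plus_def)
      have "z = v + ((u - v) + n)" using n by simp
      moreover have "(u - v) + n \<in> N" using E.subspace_add[OF N that n(1)] .
      ultimately show "z \<in> {v} + N" unfolding set_plus_def by blast
    qed
    have "v - u \<in> N" using E.subspace_neg[OF N that] by simp
    then show ?thesis using 1 that by blast
  qed
  have coset_add: "({u} + N) + ({v} + N) = {u + v} + N" for u v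
  proof -
    have "({u} + N) + ({v} + N) = ({u} + {v}) + (N + N)" by (simp only: ac_simps)
    also have "{u} + {v} = {u + v}" by (simp add: set_plus_def)
    finally show ?thesis by (simp only: NN)
  qed
  have coset_smult: "quot_smult (pscale scale) N c ({u} + N) = {pscale scale c u} + N" for c u
  proof
    show "quot_smult (pscale scale) N c ({u} + N) \<subseteq> {pscale scale c u} + N"
    proof
      fix z assume "z \<in> quot_smult (pscale scale) N c ({u} + N)"
      then obtain n n' where n: "n \<in> N" "n' \<in> N" "z = pscale scale c (u + n) + n'"
        by (auto simp: quot_smult_def set_plus_def)
      then have "z = pscale scale c u + (pscale scale c n + n')" by (simp only: E.scale_right_distrib add.assoc)
      moreover have "pscale scale c n + n' \<in> N" using n E.subspace_add[OF N E.subspace_scale[OF N]] by blast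
      ultimately show "z \<in> {pscale scale c u} + N" unfolding set_plus_def by blast
    qed
    have "pscale scale c u \<in> pscale scale c ` ({u} + N)"
      using E.subspace_0[OF N] by (force simp: set_plus_def)
    then show "{pscale scale c u} + N \<subseteq> quot_smult (pscale scale) N c ({u} + N)"
      unfolding quot_smult_def by (intro set_plus_mono2) auto
  qed
  have coset_act: "quot_act commutator N a ({u} + N) = {commutator a u} + N" if a: "a \<in> qw" for a u
  proof
    show "quot_act commutator N a ({u} + N) \<subseteq> {commutator a u} + N"
    proof
      fix z assume "z \<in> quot_act commutator N a ({u} + N)"
      then obtain n n' where n: "n \<in> N" "n' \<in> N" "z = commutator a (u + n) + n'"
        by (auto simp: quot_act_def set_plus_def)
      then have "z = commutator a u + (commutator a n + n')"
        by (simp only: commutator_simps(4)[OF q_lin[OF qwq(1)[OF a]]] add.assoc)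
      moreover have "commutator a n + n' \<in> N" using n E.subspace_add[OF N stab[OF a]] by blast
      ultimately show "z \<in> {commutator a u} + N" unfolding set_plus_def by blast
    qed
    have "commutator a u \<in> commutator a ` ({u} + N)"
      using E.subspace_0[OF N] by (force simp: set_plus_def)
    then show "{commutator a u} + N \<subseteq> quot_act commutator N a ({u} + N)"
      unfolding quot_act_def by (intro set_plus_mono2) auto
  qed
  have ind2: "ind (pscale (*)) (dual_act (quot_act commutator N) (quot_space M N)) qw
      (dual_space (quot_smult (pscale scale) N) (+) (quot_space M N)) =
      int (card B) - int (Max (g ` D))"
    unfolding g_def
  proof (rule ind_dual_space[where \<phi> = \<phi>])
    show "vspace (pscale scale :: 'a \<Rightarrow> ('b \<Rightarrow> 'b) \<Rightarrow> 'b \<Rightarrow> 'b)" by (rule vspace_pscale)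
    show "D = E.span B" by (rule D_def)
    show "bij_betw \<phi> (quot_space M N) D"
      unfolding bij_betw_def
    proof
      show "inj_on \<phi> (quot_space M N)"
      proof (rule inj_onI)
        fix A A' assume "A \<in> quot_space M N" "A' \<in> quot_space M N" and eq: "\<phi> A = \<phi> A'"
        then obtain u v where uv: "u \<in> M" "A = {u} + N" "v \<in> M" "A' = {v} + N" by (auto simp: quot_space_def)
        have "P u = P v" using eq uv \<phi> by simp
        then have "u - v = (u - P u) - (v - P v)" by simp
        moreover have "(u - P u) - (v - P v) \<in> N" using Pdiff[OF uv(1)] Pdiff[OF uv(3)] E.subspace_diff[OF N] by blast
        ultimately have "u - v \<in> N" by (simp only:)
        then show "A = A'" using coset_eq uv by simp
      qed
      show "\<phi> ` quot_space M N = D"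
      proof
        show "\<phi> ` quot_space M N \<subseteq> D" using \<phi> Pdiff by (auto simp: quot_space_def)
        show "D \<subseteq> \<phi> ` quot_space M N"
        proof
          fix d assume d: "d \<in> D"
          then have "d = \<phi> ({d} + N)" using \<phi> DM PD by auto
          then show "d \<in> \<phi> ` quot_space M N" using d DM by (auto simp: quot_space_def)
        qed
      qed
    qed
    show "A + A' \<in> quot_space M N \<and> \<phi> (A + A') = \<phi> A + \<phi> A'"
      if A: "A \<in> quot_space M N" "A' \<in> quot_space M N" for A A'
    proof -
      obtain u v where uv: "u \<in> M" "A = {u} + N" "v \<in> M" "A' = {v} + N" using A by (auto simp: quot_space_def)
      have "u + v \<in> M" using uv E.subspace_add[OF subspace_M] by blast
      then show ?thesis unfolding uv coset_add \<phi>[OF uv(1)] \<phi>[OF uv(3)]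
        using \<phi>[of "u + v"] E.lin_add[OF P(1)] by (auto simp: quot_space_def)
    qed
    show "quot_smult (pscale scale) N c A \<in> quot_space M N \<and>
        \<phi> (quot_smult (pscale scale) N c A) = pscale scale c (\<phi> A)" if A: "A \<in> quot_space M N" for c A
    proof -
      obtain u where u: "u \<in> M" "A = {u} + N" using A by (auto simp: quot_space_def)
      have "pscale scale c u \<in> M" using u E.subspace_scale[OF subspace_M] by blast
      then show ?thesis unfolding u coset_smult \<phi>[OF u(1)]
        using \<phi>[of "pscale scale c u"] E.lin_scale[OF P(1)] by (auto simp: quot_space_def)
    qed
    show "quot_act commutator N a A \<in> quot_space M N \<and>
        \<phi> (quot_act commutator N a A) = P (commutator a (\<phi> A))" if a: "a \<in> qw" and A: "A \<in> quot_space M N" for a A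
    proof -
      obtain u where u: "u \<in> M" "A = {u} + N" using A by (auto simp: quot_space_def)
      have "commutator a u \<in> M" using u commutator_M qwq(1)[OF a] by blast
      then show ?thesis unfolding u coset_act[OF a] \<phi>[OF u(1)] Pcomm[OF a u(1), symmetric]
        using \<phi>[of "commutator a u"] by (auto simp: quot_space_def)
    qed
    show "P (commutator a (x + y)) = P (commutator a x) + P (commutator a y)" if "a \<in> qw" for a x y
      unfolding commutator_simps(4)[OF q_lin[OF qwq(1)[OF that]]] E.lin_add[OF P(1)] ..
    show "P (commutator a (pscale scale c x)) = pscale scale c (P (commutator a x))" if "a \<in> qw" for a c x
      unfolding commutator_simps(6)[OF q_lin[OF qwq(1)[OF that]]] E.lin_scale[OF P(1)] ..
  qed (rule B)+
  have gP: "g d = E.dim (P ` orbit_space commutator qw d)" for d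
    by (simp add: g_def orbit_space_def image_image)
  have fbound: "f x \<le> R" if "x \<in> M" for x using R[OF that] by (simp add: f_def)
  have finf: "finite (f ` M)" by (rule finite_subset[of _ "{..R}"]) (use fbound in auto)
  have vinberg: "\<exists>x\<in>M. card BN + g d \<le> f x" if d: "d \<in> D" for d
  proof -
    have dM: "d \<in> M" using d DM by blast
    have "finite {t. f (w + pscale scale t d) < card BN + g d}"
      using finite_dim_drop[OF w dM P(1) PN[unfolded N_def]] unfolding f_def gP qw_def BN(4) N_def .
    then obtain t where "\<not> f (w + pscale scale t d) < card BN + g d"
      using infinite_field ex_new_if_finite by blast
    moreover have "w + pscale scale t d \<in> M" 
      by (rule E.subspace_add[OF subspace_M w E.subspace_scale[OF subspace_M dM]])
    ultimately show ?thesis by (meson not_less)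
  qed
  have "finite (g ` D)" by (rule finite_subset[of _ "{..R}"]) (use vinberg fbound in fastforce)+
  note fing = this
  have wM: "f ` M \<noteq> {}" using w by blast
  have D0: "g ` D \<noteq> {}" using E.subspace_0[OF Dsub] by blast
  have le1: "card BN + Max (g ` D) \<le> Max (f ` M)"
  proof -
    obtain d where d: "d \<in> D" "Max (g ` D) = g d" using Max_in[OF fing D0] by blast
    obtain x where "x \<in> M" "card BN + g d \<le> f x" using vinberg[OF d(1)] by blast
    then show ?thesis using d(2) Max_ge[OF finf, of "f x"] by fastforce
  qed
  have le2: "Max (f ` M) \<le> card BN + Max (g ` D)"
  proof -
    obtain \<xi> X where \<xi>: "\<xi> \<in> M" and X: "finite X" "card X + R \<le> E.dim M"
      "M \<subseteq> E.span (N \<union> orbit_space commutator qw \<xi> \<union> X)"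
      using ex[OF w] unfolding N_def qw_def by blast
    define Y where "Y = P ` orbit_space commutator qw \<xi>"
    have gY: "g (P \<xi>) = E.dim Y"
    proof -
      have "(\<lambda>a. P (commutator a (P \<xi>))) ` qw = (\<lambda>a. P (commutator a \<xi>)) ` qw"
        by (rule image_cong[OF refl], rule Pcomm[OF _ \<xi>, symmetric])
      then show ?thesis by (simp only: g_def Y_def orbit_space_def image_image)
    qed
    have "orbit_space commutator qw \<xi> \<subseteq> M" using commutator_M[OF qwq(1) \<xi>] by (auto simp: orbit_space_def)
    then have "Y \<subseteq> E.span B" using Pdiff D_def by (auto simp: Y_def)
    obtain BY where BY: "BY \<subseteq> Y" "E.independent BY" "Y \<subseteq> E.span BY" "card BY = E.dim Y"
      by (rule E.basis_exists[of Y])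
    have finBY: "finite BY" using E.independent_span_bound[OF B(1) BY(2)] BY(1) \<open>Y \<subseteq> E.span B\<close> by blast
    \<comment> \<open>\<open>P\<close> kills \<open>N\<close>, so the images of the orbit of
      \<open>\<xi>\<close> and of \<open>X\<close> span \<open>D\<close>; counting dimensions gives
      the bound.\<close>
    have "B \<subseteq> E.span (BY \<union> P ` X)"
    proof
      fix b assume b: "b \<in> B"
      have "P b = b" using PD[of b] E.span_base[OF b] by (simp add: D_def)
      moreover have "b \<in> M" using b BM(2) by (auto simp: B_def)
      then have "P b \<in> P ` E.span (N \<union> orbit_space commutator qw \<xi> \<union> X)" using X(3) by blast
      then have "P b \<in> E.span (P ` (N \<union> orbit_space commutator qw \<xi> \<union> X))"
        by (simp only: EE.linear_span_image[OF P(1)])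
      moreover have "P ` (N \<union> orbit_space commutator qw \<xi> \<union> X) \<subseteq> E.span (BY \<union> P ` X)"
      proof
        fix z assume "z \<in> P ` (N \<union> orbit_space commutator qw \<xi> \<union> X)"
        then consider "z = 0" | "z \<in> Y" | "z \<in> P ` X" using PN by (auto simp: Y_def)
        then show "z \<in> E.span (BY \<union> P ` X)"
          using BY(3) E.span_mono[of BY "BY \<union> P ` X"] E.span_base[of z "BY \<union> P ` X"] E.span_zero
          by cases auto
      qed
      then have "E.span (P ` (N \<union> orbit_space commutator qw \<xi> \<union> X)) \<subseteq> E.span (BY \<union> P ` X)"
        by (rule E.span_minimal[OF _ E.subspace_span])
      ultimately show "b \<in> E.span (BY \<union> P ` X)" by auto
    qed
    then have "card B \<le> card (BY \<union> P ` X)"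
      using E.independent_span_bound[of "BY \<union> P ` X" B] B finBY X(1) by simp
    also have "\<dots> \<le> card BY + card X" 
      using card_Un_le[of BY "P ` X"] card_image_le[OF X(1), of P] by linarith
    finally have "R \<le> card BN + g (P \<xi>)" using X(2) dimM cardB gY BY(4) by simp
    moreover have "g (P \<xi>) \<le> Max (g ` D)" using Max_ge[OF fing] Pdiff[OF \<xi>] by blast
    moreover have "Max (f ` M) \<le> R" using Max_in[OF finf wM] fbound by auto
    ultimately show ?thesis by linarith
  qed
  show "ind (pscale (*)) (dual_act commutator M) q (dual_space (pscale scale) (+) M) =
     ind (pscale (*)) (dual_act (quot_act commutator (orbit_space commutator q w)) (quot_space M (orbit_space commutator q w)))
       (annihilator commutator q w)
       (dual_space (quot_smult (pscale scale) (orbit_space commutator q w)) (+) (quot_space M (orbit_space commutator q w)))"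
    unfolding N_def[symmetric] qw_def[symmetric] ind1 ind2 using le1 le2 cardB by linarith
qed

end


section \<open>The component of degree one has good index behaviour\<close>

context vspace
begin

lemma subspace_eq_of_dim_le:
  assumes "subspace S" "S \<subseteq> T" "T \<subseteq> span X" "finite X" "dim T \<le> dim S"
  shows "S = T"
proof (rule ccontr)
  assume "S \<noteq> T"
  then obtain u where u: "u \<in> T" "u \<notin> S" using assms(2) by blast
  obtain B where B: "B \<subseteq> S" "independent B" "S \<subseteq> span B" "card B = dim S" by (rule basis_exists[of S])
  have "span B \<subseteq> S" using B(1) assms(1) by (rule span_minimal)
  then have uB: "u \<notin> span B" using u by blast
  then have ind: "independent (insert u B)" using B(2) by (rule independent_insertI)
  have sub: "insert u B \<subseteq> T" using u B(1) assms(2) by blast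
  have "finite B" using independent_span_bound[OF assms(4) B(2)] B(1) assms(2,3) by blast
  moreover have "u \<notin> B" using uB span_base by blast
  ultimately have "card (insert u B) = Suc (dim S)" using B(4) by simp
  then show False using card_le_dim[OF sub ind assms(3,4)] assms(5) by simp
qed

text \<open>Peeling off the outermost factor splits the value into a part from \<open>x\<close> and
  t times a part from \<open>x1\<close>, so the coefficient of t^k sees \<open>x1\<close>
  only.\<close>

lemma poly_power_pencil:
  assumes x: "lin x" "lin x1" and \<phi>: "fnl \<phi>"
  shows "\<exists>p. degree p \<le> k \<and> coeff p k = \<phi> ((x1 ^^ k) e) \<and>
    (\<forall>t. \<phi> (((\<lambda>v. x v + t *s x1 v) ^^ k) e) = poly p t)"
  using \<phi>
proof (induction k arbitrary: \<phi>)
  case 0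
  show ?case by (rule exI[of _ "[:\<phi> e:]"]) simp
next
  case (Suc k)
  have "fnl (\<lambda>v. \<phi> (x v))" "fnl (\<lambda>v. \<phi> (x1 v))"
    by (rule fnlI; simp add: lin_simps(1-5)[OF x(1)] lin_simps(1-5)[OF x(2)] lin_simps(6-10)[OF Suc.prems])+
  from Suc.IH[OF this(1)] Suc.IH[OF this(2)] obtain p p1 where
    p: "degree p \<le> k" "\<And>t. \<phi> (x (((\<lambda>v. x v + t *s x1 v) ^^ k) e)) = poly p t" and
    p1: "degree p1 \<le> k" "coeff p1 k = \<phi> (x1 ((x1 ^^ k) e))"
      "\<And>t. \<phi> (x1 (((\<lambda>v. x v + t *s x1 v) ^^ k) e)) = poly p1 t"
    by blast
  show ?case
  proof (intro exI[of _ "p + pCons 0 p1"] conjI allI)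
    show "degree (p + pCons 0 p1) \<le> Suc k"
      using p(1) p1(1) by (intro degree_add_le) (auto intro: order_trans[OF degree_pCons_le])
    show "coeff (p + pCons 0 p1) (Suc k) = \<phi> ((x1 ^^ Suc k) e)"
      using p(1) p1(2) by (simp add: coeff_eq_0)
    show "\<phi> (((\<lambda>v. x v + t *s x1 v) ^^ Suc k) e) = poly (p + pCons 0 p1) t" for t
      by (simp add: lin_simps(6-10)[OF Suc.prems] p(2) p1(3))
  qed
qed

end

lemma finite_zero_poly:
  fixes p :: "'a::field_char_0 poly"
  assumes "finite {t. poly p t \<noteq> 0}" shows "p = 0"
proof (rule ccontr)
  assume "p \<noteq> 0"
  then have "finite ({t. poly p t = 0} \<union> {t. poly p t \<noteq> 0})" using assms poly_roots_finite by blast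
  moreover have "{t. poly p t = 0} \<union> {t. poly p t \<noteq> 0} = UNIV" by blast
  ultimately show False using infinite_UNIV_char_0[where 'a = 'a] by simp
qed

locale cyclic_grading_char_0 = cyclic_grading scale Basis m V
  for scale :: "'a::field_char_0 \<Rightarrow> 'b::ab_group_add \<Rightarrow> 'b" (infixr \<open>*s\<close> 75)
    and Basis :: "'b set" and m :: nat and V :: "nat \<Rightarrow> 'b set"
begin

interpretation E: vspace "pscale scale :: 'a \<Rightarrow> ('b \<Rightarrow> 'b) \<Rightarrow> 'b \<Rightarrow> 'b" by (rule vspace_pscale)

text \<open>The matrix units with respect to \<open>Basis\<close>.\<close>

definition units :: "('b \<Rightarrow> 'b) set" where
  "units = (\<lambda>(b, c) v. representation Basis v b *s c) ` (Basis \<times> Basis)"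

lemma finite_units: "finite units"
  unfolding units_def using finite_Basis by simp

lemma lin_in_span_units:
  assumes "lin T" shows "T \<in> E.span units"
proof -
  have Tv: "T v = (\<Sum>b\<in>Basis. \<Sum>c\<in>Basis. representation Basis (T b) c *s (representation Basis v b *s c))" for v
  proof -
    have ex: "k *s w = (\<Sum>c\<in>Basis. representation Basis w c *s (k *s c))" for k w
    proof -
      have "(\<Sum>c\<in>Basis. representation Basis w c *s c) = w"
        by (rule sum_representation_eq[OF independent_Basis]) (auto simp: span_Basis finite_Basis)
      from arg_cong[OF sym[OF this], of "\<lambda>z. k *s z"] show ?thesis
        by (simp only: scale_sum_right scale_left_commute[of k])
    qed
    show ?thesis unfolding lin_expand[OF assms, of v] by (rule sum.cong[OF refl]) (rule ex)
  qed
  have "T = (\<Sum>b\<in>Basis. \<Sum>c\<in>Basis. pscale scale (representation Basis (T b) c) (\<lambda>v. representation Basis v b *s c))"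
    by (rule ext) (simp only: sum_fun_apply pscale_def, rule Tv)
  moreover have "\<dots> \<in> E.span units"
    by (intro E.span_sum E.span_scale E.span_base) (auto simp: units_def)
  ultimately show ?thesis by simp
qed

sublocale pair: lie_pair scale deg0 deg1 units
proof (intro lie_pair.intro[OF vspace_axioms] lie_pair_axioms.intro)
  show "infinite (UNIV :: 'a set)" by (rule infinite_UNIV_char_0)
  show "E.subspace deg0" "E.subspace deg1" by (fact subspace_deg0 subspace_deg1)+
  show "deg1 \<subseteq> E.span units" using lin_in_span_units deg1D(1) by blast
qed (use deg0D(1) deg1D(1) commutator_deg0 commutator_deg1 finite_units in auto)

text \<open>A nonzero vector is chosen in each component and sent to the next one. The result is not
  nilpotent, which makes it a suitable direction for the pencil below.\<close>

lemma ex_cyclic_shift: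
  assumes e: "e \<in> U 0" "e \<noteq> 0" and nz: "\<And>i. U i \<noteq> {0}"
  obtains x where "x \<in> deg1" "(x ^^ m) e = e"
proof -
  have "\<forall>i. \<exists>u. u \<in> U i \<and> u \<noteq> 0 \<and> (i = 0 \<longrightarrow> u = e)"
    using e nz subspace_0[OF subspace_U] by (metis singletonI subsetI subset_antisym subset_singleton_iff empty_iff insertI1)
  from choice[OF this] obtain d where d: "\<forall>i. d i \<in> U i \<and> d i \<noteq> 0 \<and> (i = 0 \<longrightarrow> d i = e)" ..
  have "\<forall>i. \<exists>\<epsilon>. fnl \<epsilon> \<and> \<epsilon> (d i) = 1" using fnl_with_value d by metis
  from choice[OF this] obtain \<epsilon> where \<epsilon>: "\<forall>i. fnl (\<epsilon> i) \<and> \<epsilon> i (d i) = 1" ..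
  define x where "x v = (\<Sum>i<m. \<epsilon> i (P i v) *s d (Suc i mod m))" for v
  have \<epsilon>P: "\<epsilon> i (P i (u + w)) = \<epsilon> i (P i u) + \<epsilon> i (P i w)" "\<epsilon> i (P i (c *s u)) = c * \<epsilon> i (P i u)" for i u w c
    using \<epsilon> by (simp_all add: lin_add[OF lin_P] lin_scale[OF lin_P] fnl_add fnl_scale)
  have xU: "x u = \<epsilon> (i mod m) u *s d (Suc i mod m)" if u: "u \<in> U i" for u i
  proof -
    have "\<epsilon> j (P j u) *s d (Suc j mod m) = (if j = i mod m then \<epsilon> (i mod m) u *s d (Suc i mod m) else 0)"
      if "j < m" for j
      using P_on[OF u, of j] that \<epsilon> fnl_0 by (auto simp: mod_Suc_eq)
    then have "x u = (\<Sum>j<m. if j = i mod m then \<epsilon> (i mod m) u *s d (Suc i mod m) else 0)" by (simp add: x_def)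
    then show ?thesis using m_pos by simp
  qed
  have dU: "d (i mod m) \<in> U i" for i using d[rule_format, of "i mod m"] U_cong[of "i mod m" i] by simp
  have "x \<in> deg1"
  proof (rule deg1I)
    show "lin x"
      by (rule linI) (simp_all add: x_def \<epsilon>P scale_left_distrib sum.distrib scale_sum_right)
    show "x u \<in> U (Suc i)" if "u \<in> U i" for i u
      unfolding xU[OF that] by (rule subspace_scale[OF subspace_U dU])
  qed
  moreover have "(x ^^ k) e = d (k mod m)" for k
  proof (induction k)
    case (Suc k)
    have "x (d (k mod m)) = d (Suc k mod m)" using xU[OF dU[of k]] \<epsilon> by simp
    then show ?case using Suc by simp
  qed (use d in simp)
  from this[of m] have "(x ^^ m) e = e" using d by simp
  ultimately show thesis by (rule that)
qed

text \<open>A full orbit of \<open>x\<close> alone is no contradiction at once, since the m-th power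
  of \<open>x\<close> may kill \<open>e\<close>. Fullness therefore has to be carried to most
  members of a pencil in which the m-th power does not vanish identically at
  \<open>e\<close>.\<close>

lemma orbit_dim_less:
  assumes e: "U 0 = span {e}" "e \<noteq> 0" and nz: "\<And>i. U i \<noteq> {0}" and x: "x \<in> deg1"
  shows "E.dim (orbit_space commutator deg0 x) < E.dim deg1"
proof (rule ccontr)
  assume "\<not> ?thesis"
  then have full: "E.dim deg1 \<le> E.dim (orbit_space commutator deg0 x)" by simp
  have eU: "e \<in> U 0" using e(1) by (simp add: span_base)
  obtain x1 where x1: "x1 \<in> deg1" "(x1 ^^ m) e = e" using ex_cyclic_shift[OF eU e(2) nz] by blast
  obtain \<epsilon> where \<epsilon>: "fnl \<epsilon>" "\<epsilon> e = 1" using fnl_with_value[OF e(2)] by blast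
  define X where "X t = (\<lambda>v. x v + t *s x1 v)" for t
  obtain p where p: "coeff p m = \<epsilon> ((x1 ^^ m) e)" "\<And>t. \<epsilon> ((X t ^^ m) e) = poly p t"
    using poly_power_pencil[OF deg1D(1)[OF x] deg1D(1)[OF x1(1)] \<epsilon>(1), of m e] unfolding X_def by blast
  have X1: "X t = x + pscale scale t x1" for t by (simp add: X_def fun_eq_iff pscale_def)
  have Xdeg: "X t \<in> deg1" for t
    unfolding X1 by (rule E.subspace_add[OF subspace_deg1 x E.subspace_scale[OF subspace_deg1 x1(1)]])
  have "poly p t = 0" if t: "E.dim deg1 \<le> E.dim (orbit_space commutator deg0 (X t))" for t
  proof -
    have "orbit_space commutator deg0 (X t) = deg1"
      by (rule E.subspace_eq_of_dim_le[OF pair.orbit_subspace[OF Xdeg] pair.orbit_subset[OF Xdeg]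
            pair.M_span finite_units t])
    then obtain a where a: "a \<in> deg0" "X t = commutator a (X t)" using Xdeg[of t] by (auto simp: orbit_space_def)
    have aX: "a (X t v) = X t (a v) + X t v" for v
      using fun_cong[OF a(2), of v] by (simp add: commutator_def algebra_simps)
    note la = lin_simps(1-5)[OF deg0D(1)[OF a(1)]] and lX = lin_simps(1-5)[OF deg1D(1)[OF Xdeg[of t]]]
    have "a e \<in> range (\<lambda>k. k *s e)" using deg0D(2)[OF a(1) eU] by (simp add: e(1) span_singleton)
    then obtain l where l: "a e = l *s e" by blast
    \<comment> \<open>Since [a, X] = X, each application of \<open>X t\<close> raises the eigenvalue
      of \<open>a\<close> by one.\<close>
    have aXk: "a ((X t ^^ k) e) = (l + of_nat k) *s (X t ^^ k) e" for k
    proof (induction k)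
      case (Suc k)
      have "a ((X t ^^ Suc k) e) = X t (a ((X t ^^ k) e)) + (X t ^^ Suc k) e" by (simp add: aX)
      then show ?case by (simp add: Suc.IH lX algebra_simps)
    qed (simp add: l)
    have "(X t ^^ k) e \<in> U k" for k by (induction k) (use eU deg1D(2)[OF Xdeg] in auto)
    from this[of m] have "(X t ^^ m) e \<in> U 0" using U_cong[of m 0] by simp
    then have "(X t ^^ m) e \<in> range (\<lambda>k. k *s e)" by (simp add: e(1) span_singleton)
    then obtain \<mu> where \<mu>: "(X t ^^ m) e = \<mu> *s e" by blast
    \<comment> \<open>After one turn around the cycle the vector is back on the line of
      \<open>e\<close>, where \<open>a\<close> acts by \<open>l\<close> and also by
      \<open>l + m\<close>; in characteristic 0 these differ.\<close>
    have "(l * \<mu>) *s e = ((l + of_nat m) * \<mu>) *s e"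
      using aXk[of m] by (simp add: \<mu> la l mult.commute)
    then have "\<mu> = 0" using e(2) m_pos by (simp add: algebra_simps)
    then show ?thesis using p(2)[of t] \<mu> fnl_0[OF \<epsilon>(1)] by simp
  qed
  \<comment> \<open>With the zero map as projection, \<open>finite_dim_drop\<close> is plain
    semicontinuity of orbit dimension along the pencil.\<close>
  then have "{t. poly p t \<noteq> 0} \<subseteq> {t. E.dim (orbit_space commutator deg0 (x + pscale scale t x1)) <
      E.dim (orbit_space commutator deg0 x) + E.dim ((\<lambda>_. 0) ` orbit_space commutator (annihilator commutator deg0 x) x1)}"
    using full unfolding X1 by (auto simp: not_le[symmetric])
  moreover have "finite \<dots>"
    by (rule pair.finite_dim_drop[OF x x1(1) E.lin_zero]) simp
  ultimately have "finite {t. poly p t \<noteq> 0}" by (rule finite_subset)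
  then have "p = 0" by (rule finite_zero_poly)
  then show False using p(1) x1(2) \<epsilon>(2) by simp
qed

lemma GIB:
  assumes e: "U 0 = span {e}" "e \<noteq> 0" and no3: "\<And>i. small i \<or> small (i + 1) \<or> small (i + 2)"
  shows "lie_GIB (pscale scale) commutator deg0 deg1"
proof (rule pair.GIB_criterion)
  \<comment> \<open>The generic orbit dimension. When every component is nonzero, the strict
    inequality \<open>less\<close> makes dim deg1 positive, so the subtraction does not
    truncate.\<close>
  let ?R = "if \<exists>i. U i = {0} then E.dim deg1 else E.dim deg1 - 1"
  have less: "E.dim (orbit_space commutator deg0 x) < E.dim deg1" if "x \<in> deg1" "\<not> (\<exists>i. U i = {0})" for x
    by (rule orbit_dim_less[OF e _ that(1)]) (use that(2) in blast)
  show "E.dim (orbit_space commutator deg0 x) \<le> ?R" if x: "x \<in> deg1" for x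
    using E.dim_mono_finite[OF pair.orbit_subset[OF x] pair.M_span finite_units] less[OF x] by force
  show "\<exists>\<xi>\<in>deg1. \<exists>X. finite X \<and> card X + ?R \<le> E.dim deg1 \<and>
      deg1 \<subseteq> E.span (orbit_space commutator deg0 x \<union> orbit_space commutator (annihilator commutator deg0 x) \<xi> \<union> X)"
    if x: "x \<in> deg1" for x
  proof -
    obtain \<xi> X where \<xi>: "\<xi> \<in> deg1" "X \<subseteq> deg1" "finite X" "card X \<le> 1" "\<exists>i. U i = {0} \<Longrightarrow> X = {}"
      "deg1 \<subseteq> E.span ((\<lambda>a. commutator a x) ` deg0 \<union>
         (\<lambda>a. commutator a \<xi>) ` {a \<in> deg0. commutator a x = 0} \<union> X)"
      by (rule ex_direction_spanning[OF x no3], rule that)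
    have "card X + ?R \<le> E.dim deg1"
    proof (cases "\<exists>i. U i = {0}")
      case True
      then show ?thesis using \<xi>(5) by simp
    next
      case False
      then show ?thesis using \<xi>(4) less[OF x False] by simp
    qed
    then show ?thesis using \<xi>(1,3,6) unfolding orbit_space_def annihilator_def by blast
  qed
qed

text \<open>Preserving a component is expressed by linear equations, whose derivatives are the same
  equations for \<open>x\<close>. Conversely, 1 + t x lies in the group for all but finitely many t,
  so a polynomial function vanishing on the group vanishes along this whole line.\<close>

lemma lie_algebra_block_GL: "lie_algebra_of scale (block_GL scale m V) = deg0"
proof
  have UV: "U t = V t" if "t < m" for t using that by (simp add: U_def)
  show "lie_algebra_of scale (block_GL scale m V) \<subseteq> deg0"
  proof
    fix x assume x: "x \<in> lie_algebra_of scale (block_GL scale m V)"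
    then have lx: "lin x" by (simp add: lie_algebra_of_def gl_def)
    show "x \<in> deg0"
    proof (rule deg0I[OF lx], rule ccontr)
      fix i u assume u: "u \<in> U i" "x u \<notin> U i"
      obtain \<phi> where \<phi>: "fnl \<phi>" "\<And>v. v \<in> U i \<Longrightarrow> \<phi> v = 0" "\<phi> (x u) = 1"
        using separating_fnl[OF subspace_U u(2)] by blast
      have "poly_fun scale (\<lambda>x. \<phi> (x u))" using \<phi>(1) by (rule poly_fun.matrix_coeff)
      moreover have "\<phi> (g u) = 0" if "g \<in> block_GL scale m V" for g
      proof -
        have "g ` U i = U i" using that m_pos by (simp add: block_GL_def U_def)
        then show ?thesis using u(1) \<phi>(2) by blast
      qed
      moreover have "\<forall>t. poly [:0, 1:] t = \<phi> (u + t *s x u)"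
        using \<phi>(2)[OF u(1)] \<phi>(3) by (simp add: fnl_add[OF \<phi>(1)] fnl_scale[OF \<phi>(1)])
      ultimately have "coeff [:0, 1 :: 'a:] 1 = 0"
        using x unfolding lie_algebra_of_def by blast
      then show False by simp
    qed
  qed
  show "deg0 \<subseteq> lie_algebra_of scale (block_GL scale m V)"
  proof
    fix x assume x: "x \<in> deg0"
    note lx = deg0D(1)[OF x]
    define T where "T t = (\<lambda>v. v + t *s x v)" for t
    have linT: "lin (T t)" for t
      by (rule linI) (simp_all add: T_def lin_simps(1-5)[OF lx] algebra_simps)
    have "T t \<in> block_GL scale m V" if t: "\<not> (\<exists>v\<in>span Basis. v \<noteq> 0 \<and> v + t *s x v = 0)" for t
    proof -
      have inj: "inj (T t)"
      proof (rule injI)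
        fix v w assume "T t v = T t w"
        then have "T t (v - w) = 0" by (simp add: lin_diff[OF linT])
        then have "v - w = 0" using t unfolding T_def span_Basis by blast
        then show "v = w" by simp
      qed
      moreover have "surj (T t)" using linear_inj_imp_surj[OF linT inj] .
      moreover have "T t ` V i = V i" if i: "i < m" for i
      proof (rule subspace_dim_equal)
        show "subspace (T t ` V i)" by (rule subspace_image[OF linT subspace_V[OF i]])
        show "subspace (V i)" by (rule subspace_V[OF i])
        show "T t ` V i \<subseteq> V i"
          using deg0D(2)[OF x, of _ i] UV[OF i] subspace_V[OF i] by (auto simp: T_def subspace_add subspace_scale)
        show "dim (V i) \<le> dim (T t ` V i)"
          using dim_image_inj[OF linT, of t "V i"] inj inj_on_subset by fastforce
      qed
      ultimately show ?thesis using linT by (simp add: block_GL_def GL_def gl_def bij_def)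
    qed
    moreover have "finite {t. \<exists>v\<in>span Basis. v \<noteq> 0 \<and> v + t *s x v = 0}"
      by (rule finite_singular_perturbations[OF lx finite_Basis])
    ultimately have fin: "finite {t. T t \<notin> block_GL scale m V}"
      by (elim finite_subset[rotated]) blast
    have "coeff p 1 = 0" if f: "\<forall>g\<in>block_GL scale m V. f g = 0" "\<forall>t. poly p t = f (\<lambda>v. v + t *s x v)" for f p
    proof -
      have "{t. poly p t \<noteq> 0} \<subseteq> {t. T t \<notin> block_GL scale m V}" using f by (auto simp: T_def)
      then have "p = 0" using finite_zero_poly fin finite_subset by blast
      then show ?thesis by simp
    qed
    then show "x \<in> lie_algebra_of scale (block_GL scale m V)"
      using lx unfolding lie_algebra_of_def gl_def by blast
  qed
qed

text \<open>The eigenvalue equation is s x = \<zeta> x s, so \<open>x\<close> multiplies eigenvalues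
  of \<open>s\<close> by \<zeta>. By primitivity the powers of \<zeta> with exponents below
  \<open>m\<close> are distinct, so eigenvalues separate the components.\<close>

lemma eigenspace_inner_aut:
  assumes \<zeta>: "primitive_root_unity m \<zeta>" and s: "s \<in> GL scale"
    and sV: "\<And>t v. t < m \<Longrightarrow> v \<in> V t \<Longrightarrow> s v = \<zeta> ^ t *s v"
  shows "eigenspace scale (inner_aut s) \<zeta> = deg1"
proof -
  have ls: "lin s" and bij: "bij s" using s by (auto simp: GL_def gl_def)
  have \<zeta>m: "\<zeta> ^ m = 1" and prim: "\<And>k. 0 < k \<Longrightarrow> k < m \<Longrightarrow> \<zeta> ^ k \<noteq> 1"
    using \<zeta> by (auto simp: primitive_root_unity_def)
  have \<zeta>0: "\<zeta> \<noteq> 0" using \<zeta>m m_pos by (metis power_0_left zero_neq_one not_gr_zero)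
  have \<zeta>mod: "\<zeta> ^ (i mod m) = \<zeta> ^ i" for i
  proof -
    have "\<zeta> ^ i = \<zeta> ^ (m * (i div m) + i mod m)" by simp
    also have "\<dots> = \<zeta> ^ (i mod m)" by (simp only: power_add power_mult \<zeta>m power_one mult_1)
    finally show ?thesis ..
  qed
  have \<zeta>inj: "j = k" if "\<zeta> ^ j = \<zeta> ^ k" "j < m" "k < m" for j k
  proof -
    have le: "j = k" if "\<zeta> ^ j = \<zeta> ^ k" "j < m" "k < m" "j \<le> k" for j k
    proof (rule ccontr)
      assume "j \<noteq> k"
      have "\<zeta> ^ k = \<zeta> ^ j * \<zeta> ^ (k - j)" using \<open>j \<le> k\<close> by (simp flip: power_add)
      then have "\<zeta> ^ (k - j) = 1" using that(1) \<zeta>0 by simp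
      then show False using prim[of "k - j"] that \<open>j \<noteq> k\<close> by simp
    qed
    show ?thesis using le[of j k] le[of k j] that by (cases "j \<le> k") auto
  qed
  have sU: "s v = \<zeta> ^ i *s v" if "v \<in> U i" for v i
    using sV[of "i mod m" v] that m_pos by (simp add: U_def \<zeta>mod)
  have eq: "inner_aut s x = pscale scale \<zeta> x \<longleftrightarrow> (\<forall>v. s (x v) = \<zeta> *s x (s v))" for x
  proof
    assume *: "inner_aut s x = pscale scale \<zeta> x"
    show "\<forall>v. s (x v) = \<zeta> *s x (s v)"
    proof
      fix v
      have "inv s (s v) = v" using bij by (simp add: bij_is_inj)
      then show "s (x v) = \<zeta> *s x (s v)"
        using fun_cong[OF *, of "s v"] by (simp add: inner_aut_def pscale_def)
    qed
  next
    assume *: "\<forall>v. s (x v) = \<zeta> *s x (s v)"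
    show "inner_aut s x = pscale scale \<zeta> x"
    proof
      fix w
      have "s (inv s w) = w" using bij by (simp add: bij_is_surj surj_f_inv_f)
      then show "inner_aut s x w = pscale scale \<zeta> x w"
        using * by (simp add: inner_aut_def pscale_def)
    qed
  qed
  have "x \<in> deg1" if lx: "lin x" and *: "\<forall>v. s (x v) = \<zeta> *s x (s v)" for x
  proof (rule deg1I[OF lx])
    fix i u assume u: "u \<in> U i"
    have sy: "s (x u) = \<zeta> ^ Suc i *s x u" using * sU[OF u] by (simp add: lin_scale[OF lx])
    \<comment> \<open>The component of \<open>x u\<close> at \<open>j\<close> is multiplied by
      \<open>s\<close> with \<zeta>^j and also with \<zeta>^(i+1), and these numbers differ.\<close>
    have Pj: "P j (x u) = 0" if j: "j < m" "j \<noteq> Suc i mod m" for j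
    proof -
      have "P j (s v) = \<zeta> ^ j *s P j v" for v
      proof (rule lin_eq_on_U[where f = "\<lambda>v. P j (s v)" and g = "\<lambda>v. \<zeta> ^ j *s P j v"])
        show "lin (\<lambda>v. P j (s v))" "lin (\<lambda>v. \<zeta> ^ j *s P j v)"
          by (rule lin_comp[OF lin_P ls], rule lin_cmult[OF lin_P])
        show "P j (s u) = \<zeta> ^ j *s P j u" if "k < m" "u \<in> U k" for k u
          using P_on[OF that(2), of j] sU[OF that(2)] j(1) that(1) by (auto simp: lin_scale[OF lin_P])
      qed
      then have "\<zeta> ^ j *s P j (x u) = \<zeta> ^ Suc i *s P j (x u)"
        using sy lin_scale[OF lin_P] by metis
      moreover have "\<zeta> ^ j \<noteq> \<zeta> ^ Suc i"
        using \<zeta>inj[OF _ j(1), of "Suc i mod m"] j(2) m_pos unfolding \<zeta>mod by auto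
      ultimately show ?thesis by (simp only: scale_cancel_right) blast
    qed
    have "x u = (\<Sum>j<m. P j (x u))" by (simp only: P_sum)
    also have "\<dots> = (\<Sum>j<m. if j = Suc i mod m then P (Suc i) (x u) else 0)"
      using Pj P_cong[of "Suc i mod m" "Suc i"] by (intro sum.cong) auto
    also have "\<dots> = P (Suc i) (x u)" using m_pos by simp
    finally show "x u \<in> U (Suc i)" using P_in by metis
  qed
  moreover have "s (x v) = \<zeta> *s x (s v)" if x: "x \<in> deg1" for x v
  proof (rule lin_eq_on_U[where f = "\<lambda>v. s (x v)" and g = "\<lambda>v. \<zeta> *s x (s v)"])
    show "lin (\<lambda>v. s (x v))" "lin (\<lambda>v. \<zeta> *s x (s v))"
      using deg1D(1)[OF x] ls lin_comp lin_cmult by blast+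
    show "s (x u) = \<zeta> *s x (s u)" if "u \<in> U i" for i u
      using sU[OF deg1D(2)[OF x that]] sU[OF that] by (simp add: lin_scale[OF deg1D(1)[OF x]])
  qed
  ultimately show ?thesis using deg1D(1) by (auto simp: eigenspace_def gl_def eq)
qed

lemma small_of_dim_le_1:
  assumes "dim (U i) \<le> 1" shows "small i"
proof -
  obtain B where B: "B \<subseteq> U i" "independent B" "U i \<subseteq> span B" "card B = dim (U i)"
    by (rule basis_exists[of "U i"])
  have "span B = U i" using B(1,3) subspace_U span_minimal by blast
  moreover consider "B = {}" | b where "B = {b}"
    using B(4) assms finiteI_independent[OF B(2)] by (metis One_nat_def card_0_eq card_1_singletonE le_Suc_eq le_zero_eq)
  ultimately show ?thesis unfolding small_def by cases (metis span_empty span_insert_0)+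
qed

end

theorem proposition4p17:
  fixes scale :: "'a::{alg_closed_field, field_char_0} \<Rightarrow> 'v::ab_group_add \<Rightarrow> 'v"
    and Basis :: "'v set"
    and m :: nat and \<zeta> :: 'a
    and V :: "nat \<Rightarrow> 'v set" and r :: "nat \<Rightarrow> nat"
    and s :: "'v \<Rightarrow> 'v" and \<theta> :: "('v \<Rightarrow> 'v) \<Rightarrow> 'v \<Rightarrow> 'v"
  assumes "finite_dimensional_vector_space scale Basis"
    and "primitive_root_unity m \<zeta>"
    and "direct_decomposition scale m V"
    and "\<And>t. t < m \<Longrightarrow> vector_space.dim scale (V t) = r t"
    and "s \<in> GL scale"
    and "\<And>t v. t < m \<Longrightarrow> v \<in> V t \<Longrightarrow> s v = scale (\<zeta> ^ t) v"
    and "\<theta> = inner_aut s"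
    and "has_order scale \<theta> m"
    and "r 0 = 1"
    and "\<not> (\<exists>i. i + 2 < m \<and> r i > 1 \<and> r (i + 1) > 1 \<and> r (i + 2) > 1)"
  shows "aut_GIB scale m \<zeta> V \<theta>"
proof -
  interpret F: finite_dimensional_vector_space scale Basis by (rule assms(1))
  have m: "m > 0" using assms(2) by (simp add: primitive_root_unity_def)
  interpret cyclic_grading_char_0 scale Basis m V
    by unfold_locales (use m assms(3) in auto)
  have dimU: "F.dim (U i) = r (i mod m)" for i using assms(4) m by (simp add: U_def)
  have U0: "F.dim (U 0) = 1" using dimU[of 0] assms(9) by simp
  then obtain e where e: "U 0 = F.span {e}" using small_of_dim_le_1[of 0] by (auto simp: small_def)
  have e0: "e \<noteq> 0" using U0 unfolding e by auto
  have small: "small i" if "r (i mod m) \<le> 1" for i using small_of_dim_le_1 dimU that by simp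
  have no3: "small i \<or> small (i + 1) \<or> small (i + 2)" for i
  proof -
    define j where "j = i mod m"
    have j: "j < m" using m by (simp add: j_def)
    have jk: "(i + k) mod m = (j + k) mod m" for k by (simp add: j_def mod_simps)
    \<comment> \<open>The hypothesis speaks of substrings without wrapping around. A window that
      crosses the end of the vector contains the index 0, where the multiplicity is 1.\<close>
    consider "j + 2 < m" | "j + 2 = m" | "j + 1 = m" using j by linarith
    then show ?thesis
    proof cases
      case 1
      then have "r j \<le> 1 \<or> r (j + 1) \<le> 1 \<or> r (j + 2) \<le> 1" using assms(10) by (auto simp: not_less[symmetric])
      then show ?thesis using small[of i] small[of "i + 1"] small[of "i + 2"] 1 jk[of 0] jk[of 1] jk[of 2] by auto
    next
      case 2
      then have "r ((i + 2) mod m) \<le> 1" using jk[of 2] assms(9) by simp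
      then show ?thesis using small[of "i + 2"] by blast
    next
      case 3
      then have "r ((i + 1) mod m) \<le> 1" using jk[of 1] assms(9) by simp
      then show ?thesis using small[of "i + 1"] by blast
    qed
  qed
  have "lie_GIB (pscale scale) commutator deg0 deg1" by (rule GIB[OF e e0 no3])
  moreover have "eigenspace scale (inner_aut s) \<zeta> = deg1"
    by (rule eigenspace_inner_aut[OF assms(2,5)]) (rule assms(6))
  ultimately show ?thesis
    by (simp only: aut_GIB_def adjoint_pair_GIB_def lie_algebra_block_GL assms(7))
qed

end
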